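(* Let $b\in(0,1]$ and let $(b_N)_{N\ge1}$ be integers with $0\le b_N<N$ and $b_N/N\to b$ as $N\to\infty$. Let $(a_j)_{j\in\mathbb Z}$ be random variables on one probability space satisfying either the Hermitian assumptions (H) or the real symmetric assumptions (S) given in the context, and let $T_N=(\eta_{ij}a_{i-j})_{i,j=1}^N$, where $\eta_{ij}=1$ if $|i-j|\le b_N$ and $\eta_{ij}=0$ otherwise. Put $$X_N=\frac{T_N}{\sqrt{(2-b)\,b\,N}}.$$ Then, almost surely, the eigenvalue distribution $\mu_{X_N}$ converges weakly, as $N\to\infty$, to a (nonrandom) symmetric probability distribution $\gamma_T(b)$ on $\mathbb R$ which is determined by its even moments: for every $k\in\mathbb N$, $$m_{2k}(\gamma_T(b))=\frac{1}{(2-b)^{k}}\sum_{\pi\in\mathcal P_2(2k)}\int_{[0,1]\times[-1,1]^k}\prod_{j=1}^{2k}I_{[0,1]}\Big(x_0+b\sum_{i=1}^{j}\epsilon_\pi(i)\,x_{\pi(i)}\Big)\prod_{l=0}^{k}\mathrm dx_l,$$ where $\epsilon_\pi(i)=1$ if $i$ is the smallest element of $\pi^{-1}(\pi(i))$ (the block of $\pi$ containing $i$), and $\epsilon_\pi(i)=-1$ otherwise.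
   Context: For a real symmetric or complex Hermitian $N\times N$ matrix $A$ with eigenvalues $\lambda_1,\dots,\lambda_N$, its eigenvalue distribution is the probability measure $\mu_A=\frac1N\sum_{j=1}^N\delta_{\lambda_j}$; if $A$ is random, $\mu_A$ is a random measure. Assumptions (H) (Hermitian Toeplitz case): $(a_j)_{j\in\mathbb Z}$ are complex random variables with $a_0$ real, $\operatorname{Re}a_j=\operatorname{Re}a_{-j}$ and $\operatorname{Im}a_j=-\operatorname{Im}a_{-j}$ for $j=1,2,\dots$; the family $\{a_0\}\cup\{\operatorname{Re}a_j,\operatorname{Im}a_j\}_{j\in\mathbb N}$ consists of independent real random variables; $\mathbb E[a_j]=0$ and $\mathbb E[|a_j|^2]=1$ for all $j\in\mathbb Z$; and $\sup_{j\in\mathbb Z}\mathbb E[|a_j|^k]=C_k<\infty$ for every $k\in\mathbb N$. Assumptions (S) (real symmetric Toeplitz case): $a_j=a_{-j}$ for $j=0,1,\dots$; $(a_j)_{j\ge0}$ is a sequence of independent real random variables; $\mathbb E[a_j]=0$ and $\mathbb E[|a_j|^2]=1$ for all $j\ge0$; and $\sup_{j\ge0}\mathbb E[|a_j|^k]=C_k<\infty$ for every $k\in\mathbb N$. Partitions: $[n]=\{1,\dots,n\}$. $\mathcal P_2(2k)$ is the set of pair partitions of $[2k]$, i.e. partitions into blocks of exactly two elements. The blocks $V_1,\dots,V_k$ of $\pi\in\mathcal P_2(2k)$ are numbered so that their smallest elements satisfy $s_1<s_2<\cdots<s_k$, and $\pi(i)=j$ means $i\in V_j$. $I_B$ denotes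 the indicator function of a set $B$, and $m_{r}(\gamma)=\int x^r\,\gamma(\mathrm dx)$. *)

theory Defs
  imports
    "HOL-Probability.Probability"
    "HOL-Library.Disjoint_Sets"
    "HOL-Computational_Algebra.Fundamental_Theorem_Algebra"
    "Jordan_Normal_Form.Char_Poly"
begin

section \<open>Random Toeplitz entries\<close>

locale toeplitz_entries = prob_space M for M :: "'w measure" +
  fixes a :: "int \<Rightarrow> 'w \<Rightarrow> complex"
  assumes entry_measurable: "random_variable borel (a j)"
    and entry_mean: "expectation (a j) = 0"
    and entry_variance: "expectation (\<lambda>\<omega>. (cmod (a j \<omega>))\<^sup>2) = 1"
    and entry_moment_integrable: "integrable M (\<lambda>\<omega>. cmod (a j \<omega>) ^ k)"
    and entry_moment_bounded: "bdd_above (range (\<lambda>j. expectation (\<lambda>\<omega>. cmod (a j \<omega>) ^ k)))"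

text \<open>Hermitian case. In the index set \<open>UNIV <+> {1..}\<close>, \<open>Inl j\<close> stands for \<open>Re a\<^sub>j\<close> with
  \<open>j \<ge> 0\<close> (and \<open>Re a\<^sub>0 = a\<^sub>0\<close>), and \<open>Inr j\<close> for \<open>Im a\<^sub>j\<close> with \<open>j \<ge> 1\<close>.\<close>

locale hermitian_toeplitz_entries = toeplitz_entries +
  assumes diag_real: "\<omega> \<in> space M \<Longrightarrow> a 0 \<omega> \<in> \<real>"
    and Re_sym: "j \<ge> 1 \<Longrightarrow> \<omega> \<in> space M \<Longrightarrow> Re (a j \<omega>) = Re (a (- j) \<omega>)"
    and Im_antisym: "j \<ge> 1 \<Longrightarrow> \<omega> \<in> space M \<Longrightarrow> Im (a j \<omega>) = - Im (a (- j) \<omega>)"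
    and indep: "indep_vars (\<lambda>_. borel)
      (\<lambda>i \<omega>. case i of Inl j \<Rightarrow> Re (a (int j) \<omega>) | Inr j \<Rightarrow> Im (a (int j) \<omega>))
      (UNIV <+> {1..})"

locale symmetric_toeplitz_entries = toeplitz_entries +
  assumes entry_real: "\<omega> \<in> space M \<Longrightarrow> a j \<omega> \<in> \<real>"
    and entry_sym: "j \<ge> 0 \<Longrightarrow> \<omega> \<in> space M \<Longrightarrow> a j \<omega> = a (- j) \<omega>"
    and indep: "indep_vars (\<lambda>_. borel) (\<lambda>(j::nat) \<omega>. Re (a (int j) \<omega>)) UNIV"


section \<open>Band Toeplitz matrices and eigenvalue distributions\<close>

definition band_toeplitz :: "nat \<Rightarrow> nat \<Rightarrow> (int \<Rightarrow> complex) \<Rightarrow> complex Matrix.mat" where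
  "band_toeplitz N m c = Matrix.mat N N (\<lambda>(i, j).
     (if \<bar>int i - int j\<bar> \<le> int m then 1 else 0) * c (int i - int j))"

text \<open>\<open>proots (char_poly A)\<close> is the multiset of the \<open>N\<close> eigenvalues of an \<open>N \<times> N\<close> complex
  matrix, so this is \<open>1/N \<Sum>\<^sub>j \<delta>(\<lambda>\<^sub>j)\<close>. It is meant for \<open>N \<ge> 1\<close> and Hermitian \<open>A\<close>, where
  \<open>Re\<close> only turns the (real) complex eigenvalues into elements of type \<open>real\<close>.\<close>

definition eigenvalue_distribution :: "complex Matrix.mat \<Rightarrow> real measure" where
  "eigenvalue_distribution A = distr (measure_pmf (pmf_of_multiset (proots (char_poly A)))) borel Re"


section \<open>Pair partitions\<close>

definition pair_partitions :: "nat \<Rightarrow> nat set set set" where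
  "pair_partitions n = {\<pi>. partition_on {1..n} \<pi> \<and> (\<forall>V\<in>\<pi>. card V = 2)}"

definition block_of :: "nat set set \<Rightarrow> nat \<Rightarrow> nat set" where
  "block_of \<pi> i = (THE V. V \<in> \<pi> \<and> i \<in> V)"

text \<open>Blocks are numbered from 1 in the order of their smallest elements, so the number of
  a block is the number of blocks whose smallest element does not exceed its own.\<close>

definition block_number :: "nat set set \<Rightarrow> nat \<Rightarrow> nat" where
  "block_number \<pi> i = card {V \<in> \<pi>. Min V \<le> Min (block_of \<pi> i)}"

definition block_sign :: "nat set set \<Rightarrow> nat \<Rightarrow> real" where
  "block_sign \<pi> i = (if i = Min (block_of \<pi> i) then 1 else - 1)"


section \<open>The limit distribution\<close>

definition partition_integral :: "real \<Rightarrow> nat \<Rightarrow> nat set set \<Rightarrow> real" where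
  "partition_integral b k \<pi> =
     (LINT x : (\<Pi>\<^sub>E l\<in>{0..k}. if l = 0 then {0..1} else {-1..1}) | (\<Pi>\<^sub>M l\<in>{0..k}. lborel).
        (\<Prod>j=1..2*k. indicator {0..1}
           (x 0 + b * (\<Sum>i=1..j. block_sign \<pi> i * x (block_number \<pi> i)))))"

definition limit_moment :: "real \<Rightarrow> nat \<Rightarrow> real" where
  "limit_moment b k = 1 / (2 - b) ^ k * (\<Sum>\<pi>\<in>pair_partitions (2 * k). partition_integral b k \<pi>)"

text \<open>\<open>has_bochner_integral\<close> asserts that the moment exists as well as its value.\<close>

definition is_limit_distribution :: "real \<Rightarrow> real measure \<Rightarrow> bool" where
  "is_limit_distribution b \<gamma> \<longleftrightarrow>
     real_distribution \<gamma> \<and> distr \<gamma> borel uminus = \<gamma> \<and>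
     (\<forall>k. has_bochner_integral \<gamma> (\<lambda>x. x ^ (2 * k)) (limit_moment b k))"

end

theory Submission
  imports Defs "Jordan_Normal_Form.Schur_Decomposition"
begin

text \<open>The proof is the method of moments. The two cases are treated at once: both sets of assumptions make the
\<open>a\<^sub>j\<close> with \<open>j \<ge> 0\<close> independent with mean 0, variance 1 and bounded moments,
and both give \<open>a\<^bsub>-j\<^esub> = cnj a\<^sub>j\<close>, so that the matrices are Hermitian.

A power of a Toeplitz matrix has a trace that is a sum over closed words of steps: \<open>tr T\<^sup>r\<close>
is the sum, over step sequences \<open>d\<^sub>1, \<dots>, d\<^sub>r\<close> with \<open>\<bar>d\<^sub>l\<bar>
\<le> b\<^sub>N\<close> and total 0, of \<open>a (d\<^sub>1) \<dots> a (d\<^sub>r)\<close> times the number of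
starting points from which the path with these steps stays in \<open>[0, N)\<close>
(\<open>trace_band_toeplitz_pow\<close>). That number is at most \<open>N\<close>, so what matters is how many
words have a nonzero expectation.

By independence and mean 0, every value \<open>\<bar>d\<^sub>l\<bar>\<close> must occur at least twice in such a
word. A word of length \<open>2 k\<close> therefore has at most \<open>k\<close> free values, and fewer unless
the values are matched in pairs. If some pair consists of two equal steps instead of two opposite ones, the
condition that the total is 0 becomes a nontrivial linear equation and again costs a degree of freedom. Up to a
relative error \<open>O(1/N)\<close>, the mean trace is thus a sum over pair partitions \<open>\<pi>\<close> and
over free values \<open>x\<^sub>1, \<dots>, x\<^sub>k\<close> (\<open>expectation_trace_sum_even\<close>); each
inner sum is a Riemann sum for the integral that belongs to \<open>\<pi>\<close>
(\<open>normalized_start_counts_tendsto\<close>). Odd moments vanish in the limit for lack of free values.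

For almost sure convergence, the fourth power of the centred trace is expanded into four words. A term survives
only if all values are repeated and each word shares a value with another one. Such quadruples have at most
\<open>2 r\<close> free values, and two of these are lost, to the four conditions of total 0 or to further
repetitions (\<open>four_linked_words_determine\<close>). The fourth central moments of the normalised traces
are therefore \<open>O(N\<^sup>-\<^sup>2)\<close>, which is summable.

Finally, the limiting moments are bounded by \<open>(2 k)! / k!\<close> because a set of \<open>2 k\<close>
elements has at most \<open>(2 k)! / (2\<^sup>k k!)\<close> pairings. With this growth a characteristic function
is the limit of its Taylor polynomials, so the moments determine the distribution, and convergence of all
moments implies weak convergence (\<open>weak_conv_of_moments\<close>), the existence of the limit coming from
tightness.\<close>

section \<open>The method of moments\<close>

lemma char_taylor_bound:
  fixes \<mu> :: "real measure"
  assumes "real_distribution \<mu>" and "\<And>k. integrable \<mu> (\<lambda>x. x ^ k)"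
  shows "cmod (char \<mu> t - (\<Sum>j\<le>2*k. ((\<i> * t) ^ j / fact j) * (\<integral>x. x ^ j \<partial>\<mu>)))
    \<le> 2 * (\<bar>t\<bar> ^ (2 * k) / fact (2 * k) * (\<integral>x. x ^ (2 * k) \<partial>\<mu>))"
proof -
  have "\<bar>x\<bar> ^ (2 * k) = x ^ (2 * k)" for x :: real
    by (simp add: power_even_abs)
  then show ?thesis
    using real_distribution.char_approx1[OF assms(1), of "2*k" t] assms(2) by simp
qed

lemma distribution_eqI_moments:
  fixes \<mu> \<nu> :: "real measure" and mom :: "nat \<Rightarrow> real"
  assumes \<mu>: "real_distribution \<mu>" "\<And>k. has_bochner_integral \<mu> (\<lambda>x. x ^ k) (mom k)"
    and \<nu>: "real_distribution \<nu>" "\<And>k. has_bochner_integral \<nu> (\<lambda>x. x ^ k) (mom k)"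
    and growth: "\<And>t. (\<lambda>k. t ^ (2 * k) / fact (2 * k) * mom (2 * k)) \<longlonglongrightarrow> 0"
  shows "\<mu> = \<nu>"
proof (rule Levy_uniqueness[OF \<mu>(1) \<nu>(1)], rule ext)
  fix t :: real
  let ?s = "\<lambda>k. (\<Sum>j\<le>2*k. ((\<i> * t) ^ j / fact j) * complex_of_real (mom j))"
  have "norm (char \<mu> t - char \<nu> t) \<le> 4 * (\<bar>t\<bar> ^ (2 * k) / fact (2 * k) * mom (2 * k))" for k
  proof -
    have 1: "norm (char \<mu> t - ?s k) \<le> 2 * (\<bar>t\<bar> ^ (2 * k) / fact (2 * k) * mom (2 * k))"
      using char_taylor_bound[OF \<mu>(1), of t k] \<mu>(2)
      by (simp add: has_bochner_integral_iff)
    have 2: "norm (char \<nu> t - ?s k) \<le> 2 * (\<bar>t\<bar> ^ (2 * k) / fact (2 * k) * mom (2 * k))"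
      using char_taylor_bound[OF \<nu>(1), of t k] \<nu>(2)
      by (simp add: has_bochner_integral_iff)
    have "norm (char \<mu> t - char \<nu> t) \<le> norm (char \<mu> t - ?s k) + norm (char \<nu> t - ?s k)"
      using norm_triangle_ineq4[of "char \<mu> t - ?s k" "char \<nu> t - ?s k"] by simp
    then show ?thesis using 1 2 by linarith
  qed
  moreover have "(\<lambda>k. 4 * (\<bar>t\<bar> ^ (2 * k) / fact (2 * k) * mom (2 * k))) \<longlonglongrightarrow> 0"
    using tendsto_mult_left[OF growth[of "\<bar>t\<bar>"], of 4] by simp
  ultimately have "norm (char \<mu> t - char \<nu> t) \<le> 0"
    by (intro tendsto_lowerbound[where F = sequentially]) auto
  then show "char \<mu> t = char \<nu> t" by simp
qed

text \<open>Weak convergence alone does not carry over to moments, because mass may escape to infinity. Here all moments of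
the \<open>\<mu> n\<close> converge, hence are bounded, which makes the powers \<open>x ^ k\<close> uniformly
integrable: they may be replaced by powers of the truncation of \<open>x\<close> to \<open>[-R, R]\<close>,
which are bounded and continuous.\<close>
lemma weak_conv_moment:
  fixes \<mu> :: "nat \<Rightarrow> real measure"
  assumes \<mu>: "\<And>n. real_distribution (\<mu> n)" "\<And>n k. integrable (\<mu> n) (\<lambda>x. x ^ k)"
    and lim: "\<And>k. (\<lambda>n. \<integral>x. x ^ k \<partial>\<mu> n) \<longlonglongrightarrow> mom k"
    and \<gamma>: "real_distribution \<gamma>" and conv: "weak_conv_m \<mu> \<gamma>"
  shows "has_bochner_integral \<gamma> (\<lambda>x. x ^ k) (mom k)"
proof -
  interpret \<gamma>: real_distribution \<gamma> by fact
  define c where "c R = (\<lambda>x::real. max (-R) (min R x))" for R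
  have c_meas [measurable]: "c R \<in> borel_measurable borel" for R
    by (auto simp: c_def)
  have c_cont: "isCont (\<lambda>x. (c R x) ^ j) x" for R x and j :: nat
    unfolding c_def by (intro continuous_intros)
  have c_bdd: "\<bar>c R x\<bar> \<le> R" if "R \<ge> 0" for R x using that by (auto simp: c_def)
  have c_le: "\<bar>c R x\<bar> \<le> \<bar>x\<bar>" if "R \<ge> 0" for R x using that by (auto simp: c_def)
  have c_conv: "(\<lambda>R::nat. c (real R) x ^ j) \<longlonglongrightarrow> x ^ j" for x j
  proof -
    obtain R0 :: nat where R0: "\<bar>x\<bar> \<le> real R0" using real_arch_simple by blast
    have "eventually (\<lambda>R::nat. c (real R) x ^ j = x ^ j) sequentially"
      using eventually_ge_at_top[of R0] by eventually_elim (use R0 in \<open>auto simp: c_def max_def min_def intro!: arg_cong[where f = "\<lambda>y. y ^ j"]\<close>)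
    then show ?thesis by (rule tendsto_eventually)
  qed
  have trunc: "(\<lambda>n. \<integral>x. c R x ^ j \<partial>\<mu> n) \<longlonglongrightarrow> (\<integral>x. c R x ^ j \<partial>\<gamma>)" if "R \<ge> 0" for R j
    using that c_bdd[OF that]
    by (intro weak_conv_imp_integral_bdd_continuous_conv[where B = "R ^ j"] \<mu>(1) \<gamma> conv c_cont)
       (auto simp: power_abs intro!: power_mono)
  have int_c: "integrable M (\<lambda>x. c R x ^ j)" if "R \<ge> 0" "real_distribution M" for R j and M
  proof -
    interpret M: real_distribution M by fact
    show ?thesis using c_bdd[OF that(1)]
      by (intro M.integrable_const_bound[where B = "R ^ j"])
         (auto simp: power_abs intro!: power_mono AE_I2)
  qed
  \<comment> \<open>Fatou's lemma along \<open>R \<rightarrow> \<infinity>\<close> shows that the even moments of the limit are finite.\<close>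
  have c_even: "c R x ^ (2 * j) \<le> x ^ (2 * j)" if "R \<ge> 0" for R x j
    using power_mono[OF c_le[OF that, of x] abs_ge_zero, of "2*j"] by (simp add: power_even_abs)
  have even_fin: "(\<integral>x. c R x ^ (2 * j) \<partial>\<gamma>) \<le> mom (2 * j)" if "R \<ge> 0" for R j
  proof (rule LIMSEQ_le[OF trunc[OF that] lim], intro exI allI impI)
    fix n show "(\<integral>x. c R x ^ (2 * j) \<partial>\<mu> n) \<le> (\<integral>x. x ^ (2 * j) \<partial>\<mu> n)"
      by (intro integral_mono int_c that \<mu> c_even)
  qed
  have even_int: "integrable \<gamma> (\<lambda>x. x ^ (2 * j))" for j
  proof (rule integrableI_bounded)
    have "(\<integral>\<^sup>+x. ennreal (x ^ (2 * j)) \<partial>\<gamma>) = (\<integral>\<^sup>+x. liminf (\<lambda>R. ennreal (c (real R) x ^ (2 * j))) \<partial>\<gamma>)"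
      by (intro nn_integral_cong lim_imp_Liminf[symmetric]) (auto intro!: tendsto_ennrealI c_conv)
    also have "\<dots> \<le> liminf (\<lambda>R. \<integral>\<^sup>+x. ennreal (c (real R) x ^ (2 * j)) \<partial>\<gamma>)"
      by (intro nn_integral_liminf) auto
    also have "\<dots> = liminf (\<lambda>R. ennreal (\<integral>x. c (real R) x ^ (2 * j) \<partial>\<gamma>))"
      by (subst nn_integral_eq_integral) (auto intro!: int_c \<gamma>)
    also have "\<dots> \<le> liminf (\<lambda>R::nat. ennreal (mom (2 * j)))"
      by (intro Liminf_mono always_eventually allI ennreal_leI even_fin) auto
    also have "\<dots> < \<infinity>" by (simp add: Liminf_const)
    finally show "(\<integral>\<^sup>+x. ennreal (norm (x ^ (2 * j))) \<partial>\<gamma>) < \<infinity>"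
      by (simp add: power_abs power_even_abs)
  qed auto
  have abs_le: "\<bar>x\<bar> ^ j \<le> 1 + x ^ (2 * j)" for x :: real and j
  proof -
    have "x ^ (2 * j) = (\<bar>x\<bar> ^ j)\<^sup>2"
      by (metis even_two_times_div_two power_even_abs power_mult mult.commute even_mult_iff even_numeral)
    moreover have "0 \<le> (\<bar>x\<bar> ^ j)\<^sup>2 - 2 * \<bar>x\<bar> ^ j + 1"
      using zero_le_power2[of "\<bar>x\<bar> ^ j - 1"] by (simp add: power2_diff)
    moreover have "0 \<le> \<bar>x\<bar> ^ j" by simp
    ultimately show ?thesis by linarith
  qed
  have int: "integrable \<gamma> (\<lambda>x. x ^ k)"
    by (rule Bochner_Integration.integrable_bound[where f = "\<lambda>x. 1 + x ^ (2 * k)"])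
       (use even_int[of k] abs_le[of _ k] in \<open>auto simp: power_abs\<close>)
  \<comment> \<open>Where truncation changes \<open>x\<close>, the factor \<open>\<bar>x\<bar> ^ (k + 2) / R\<close> is at least 1; a higher even moment
    therefore bounds the truncation error uniformly in \<open>n\<close>.\<close>
  have err: "\<bar>x ^ k - c R x ^ k\<bar> \<le> 2 * x ^ (2 * (k + 1)) / R" if R: "R \<ge> 1" for R x
  proof (cases "\<bar>x\<bar> \<le> R")
    case True
    then have "c R x = x" by (auto simp: c_def)
    moreover have "0 \<le> 2 * x ^ (2 * (k + 1)) / R"
      using R by (intro divide_nonneg_nonneg mult_nonneg_nonneg zero_le_even_power) auto
    ultimately show ?thesis by (metis abs_zero diff_self)
  next
    case False
    have "\<bar>x ^ k - c R x ^ k\<bar> \<le> \<bar>x\<bar> ^ k + \<bar>c R x\<bar> ^ k"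
      using abs_triangle_ineq4[of "x ^ k" "c R x ^ k"] by (simp add: power_abs)
    also have "\<dots> \<le> 2 * \<bar>x\<bar> ^ k" using power_mono[OF c_le[of R x], of k] R by simp
    also have "\<dots> \<le> 2 * \<bar>x\<bar> ^ k * (\<bar>x\<bar> ^ (k + 2) / R)"
    proof -
      have "R * 1 \<le> \<bar>x\<bar> * \<bar>x\<bar> ^ (k + 1)"
        using False R by (intro mult_mono one_le_power) auto
      then have "1 \<le> \<bar>x\<bar> ^ (k + 2) / R" using R by (simp add: field_simps)
      then show ?thesis using mult_left_mono[of 1 "\<bar>x\<bar> ^ (k + 2) / R" "2 * \<bar>x\<bar> ^ k"] by simp
    qed
    also have "\<dots> = 2 * \<bar>x\<bar> ^ (2 * (k + 1)) / R"
      by (simp add: power_add field_simps power_mult power2_eq_square power_mult_distrib)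
    finally show ?thesis by (simp add: power_even_abs)
  qed
  have "(\<lambda>n. \<integral>x. x ^ k \<partial>\<mu> n) \<longlonglongrightarrow> (\<integral>x. x ^ k \<partial>\<gamma>)"
  proof (rule LIMSEQ_I)
    fix e :: real assume e: "e > 0"
    have "Bseq (\<lambda>n. \<integral>x. x ^ (2 * (k + 1)) \<partial>\<mu> n)"
      using lim[of "2 * (k+1)"] by (intro convergent_imp_Bseq) (auto simp: convergent_def)
    then obtain K where K: "K > 0" "\<And>n. \<bar>\<integral>x. x ^ (2 * (k + 1)) \<partial>\<mu> n\<bar> \<le> K"
      by (auto simp: Bseq_def)
    define K' where "K' = max K (\<integral>x. x ^ (2 * (k + 1)) \<partial>\<gamma>)"
    have K': "K' > 0" using K by (auto simp: K'_def)
    define R where "R = max 1 (8 * K' / e)"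
    have R: "R \<ge> 1" "2 * K' / R \<le> e / 4" using e K' by (auto simp: R_def field_simps max_def)
    have tr: "\<bar>(\<integral>x. x ^ k \<partial>M) - (\<integral>x. c R x ^ k \<partial>M)\<bar> \<le> e / 4"
      if M: "real_distribution M" "integrable M (\<lambda>x. x ^ k)" "integrable M (\<lambda>x. x ^ (2 * (k+1)))"
        "(\<integral>x. x ^ (2 * (k + 1)) \<partial>M) \<le> K'" for M
    proof -
      have I: "integrable M (\<lambda>x. c R x ^ k)" using R by (intro int_c M) auto
      have "\<bar>(\<integral>x. x ^ k \<partial>M) - (\<integral>x. c R x ^ k \<partial>M)\<bar> = \<bar>\<integral>x. x ^ k - c R x ^ k \<partial>M\<bar>"
        using M I by simp
      also have "\<dots> \<le> (\<integral>x. \<bar>x ^ k - c R x ^ k\<bar> \<partial>M)" by (rule integral_abs_bound)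
      also have "\<dots> \<le> (\<integral>x. 2 * x ^ (2 * (k + 1)) / R \<partial>M)"
        using M I err[OF R(1)] by (intro integral_mono) auto
      also have "\<dots> = 2 * (\<integral>x. x ^ (2 * (k + 1)) \<partial>M) / R" by simp
      also have "\<dots> \<le> 2 * K' / R" using M(4) R by (intro divide_right_mono mult_left_mono) auto
      finally show ?thesis using R by simp
    qed
    obtain n0 where n0: "\<And>n. n \<ge> n0 \<Longrightarrow> \<bar>(\<integral>x. c R x ^ k \<partial>\<mu> n) - (\<integral>x. c R x ^ k \<partial>\<gamma>)\<bar> < e / 4"
      using LIMSEQ_D[OF trunc[of R k], of "e/4"] R e by auto
    have "norm ((\<integral>x. x ^ k \<partial>\<mu> n) - (\<integral>x. x ^ k \<partial>\<gamma>)) < e" if "n \<ge> n0" for n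
    proof -
      have "\<bar>(\<integral>x. x ^ k \<partial>\<mu> n) - (\<integral>x. c R x ^ k \<partial>\<mu> n)\<bar> \<le> e / 4"
        using K(2)[of n] by (intro tr \<mu>) (auto simp: K'_def)
      moreover have "\<bar>(\<integral>x. x ^ k \<partial>\<gamma>) - (\<integral>x. c R x ^ k \<partial>\<gamma>)\<bar> \<le> e / 4"
        by (intro tr \<gamma> int even_int) (auto simp: K'_def)
      ultimately show ?thesis using n0[OF that] e unfolding real_norm_def by linarith
    qed
    then show "\<exists>n0. \<forall>n\<ge>n0. norm ((\<integral>x. x ^ k \<partial>\<mu> n) - (\<integral>x. x ^ k \<partial>\<gamma>)) < e" by blast
  qed
  then have "(\<integral>x. x ^ k \<partial>\<gamma>) = mom k" using lim[of k] LIMSEQ_unique by blast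
  then show ?thesis using int by (simp add: has_bochner_integral_iff)
qed

lemma tight_if_second_moments_bounded:
  fixes \<mu> :: "nat \<Rightarrow> real measure"
  assumes \<mu>: "\<And>n. real_distribution (\<mu> n)" "\<And>n. integrable (\<mu> n) (\<lambda>x. x ^ 2)"
    and bdd: "\<And>n. (\<integral>x. x ^ 2 \<partial>\<mu> n) \<le> K"
  shows "tight \<mu>"
  unfolding tight_def
proof (intro conjI allI impI \<mu>(1))
  fix e :: real assume e: "e > 0"
  have "0 \<le> (\<integral>x. x ^ 2 \<partial>\<mu> 0)" by simp
  then have K: "K \<ge> 0" using bdd[of 0] by linarith
  define R where "R = sqrt (2 * (K + 1) / e)"
  have R: "R > 0" "R ^ 2 = 2 * (K + 1) / e" using K e by (auto simp: R_def intro!: divide_pos_pos)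
  have "1 - e < measure (\<mu> n) {-R<..R}" for n
  proof -
    interpret real_distribution "\<mu> n" by (rule \<mu>)
    have "prob {x \<in> space (\<mu> n). x ^ 2 \<ge> R ^ 2} \<le> expectation (\<lambda>x. x ^ 2) / R ^ 2"
      using R(1) by (intro integral_Markov_inequality_measure[where A = "space (\<mu> n)"] \<mu>(2)) auto
    also have "\<dots> \<le> K / R ^ 2" using bdd[of n] by (intro divide_right_mono) auto
    also have "\<dots> < e"
    proof -
      have "K < e * R ^ 2" using R(2) K e by simp
      then show ?thesis using R(1) by (simp add: pos_divide_less_eq)
    qed
    finally have *: "prob {x. x ^ 2 \<ge> R ^ 2} < e" by simp
    have "1 - prob {-R<..R} = prob (UNIV - {-R<..R})"
      using prob_compl[of "{-R<..R}"] by simp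
    also have "\<dots> \<le> prob {x. x ^ 2 \<ge> R ^ 2}"
    proof (intro finite_measure_mono subsetI)
      fix x assume "x \<in> UNIV - {-R<..R}"
      then have "\<bar>R\<bar> \<le> \<bar>x\<bar>" using R by auto
      then show "x \<in> {x. x ^ 2 \<ge> R ^ 2}" by (simp add: abs_le_square_iff)
    qed simp
    finally show ?thesis using * by linarith
  qed
  moreover have "-R < R" using R by simp
  ultimately show "\<exists>a b. a < b \<and> (\<forall>n. 1 - e < measure (\<mu> n) {a<..b})" by blast
qed

text \<open>Tightness gives weak limits along subsequences, all of them have the moments \<open>mom\<close>, and the growth
condition identifies them; so the whole sequence converges.\<close>
lemma weak_conv_of_moments:
  fixes \<mu> :: "nat \<Rightarrow> real measure"
  assumes \<mu>: "\<And>n. real_distribution (\<mu> n)" "\<And>n k. integrable (\<mu> n) (\<lambda>x. x ^ k)"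
    and lim: "\<And>k. (\<lambda>n. \<integral>x. x ^ k \<partial>\<mu> n) \<longlonglongrightarrow> mom k"
    and growth: "\<And>t. (\<lambda>k. t ^ (2 * k) / fact (2 * k) * mom (2 * k)) \<longlonglongrightarrow> 0"
  shows "\<exists>\<gamma>. real_distribution \<gamma> \<and> (\<forall>k. has_bochner_integral \<gamma> (\<lambda>x. x ^ k) (mom k)) \<and> weak_conv_m \<mu> \<gamma>"
proof -
  have "Bseq (\<lambda>n. \<integral>x. x ^ 2 \<partial>\<mu> n)"
    using lim[of 2] by (intro convergent_imp_Bseq) (auto simp: convergent_def)
  then obtain K where "\<And>n. \<bar>\<integral>x. x ^ 2 \<partial>\<mu> n\<bar> \<le> K" by (auto simp: Bseq_def)
  then have tight: "tight \<mu>"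
    by (intro tight_if_second_moments_bounded[where K = K] \<mu>) (auto dest: abs_le_D1)
  have sub: "\<exists>r M. strict_mono (r::nat\<Rightarrow>nat) \<and> real_distribution M \<and> weak_conv_m (\<mu> \<circ> s \<circ> r) M \<and>
       (\<forall>k. has_bochner_integral M (\<lambda>x. x ^ k) (mom k))" if s: "strict_mono s" for s
  proof -
    obtain r M where r: "strict_mono (r::nat\<Rightarrow>nat)" "real_distribution M" "weak_conv_m (\<mu> \<circ> s \<circ> r) M"
      using tight_imp_convergent_subsubsequence[OF tight s] by blast
    have "strict_mono (s \<circ> r)" using s r(1) by (simp add: strict_mono_o)
    have "has_bochner_integral M (\<lambda>x. x ^ k) (mom k)" for k
    proof (rule weak_conv_moment[where \<mu> = "\<mu> \<circ> s \<circ> r"])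
      fix k show "(\<lambda>n. \<integral>x. x ^ k \<partial>(\<mu> \<circ> s \<circ> r) n) \<longlonglongrightarrow> mom k"
        using LIMSEQ_subseq_LIMSEQ[OF lim \<open>strict_mono (s \<circ> r)\<close>] by (simp add: o_def)
    qed (use r \<mu> in auto)
    then show ?thesis using r by blast
  qed
  obtain r0 \<gamma> where \<gamma>: "real_distribution \<gamma>" "\<And>k. has_bochner_integral \<gamma> (\<lambda>x. x ^ k) (mom k)"
    using sub[of id] by (auto simp: strict_mono_def)
  have "weak_conv_m \<mu> \<gamma>"
  proof (rule tight_subseq_weak_converge[OF \<mu>(1) \<gamma>(1) tight])
    fix s :: "nat \<Rightarrow> nat" and \<nu> assume s: "strict_mono s" "real_distribution \<nu>" "weak_conv_m (\<mu> \<circ> s) \<nu>"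
    have "has_bochner_integral \<nu> (\<lambda>x. x ^ k) (mom k)" for k
    proof (rule weak_conv_moment[where \<mu> = "\<mu> \<circ> s"])
      fix k show "(\<lambda>n. \<integral>x. x ^ k \<partial>(\<mu> \<circ> s) n) \<longlonglongrightarrow> mom k"
        using LIMSEQ_subseq_LIMSEQ[OF lim s(1)] by (simp add: o_def)
    qed (use s \<mu> in auto)
    then have "\<nu> = \<gamma>" using distribution_eqI_moments[of \<nu> mom \<gamma>] s \<gamma> growth by blast
    then show "weak_conv_m (\<mu> \<circ> s) \<gamma>" using s by simp
  qed
  then show ?thesis using \<gamma> by blast
qed

section \<open>Growth of the limiting moments\<close>

definition pairings :: "'a set \<Rightarrow> 'a set set set" where
  "pairings A = {\<pi>. partition_on A \<pi> \<and> (\<forall>V\<in>\<pi>. card V = 2)}"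

lemma pair_partitions_eq: "pair_partitions n = pairings {1..n}"
  by (simp add: pair_partitions_def pairings_def)

lemma finite_pairings: "finite A \<Longrightarrow> finite (pairings A)"
  by (rule finite_subset[of _ "Pow (Pow A)"]) (auto simp: pairings_def partition_on_def)

text \<open>In fact equality holds: remove the pair of a fixed element, whose partner can be chosen in \<open>2 k -
1\<close> ways.\<close>
lemma card_pairings_le:
  assumes "finite A" "card A = 2 * k"
  shows "card (pairings A) * (2 ^ k * fact k) \<le> fact (2 * k)"
  using assms
proof (induction k arbitrary: A)
  case 0
  then have "A = {}" by simp
  then have "pairings A \<subseteq> {{}}" by (auto simp: pairings_def partition_on_def)
  then have "card (pairings A) \<le> card {{} :: 'a set set}" by (intro card_mono) auto
  then show ?case by simp
next
  case (Suc k)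
  then have "A \<noteq> {}" by auto
  then obtain x where x: "x \<in> A" by blast
  have sub: "pairings A \<subseteq> (\<Union>y\<in>A - {x}. insert {x, y} ` pairings (A - {x, y}))"
  proof
    fix \<pi> assume \<pi>: "\<pi> \<in> pairings A"
    then obtain V where V: "V \<in> \<pi>" "x \<in> V"
      using x by (auto simp: pairings_def partition_on_def)
    then have "card V = 2" using \<pi> by (auto simp: pairings_def)
    then obtain y where y: "V = {x, y}" "y \<noteq> x"
      using V(2) by (auto simp: card_2_iff doubleton_eq_iff)
    have "y \<in> A" using y V \<pi> by (auto simp: pairings_def partition_on_def)
    have dj: "disjnt V (\<Union>(\<pi> - {V}))"
      using \<pi> V by (auto simp: pairings_def partition_on_def disjoint_def disjnt_def)
    have "\<Union>(\<pi> - {V}) = A - V"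
      using \<pi> V dj by (auto simp: pairings_def partition_on_def disjnt_def)
    then have "\<pi> - {V} \<in> pairings (A - {x, y})"
      using \<pi> y by (auto simp: pairings_def partition_on_def disjoint_def)
    moreover have "\<pi> = insert {x, y} (\<pi> - {V})" using V y by auto
    ultimately show "\<pi> \<in> (\<Union>y\<in>A - {x}. insert {x, y} ` pairings (A - {x, y}))"
      using \<open>y \<in> A\<close> y by blast
  qed
  have fin: "finite (pairings (A - {x, y}))" for y
    using Suc.prems by (intro finite_pairings) auto
  have c: "card (A - {x, y}) = 2 * k" if "y \<in> A - {x}" for y
    using Suc.prems that x by (subst card_Diff_subset) auto
  have "card (pairings A) \<le> card (\<Union>y\<in>A - {x}. insert {x, y} ` pairings (A - {x, y}))"
    using Suc.prems fin by (intro card_mono sub) auto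
  also have "\<dots> \<le> (\<Sum>y\<in>A - {x}. card (insert {x, y} ` pairings (A - {x, y})))"
    using Suc.prems by (intro card_UN_le) auto
  also have "\<dots> \<le> (\<Sum>y\<in>A - {x}. card (pairings (A - {x, y})))"
    by (intro sum_mono card_image_le fin)
  finally have "card (pairings A) * (2 ^ k * fact k)
      \<le> (\<Sum>y\<in>A - {x}. card (pairings (A - {x, y})) * (2 ^ k * fact k))"
    by (metis mult_le_mono1 sum_distrib_right)
  also have "\<dots> \<le> (\<Sum>y\<in>A - {x}. fact (2 * k))"
    using Suc.prems c by (intro sum_mono Suc.IH) auto
  also have "\<dots> = (2 * k + 1) * fact (2 * k)" using Suc.prems x by simp
  finally have "card (pairings A) * (2 ^ k * fact k) * (2 * k + 2)
      \<le> (2 * k + 1) * fact (2 * k) * (2 * k + 2)"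
    by (intro mult_le_mono1)
  then show ?case by (simp add: algebra_simps)
qed

lemma partition_integral_bounds:
  shows partition_integral_nonneg: "0 \<le> partition_integral b k \<pi>"
    and partition_integral_le: "partition_integral b k \<pi> \<le> 2 ^ k"
proof -
  define D :: "(nat \<Rightarrow> real) set" where "D = (\<Pi>\<^sub>E l\<in>{0..k}. if l = 0 then {0..1} else {-1..1})"
  define P where "P = (\<Pi>\<^sub>M l\<in>{0..k}. (lborel :: real measure))"
  define f where "f = (\<lambda>x :: nat \<Rightarrow> real. (\<Prod>j=1..2*k. indicator {0..1}
           (x 0 + b * (\<Sum>i=1..j. block_sign \<pi> i * x (block_number \<pi> i)))) :: real)"
  have eq: "partition_integral b k \<pi> = (\<integral>x. indicator D x *\<^sub>R f x \<partial>P)"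
    unfolding partition_integral_def set_lebesgue_integral_def D_def P_def f_def ..
  interpret product_sigma_finite "\<lambda>_::nat. lborel :: real measure"
    by standard
  have D: "D \<in> sets P" unfolding D_def P_def by (intro sets_PiM_I_finite) auto
  have "emeasure P D = (\<Prod>l\<in>{0..k}. emeasure lborel (if l = 0 then {0..1} else {-1..1::real}))"
    unfolding P_def D_def by (rule emeasure_PiM) auto
  also have "\<dots> = (\<Prod>l\<in>{0..k}. ennreal (if l = 0 then 1 else 2))"
    by (intro prod.cong) auto
  also have "\<dots> = ennreal (\<Prod>l\<in>{0..k}. if l = 0 then 1 else 2)"
    by (intro prod_ennreal) auto
  also have "(\<Prod>l\<in>{0..k}. if l = 0 then 1 else 2 :: real) = 2 ^ k"
    by (simp add: prod.atLeast0_atMost_Suc_shift prod.atLeast_Suc_atMost)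
  finally have em: "emeasure P D = ennreal (2 ^ k)" .
  have f01: "0 \<le> f x" "f x \<le> 1" for x
    unfolding f_def by (auto intro!: prod_nonneg prod_le_1)
  show "0 \<le> partition_integral b k \<pi>"
    unfolding eq using f01 by (intro integral_nonneg_AE) auto
  have "(\<integral>x. indicator D x *\<^sub>R f x \<partial>P) \<le> (\<integral>x. indicator D x \<partial>P)"
  proof (rule integral_mono')
    show "integrable P (indicat_real D)" using D em by (intro integrable_real_indicator) auto
    show "indicator D x *\<^sub>R f x \<le> indicat_real D x" for x using f01[of x] by (auto simp: indicator_def)
    show "0 \<le> indicat_real D x" for x by auto
  qed
  also have "\<dots> = 2 ^ k" using D em by (simp add: measure_def)
  finally show "partition_integral b k \<pi> \<le> 2 ^ k" unfolding eq .
qed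

lemma limit_moment_bounds:
  assumes "b \<le> 1"
  shows limit_moment_nonneg: "0 \<le> limit_moment b k"
    and limit_moment_le: "limit_moment b k \<le> fact (2 * k) / fact k"
proof -
  have b: "(2 - b) ^ k \<ge> 1" using assms by (intro one_le_power) auto
  show "0 \<le> limit_moment b k"
    unfolding limit_moment_def using b by (intro mult_nonneg_nonneg sum_nonneg partition_integral_nonneg) auto
  have "limit_moment b k \<le> 1 * (\<Sum>\<pi>\<in>pair_partitions (2 * k). 2 ^ k)"
    unfolding limit_moment_def using b
    by (intro mult_mono sum_mono partition_integral_le sum_nonneg partition_integral_nonneg) auto
  also have "\<dots> = real (card (pairings {1..2*k})) * 2 ^ k"
    by (simp add: pair_partitions_eq)
  also have "\<dots> \<le> fact (2 * k) / fact k"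
  proof -
    have "real (card (pairings {1..2*k}) * (2 ^ k * fact k)) \<le> real (fact (2 * k))"
      by (intro of_nat_mono card_pairings_le) auto
    then show ?thesis by (simp add: field_simps)
  qed
  finally show "limit_moment b k \<le> fact (2 * k) / fact k" .
qed

text \<open>The bound \<open>(2 k)! / k!\<close> is the moment of order \<open>2 k\<close> of a Gaussian distribution of
variance 2, whose characteristic function is entire.\<close>
lemma limit_moment_growth:
  assumes "b \<le> 1"
  shows "(\<lambda>k. t ^ (2 * k) / fact (2 * k) * limit_moment b k) \<longlonglongrightarrow> 0"
proof (rule Lim_null_comparison)
  have "norm (t ^ (2 * k) / fact (2 * k) * limit_moment b k) \<le> (t\<^sup>2) ^ k / fact k" for k
  proof -
    have "norm (t ^ (2 * k) / fact (2 * k) * limit_moment b k) = t ^ (2 * k) / fact (2 * k) * limit_moment b k"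
      using limit_moment_nonneg[OF assms, of k] by (simp add: zero_le_even_power)
    also have "\<dots> \<le> t ^ (2 * k) / fact (2 * k) * (fact (2 * k) / fact k)"
      by (intro mult_left_mono limit_moment_le assms) (simp add: zero_le_even_power)
    finally show ?thesis by (simp add: power_mult)
  qed
  then show "\<forall>\<^sub>F k in sequentially. norm (t ^ (2 * k) / fact (2 * k) * limit_moment b k) \<le> (t\<^sup>2) ^ k / fact k"
    by simp
  show "(\<lambda>k. (t\<^sup>2) ^ k / fact k) \<longlonglongrightarrow> 0" using summable_LIMSEQ_zero[OF summable_exp[of "t\<^sup>2"]] by (simp add: field_simps)
qed

section \<open>Traces of powers and eigenvalues\<close>

definition mat_trace :: "'a::comm_ring_1 Matrix.mat \<Rightarrow> 'a" where
  "mat_trace A = (\<Sum>i<dim_row A. A $$ (i, i))"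

lemma mat_trace_mult_commute:
  assumes A: "A \<in> carrier_mat n n" and B: "B \<in> carrier_mat n n"
  shows "mat_trace (A * B) = mat_trace (B * A)"
proof -
  have "mat_trace (A * B) = (\<Sum>i<n. \<Sum>j<n. A $$ (i, j) * B $$ (j, i))"
    using A B by (auto simp: mat_trace_def scalar_prod_def atLeast0LessThan intro!: sum.cong)
  also have "\<dots> = (\<Sum>j<n. \<Sum>i<n. A $$ (i, j) * B $$ (j, i))" by (rule sum.swap)
  also have "\<dots> = mat_trace (B * A)"
    using A B by (auto simp: mat_trace_def scalar_prod_def atLeast0LessThan mult.commute intro!: sum.cong)
  finally show ?thesis .
qed

lemma upper_triangular_mult:
  fixes A :: "'a::comm_ring_1 Matrix.mat"
  assumes A: "A \<in> carrier_mat n n" "upper_triangular A"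
    and B: "B \<in> carrier_mat n n" "upper_triangular B"
  shows "upper_triangular (A * B)"
    and "i < n \<Longrightarrow> (A * B) $$ (i, i) = A $$ (i, i) * B $$ (i, i)"
proof -
  have entry: "(A * B) $$ (i, j) = (\<Sum>l<n. A $$ (i, l) * B $$ (l, j))" if "i < n" "j < n" for i j
    using that A(1) B(1) by (auto simp: scalar_prod_def atLeast0LessThan)
  have zA: "A $$ (i, l) = 0" if "l < i" "i < n" for i l
    using A that by (auto simp: upper_triangular_def)
  have zB: "B $$ (i, l) = 0" if "l < i" "i < n" for i l
    using B that by (auto simp: upper_triangular_def)
  show "upper_triangular (A * B)"
  proof (rule upper_triangularI)
    fix i j assume ij: "j < i" "i < dim_row (A * B)"
    then have "(A * B) $$ (i, j) = (\<Sum>l<n. A $$ (i, l) * B $$ (l, j))"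
      using A by (intro entry) auto
    also have "\<dots> = 0"
    proof (intro sum.neutral ballI)
      fix l assume "l \<in> {..<n}"
      then show "A $$ (i, l) * B $$ (l, j) = 0"
        using zA[of l i] zB[of j l] ij A(1) by (cases "l < i") auto
    qed
    finally show "(A * B) $$ (i, j) = 0" .
  qed
  assume i: "i < n"
  have "(A * B) $$ (i, i) = (\<Sum>l<n. if l = i then A $$ (i, i) * B $$ (i, i) else 0)"
    unfolding entry[OF i i]
  proof (intro sum.cong refl)
    fix l assume "l \<in> {..<n}"
    then show "A $$ (i, l) * B $$ (l, i) = (if l = i then A $$ (i, i) * B $$ (i, i) else 0)"
      using zA[of l i] zB[of i l] i by (cases l i rule: linorder_cases) auto
  qed
  then show "(A * B) $$ (i, i) = A $$ (i, i) * B $$ (i, i)" using i by simp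
qed

lemma upper_triangular_pow:
  fixes A :: "'a::comm_ring_1 Matrix.mat"
  assumes A: "A \<in> carrier_mat n n" "upper_triangular A"
  shows "upper_triangular (A ^\<^sub>m r)" "\<And>i. i < n \<Longrightarrow> (A ^\<^sub>m r) $$ (i, i) = A $$ (i, i) ^ r"
proof (induction r)
  case 0
  { case 1 show ?case using A by auto }
  { case 2 then show ?case using A by auto }
next
  case (Suc r)
  have c: "A ^\<^sub>m r \<in> carrier_mat n n" using A by simp
  { case 1 show ?case using upper_triangular_mult(1)[OF c Suc(1) A] by simp }
  { case 2 then show ?case using upper_triangular_mult(2)[OF c Suc(1) A] Suc(2) by simp }
qed

lemma sum_mset_eq_sum_count:
  fixes f :: "'a \<Rightarrow> 'b::comm_semiring_1"
  shows "(\<Sum>x\<in>#E. f x) = (\<Sum>x\<in>set_mset E. of_nat (count E x) * f x)"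
proof (induction E)
  case (add y E)
  have "(\<Sum>x\<in>set_mset (add_mset y E). of_nat (count (add_mset y E) x) * f x)
      = (\<Sum>x\<in>insert y (set_mset E). of_nat (count E x) * f x + (if x = y then f y else 0))"
    by (intro sum.cong) (auto simp: algebra_simps)
  also have "\<dots> = (\<Sum>x\<in>insert y (set_mset E). of_nat (count E x) * f x) + f y"
    by (simp add: sum.distrib)
  also have "(\<Sum>x\<in>insert y (set_mset E). of_nat (count E x) * f x)
      = (\<Sum>x\<in>set_mset E. of_nat (count E x) * f x)"
    by (cases "y \<in># E") (auto simp: insert_absorb not_in_iff)
  finally show ?case using add by (simp add: add.commute)
qed simp

text \<open>By Schur decomposition the matrix is similar to an upper triangular one, whose powers have the powers of the
eigenvalues on the diagonal.\<close>
lemma mat_trace_pow_eq_sum_eigenvalues: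
  fixes A :: "complex Matrix.mat"
  assumes A: "A \<in> carrier_mat n n"
  shows "mat_trace (A ^\<^sub>m r) = (\<Sum>e\<in>#proots (char_poly A). e ^ r)"
proof -
  obtain es where es: "char_poly A = (\<Prod>e\<leftarrow>es. [:- e, 1:])"
    using char_poly_factorized[OF A] by blast
  have proots: "proots (char_poly A) = mset es"
    unfolding es
  proof (induction es)
    case (Cons a es)
    have "(\<Prod>e\<leftarrow>es. [:- e, 1:]) \<noteq> 0" by (auto simp: prod_list_zero_iff)
    then have "proots ([:- a, 1:] * (\<Prod>e\<leftarrow>es. [:- e, 1:])) = {#a#} + mset es"
      using Cons by (subst proots_mult) auto
    then show ?case by (simp del: mult_pCons_left)
  qed simp
  obtain B P Q where "schur_decomposition A es = (B, P, Q)" by (metis prod_cases3)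
  from schur_decomposition[OF A es this]
  have sim: "similar_mat_wit A B P Q" and ut: "upper_triangular B" and dg: "diag_mat B = es" by auto
  have cm: "B \<in> carrier_mat n n" "P \<in> carrier_mat n n" "Q \<in> carrier_mat n n" "Q * P = 1\<^sub>m n"
    using similar_mat_witD2[OF A sim] by auto
  have simr: "similar_mat_wit (A ^\<^sub>m r) (B ^\<^sub>m r) P Q" by (rule similar_mat_wit_pow[OF sim])
  have Ar: "A ^\<^sub>m r \<in> carrier_mat n n" using A by simp
  have "mat_trace (A ^\<^sub>m r) = mat_trace (P * (B ^\<^sub>m r) * Q)"
    using similar_mat_witD2[OF Ar simr] by simp
  also have "\<dots> = mat_trace (Q * (P * (B ^\<^sub>m r)))"
    using cm by (intro mat_trace_mult_commute[of _ n]) auto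
  also have "Q * (P * (B ^\<^sub>m r)) = (Q * P) * (B ^\<^sub>m r)"
    using cm by (intro assoc_mult_mat[symmetric]) auto
  also have "\<dots> = B ^\<^sub>m r" using cm by (simp add: left_mult_one_mat[of _ n n])
  also have "mat_trace (B ^\<^sub>m r) = (\<Sum>i<n. B $$ (i, i) ^ r)"
    using cm upper_triangular_pow(2)[OF cm(1) ut] by (auto simp: mat_trace_def)
  also have "\<dots> = (\<Sum>e\<leftarrow>es. e ^ r)"
    using cm unfolding dg[symmetric] diag_mat_def
    by (auto simp: o_def sum_list_distinct_conv_sum_set atLeast0LessThan)
  also have "\<dots> = (\<Sum>e\<in>#proots (char_poly A). e ^ r)"
    unfolding proots by (metis mset_map sum_mset_sum_list)
  finally show ?thesis .
qed

lemma hermitian_eigenvalue_real: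
  fixes A :: "complex Matrix.mat"
  assumes A: "A \<in> carrier_mat n n"
    and herm: "\<And>i j. i < n \<Longrightarrow> j < n \<Longrightarrow> A $$ (j, i) = cnj (A $$ (i, j))"
    and e: "e \<in># proots (char_poly A)"
  shows "e \<in> \<real>"
proof -
  have "char_poly A \<noteq> 0" using degree_monic_char_poly[OF A] by auto
  then have "poly (char_poly A) e = 0" using e by simp
  then have "eigenvalue A e" using eigenvalue_root_char_poly[OF A] by simp
  then obtain v where v: "v \<in> carrier_vec n" "v \<noteq> 0\<^sub>v n" "A *\<^sub>v v = e \<cdot>\<^sub>v v"
    using A by (auto simp: eigenvalue_def eigenvector_def)
  have row: "(\<Sum>j<n. A $$ (i, j) * v $ j) = e * v $ i" if "i < n" for i
  proof -
    have "(\<Sum>j<n. A $$ (i, j) * v $ j) = (A *\<^sub>v v) $ i"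
      using A v(1) that by (simp add: scalar_prod_def atLeast0LessThan)
    then show ?thesis using v that by simp
  qed
  define q where "q = (\<Sum>i<n. \<Sum>j<n. cnj (v $ i) * A $$ (i, j) * v $ j)"
  define s where "s = (\<Sum>i<n. cnj (v $ i) * v $ i)"
  have q: "q = e * s"
    unfolding q_def s_def sum_distrib_left
  proof (intro sum.cong refl)
    fix i assume i: "i \<in> {..<n}"
    have "(\<Sum>j<n. cnj (v $ i) * A $$ (i, j) * v $ j) = cnj (v $ i) * (\<Sum>j<n. A $$ (i, j) * v $ j)"
      by (simp add: sum_distrib_left mult.assoc)
    also have "\<dots> = e * (cnj (v $ i) * v $ i)" using row i by simp
    finally show "(\<Sum>j<n. cnj (v $ i) * A $$ (i, j) * v $ j) = e * (cnj (v $ i) * v $ i)" .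
  qed
  have cq: "cnj q = q"
  proof -
    have "cnj q = (\<Sum>i<n. \<Sum>j<n. v $ i * cnj (A $$ (i, j)) * cnj (v $ j))"
      unfolding q_def by simp
    also have "\<dots> = (\<Sum>i<n. \<Sum>j<n. cnj (v $ j) * A $$ (j, i) * v $ i)"
    proof (intro sum.cong refl)
      fix i j assume "i \<in> {..<n}" "j \<in> {..<n}"
      then have "cnj (A $$ (i, j)) = A $$ (j, i)" using herm[of i j] by simp
      then show "v $ i * cnj (A $$ (i, j)) * cnj (v $ j) = cnj (v $ j) * A $$ (j, i) * v $ i"
        by simp
    qed
    also have "\<dots> = q" unfolding q_def by (rule sum.swap)
    finally show ?thesis .
  qed
  have s: "s = of_real (\<Sum>i<n. (cmod (v $ i))\<^sup>2)"
    unfolding s_def of_real_sum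
    by (intro sum.cong refl) (metis complex_norm_square mult.commute of_real_power)
  have nz: "(\<Sum>i<n. (cmod (v $ i))\<^sup>2) \<noteq> 0"
  proof
    assume "(\<Sum>i<n. (cmod (v $ i))\<^sup>2) = 0"
    then have "v $ i = 0" if "i < n" for i using that by (subst (asm) sum_nonneg_eq_0_iff) auto
    then have "v = 0\<^sub>v n" using v(1) by (intro eq_vecI) auto
    then show False using v by simp
  qed
  have "cnj e * s = e * s" using q cq s by (metis complex_cnj_complex_of_real complex_cnj_mult)
  moreover have "s \<noteq> 0" unfolding s of_real_eq_0_iff by (rule nz)
  ultimately have "cnj e = e" by simp
  then show ?thesis by (simp add: Reals_cnj_iff)
qed

lemma real_distribution_eigenvalue_distribution: "real_distribution (eigenvalue_distribution A)"
proof -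
  have "prob_space (distr (measure_pmf p) borel (Re :: complex \<Rightarrow> real))" for p
    by (intro prob_space.prob_space_distr) (auto intro: prob_space_measure_pmf)
  then show ?thesis
    unfolding eigenvalue_distribution_def real_distribution_def real_distribution_axioms_def by auto
qed

lemma eigenvalue_distribution_moment:
  fixes A :: "complex Matrix.mat"
  assumes A: "A \<in> carrier_mat n n" and n: "n \<ge> 1"
    and herm: "\<And>i j. i < n \<Longrightarrow> j < n \<Longrightarrow> A $$ (j, i) = cnj (A $$ (i, j))"
  shows "integrable (eigenvalue_distribution A) (\<lambda>x. x ^ r)"
    and "mat_trace (A ^\<^sub>m r) = of_real (real n * (\<integral>x. x ^ r \<partial>eigenvalue_distribution A))"
proof -
  let ?E = "proots (char_poly A)"
  have sz: "size ?E = n" using degree_monic_char_poly[OF A] by (simp add: size_proots_complex)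
  then have ne: "?E \<noteq> {#}" using n by auto
  have [simp]: "set_pmf (pmf_of_multiset ?E) = set_mset ?E" using ne by simp
  have fin: "integrable (measure_pmf (pmf_of_multiset ?E)) f" for f :: "complex \<Rightarrow> real"
    by (intro integrable_measure_pmf_finite) (simp add: ne)
  show "integrable (eigenvalue_distribution A) (\<lambda>x. x ^ r)"
    unfolding eigenvalue_distribution_def by (subst integrable_distr_eq) (auto intro: fin)
  have "(\<integral>x. x ^ r \<partial>eigenvalue_distribution A) = (\<integral>z. Re z ^ r \<partial>measure_pmf (pmf_of_multiset ?E))"
    unfolding eigenvalue_distribution_def by (subst integral_distr) auto
  also have "\<dots> = (\<Sum>z\<in>set_mset ?E. Re z ^ r * pmf (pmf_of_multiset ?E) z)"
    by (subst integral_measure_pmf_real[where A = "set_mset ?E"]) (use ne in auto)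
  also have "\<dots> = (\<Sum>z\<in>set_mset ?E. Re z ^ r * (real (count ?E z) / real n))"
    using ne sz by simp
  finally have "real n * (\<integral>x. x ^ r \<partial>eigenvalue_distribution A) = (\<Sum>z\<in>set_mset ?E. real (count ?E z) * Re z ^ r)"
    using n by (simp add: sum_distrib_left field_simps)
  then have "of_real (real n * (\<integral>x. x ^ r \<partial>eigenvalue_distribution A))
      = (\<Sum>z\<in>set_mset ?E. of_nat (count ?E z) * of_real (Re z) ^ r)" by simp
  also have "\<dots> = (\<Sum>z\<in>set_mset ?E. of_nat (count ?E z) * z ^ r)"
    using hermitian_eigenvalue_real[OF A herm] by (intro sum.cong) (auto simp: of_real_Re)
  also have "\<dots> = (\<Sum>e\<in>#?E. e ^ r)"
    by (simp add: sum_mset_eq_sum_count)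
  also have "\<dots> = mat_trace (A ^\<^sub>m r)" by (rule mat_trace_pow_eq_sum_eigenvalues[OF A, symmetric])
  finally show "mat_trace (A ^\<^sub>m r) = of_real (real n * (\<integral>x. x ^ r \<partial>eigenvalue_distribution A))" ..
qed

section \<open>Traces of powers of band Toeplitz matrices\<close>

text \<open>Words are extensional functions on \<open>{1..r}\<close>, which makes the set of words of a given length finite.\<close>
definition words :: "nat \<Rightarrow> nat \<Rightarrow> (nat \<Rightarrow> int) set" where
  "words r m = PiE {1..r} (\<lambda>_. {- int m..int m})"

lemma finite_words [simp]: "finite (words r m)"
  unfolding words_def by (intro finite_PiE) auto

definition closed_words :: "nat \<Rightarrow> nat \<Rightarrow> (nat \<Rightarrow> int) set" where
  "closed_words r m = {d\<in>words r m. (\<Sum>l=1..r. d l) = 0}"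

lemma finite_closed_words [simp]: "finite (closed_words r m)"
  by (simp add: closed_words_def)

definition stays :: "nat \<Rightarrow> nat \<Rightarrow> nat \<Rightarrow> (nat \<Rightarrow> int) \<Rightarrow> bool" where
  "stays N r q d \<longleftrightarrow> (\<forall>j\<in>{1..r}. int q + (\<Sum>l=1..j. d l) \<in> {0..<int N})"

definition start_count :: "nat \<Rightarrow> nat \<Rightarrow> (nat \<Rightarrow> int) \<Rightarrow> nat" where
  "start_count N r d = card {q\<in>{..<N}. stays N r q d}"

lemma sum_words_Suc:
  "(\<Sum>d\<in>words (Suc r) m. f d) = (\<Sum>d\<in>words r m. \<Sum>x\<in>{- int m..int m}. f (d(Suc r := x)))"
proof -
  have ins: "{1..Suc r} = insert (Suc r) {1..r}" by auto
  have "words (Suc r) m = (\<lambda>(x, d). d(Suc r := x)) ` ({- int m..int m} \<times> words r m)"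
    unfolding words_def ins by (rule PiE_insert_eq)
  moreover have "inj_on (\<lambda>(x, d). d(Suc r := x)) ({- int m..int m} \<times> words r m)"
    unfolding words_def by (rule inj_combinator) simp
  ultimately have "(\<Sum>d\<in>words (Suc r) m. f d)
      = (\<Sum>(x, d)\<in>{- int m..int m} \<times> words r m. f (d(Suc r := x)))"
    by (simp add: sum.reindex case_prod_unfold)
  also have "\<dots> = (\<Sum>x\<in>{- int m..int m}. \<Sum>d\<in>words r m. f (d(Suc r := x)))"
    by (rule sum.cartesian_product[symmetric])
  also have "\<dots> = (\<Sum>d\<in>words r m. \<Sum>x\<in>{- int m..int m}. f (d(Suc r := x)))"
    by (rule sum.swap)
  finally show ?thesis .
qed

lemma pow_mat_Suc_left:
  fixes A :: "'a::comm_ring_1 Matrix.mat"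
  assumes A: "A \<in> carrier_mat n n"
  shows "A ^\<^sub>m (Suc r) = A * A ^\<^sub>m r"
proof (induction r)
  case (Suc r)
  have "A ^\<^sub>m (Suc (Suc r)) = (A * A ^\<^sub>m r) * A" using Suc by simp
  also have "\<dots> = A * (A ^\<^sub>m r * A)" using A by (intro assoc_mult_mat) auto
  finally show ?case by simp
qed (use A in simp)

lemma pow_mat_smult:
  fixes A :: "'a::comm_ring_1 Matrix.mat"
  assumes A: "A \<in> carrier_mat n n"
  shows "(c \<cdot>\<^sub>m A) ^\<^sub>m r = c ^ r \<cdot>\<^sub>m (A ^\<^sub>m r)"
proof (induction r)
  case 0 show ?case using A by (auto intro!: eq_matI)
next
  case (Suc r)
  have P: "A ^\<^sub>m r \<in> carrier_mat n n" using A by simp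
  have "(c \<cdot>\<^sub>m A) ^\<^sub>m Suc r = (c ^ r \<cdot>\<^sub>m (A ^\<^sub>m r)) * (c \<cdot>\<^sub>m A)" using Suc by simp
  also have "\<dots> = c ^ r \<cdot>\<^sub>m ((A ^\<^sub>m r) * (c \<cdot>\<^sub>m A))" using P A by (intro mult_smult_assoc_mat) auto
  also have "\<dots> = c ^ r \<cdot>\<^sub>m (c \<cdot>\<^sub>m ((A ^\<^sub>m r) * A))" using P A by (subst mult_smult_distrib[of _ n n _ n]) auto
  also have "\<dots> = c ^ Suc r \<cdot>\<^sub>m (A ^\<^sub>m Suc r)" using P A by (auto intro!: eq_matI simp: mult_ac)
  finally show ?case .
qed

lemma band_toeplitz_carrier [simp]: "band_toeplitz N m c \<in> carrier_mat N N"
  by (simp add: band_toeplitz_def)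

text \<open>The product is read from right to left, starting in column \<open>q\<close>: an entry in row \<open>i\<close>
and column \<open>j\<close> depends on \<open>i - j\<close> only, so the path is determined by its start and its
steps.\<close>
lemma band_toeplitz_pow_entry:
  assumes "p < N" "q < N"
  shows "(band_toeplitz N m c ^\<^sub>m r) $$ (p, q) =
    (\<Sum>d\<in>words r m. if stays N r q d \<and> int q + (\<Sum>l=1..r. d l) = int p then \<Prod>l=1..r. c (d l) else 0)"
  using assms
proof (induction r arbitrary: p)
  case 0
  have "words 0 m = {\<lambda>_. undefined}" by (auto simp: words_def)
  then show ?case using 0 by (auto simp: stays_def band_toeplitz_def)
next
  case (Suc r)
  let ?T = "band_toeplitz N m c"
  let ?P = "\<lambda>d. \<Prod>l=1..r. c (d l)" and ?s = "\<lambda>d. int q + (\<Sum>l=1..r. d l)"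
  have P: "?T ^\<^sub>m r \<in> carrier_mat N N" by simp
  have "(?T ^\<^sub>m Suc r) $$ (p, q) = (\<Sum>s<N. ?T $$ (p, s) * (?T ^\<^sub>m r) $$ (s, q))"
    unfolding pow_mat_Suc_left[OF band_toeplitz_carrier] using P Suc.prems
    by (simp add: scalar_prod_def atLeast0LessThan band_toeplitz_def)
  also have "\<dots> = (\<Sum>s<N. \<Sum>d\<in>words r m. ?T $$ (p, s) * (if stays N r q d \<and> ?s d = int s then ?P d else 0))"
    using Suc by (simp add: sum_distrib_left)
  also have "\<dots> = (\<Sum>d\<in>words r m. \<Sum>s<N. ?T $$ (p, s) * (if stays N r q d \<and> ?s d = int s then ?P d else 0))"
    by (rule sum.swap)
  also have "\<dots> = (\<Sum>d\<in>words r m. \<Sum>x\<in>{- int m..int m}.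
      if stays N r q d \<and> ?s d + x = int p then ?P d * c x else 0)"
  proof (intro sum.cong refl)
    fix d assume "d \<in> words r m"
    show "(\<Sum>s<N. ?T $$ (p, s) * (if stays N r q d \<and> ?s d = int s then ?P d else 0)) =
       (\<Sum>x\<in>{- int m..int m}. if stays N r q d \<and> ?s d + x = int p then ?P d * c x else 0)"
    proof (cases "stays N r q d")
      case True
      have "?s d \<in> {0..<int N}"
        using True Suc.prems by (cases "r = 0") (auto simp: stays_def)
      then obtain s where s: "s < N" "?s d = int s"
        by (metis atLeastLessThan_iff zero_le_imp_eq_int of_nat_less_iff)
      have "(\<Sum>s'<N. ?T $$ (p, s') * (if stays N r q d \<and> ?s d = int s' then ?P d else 0))
          = (\<Sum>s'<N. if s' = s then ?T $$ (p, s) * ?P d else 0)"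
        using True s by (intro sum.cong) auto
      also have "\<dots> = (if \<bar>int p - int s\<bar> \<le> int m then ?P d * c (int p - int s) else 0)"
        using s Suc.prems by (simp add: band_toeplitz_def)
      also have "\<dots> = (\<Sum>x\<in>{- int m..int m}. if x = int p - int s then ?P d * c x else 0)"
        by (simp add: abs_le_iff)
      also have "\<dots> = (\<Sum>x\<in>{- int m..int m}. if stays N r q d \<and> ?s d + x = int p then ?P d * c x else 0)"
        using True s by (intro sum.cong) auto
      finally show ?thesis .
    qed simp
  qed
  also have "\<dots> = (\<Sum>d\<in>words r m. \<Sum>x\<in>{- int m..int m}.
      if stays N (Suc r) q (d(Suc r := x)) \<and> int q + (\<Sum>l=1..Suc r. (d(Suc r := x)) l) = int p
      then \<Prod>l=1..Suc r. c ((d(Suc r := x)) l) else 0)"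
  proof (intro sum.cong refl)
    fix d :: "nat \<Rightarrow> int" and x
    let ?d = "d(Suc r := x)"
    have sm: "(\<Sum>l=1..j. ?d l) = (\<Sum>l=1..j. d l)" if "j \<le> r" for j
      using that by (intro sum.cong) auto
    have pr: "(\<Prod>l=1..r. c (?d l)) = ?P d" by (intro prod.cong) auto
    have tot: "int q + (\<Sum>l=1..Suc r. ?d l) = ?s d + x"
      using sm[of r] by simp
    have "stays N (Suc r) q ?d \<longleftrightarrow> stays N r q ?d \<and> int q + (\<Sum>l=1..Suc r. ?d l) \<in> {0..<int N}"
      unfolding stays_def by (auto simp: le_Suc_eq Ball_def simp del: sum.cl_ivl_Suc)
    also have "stays N r q ?d \<longleftrightarrow> stays N r q d"
      unfolding stays_def using sm by auto
    finally have st: "stays N (Suc r) q ?d \<longleftrightarrow> stays N r q d \<and> ?s d + x \<in> {0..<int N}"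
      unfolding tot .
    have pr': "(\<Prod>l=1..Suc r. c (?d l)) = ?P d * c x" using pr by simp
    show "(if stays N r q d \<and> ?s d + x = int p then ?P d * c x else 0) =
      (if stays N (Suc r) q ?d \<and> int q + (\<Sum>l=1..Suc r. ?d l) = int p then \<Prod>l=1..Suc r. c (?d l) else 0)"
      unfolding st tot pr' using Suc.prems by auto
  qed
  also have "\<dots> = (\<Sum>d\<in>words (Suc r) m.
      if stays N (Suc r) q d \<and> int q + (\<Sum>l=1..Suc r. d l) = int p then \<Prod>l=1..Suc r. c (d l) else 0)"
    by (rule sum_words_Suc[symmetric])
  finally show ?case .
qed

lemma trace_band_toeplitz_pow:
  "mat_trace (band_toeplitz N m c ^\<^sub>m r) =
    (\<Sum>d\<in>closed_words r m. of_nat (start_count N r d) * (\<Prod>l=1..r. c (d l)))"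
proof -
  have "mat_trace (band_toeplitz N m c ^\<^sub>m r) = (\<Sum>q<N. \<Sum>d\<in>words r m.
      if stays N r q d \<and> int q + (\<Sum>l=1..r. d l) = int q then \<Prod>l=1..r. c (d l) else 0)"
  proof -
    have "dim_row (band_toeplitz N m c ^\<^sub>m r) = N"
      by (rule carrier_matD(1)[OF pow_carrier_mat[OF band_toeplitz_carrier]])
    then show ?thesis
      unfolding mat_trace_def by (intro sum.cong) (auto simp: band_toeplitz_pow_entry)
  qed
  also have "\<dots> = (\<Sum>d\<in>words r m. \<Sum>q<N.
      if stays N r q d \<and> int q + (\<Sum>l=1..r. d l) = int q then \<Prod>l=1..r. c (d l) else 0)"
    by (rule sum.swap)
  also have "\<dots> = (\<Sum>d\<in>words r m. if (\<Sum>l=1..r. d l) = 0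
      then of_nat (start_count N r d) * (\<Prod>l=1..r. c (d l)) else 0)"
  proof (intro sum.cong refl)
    fix d
    have "(\<Sum>q<N. if stays N r q d then (\<Prod>l=1..r. c (d l)) else 0)
        = of_nat (start_count N r d) * (\<Prod>l=1..r. c (d l))"
      unfolding start_count_def by (subst sum.inter_filter[symmetric]) auto
    then show "(\<Sum>q<N. if stays N r q d \<and> int q + (\<Sum>l=1..r. d l) = int q then \<Prod>l=1..r. c (d l) else 0)
      = (if (\<Sum>l=1..r. d l) = 0 then of_nat (start_count N r d) * (\<Prod>l=1..r. c (d l)) else 0)"
      by (cases "(\<Sum>l=1..r. d l) = 0") auto
  qed
  also have "\<dots> = (\<Sum>d\<in>{d\<in>words r m. (\<Sum>l=1..r. d l) = 0}.
      of_nat (start_count N r d) * (\<Prod>l=1..r. c (d l)))"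
    by (rule sum.inter_filter[symmetric]) simp
  finally show ?thesis by (simp only: closed_words_def)
qed

section \<open>Counting words with repeated values\<close>

text \<open>The pattern of \<open>d\<close> records which entries are equal and which are opposite. The functions with at
least this pattern form a lattice, in which the entries of \<open>\<delta>\<close> at indices with the same
\<open>\<bar>d i\<bar>\<close> agree up to sign: it has at most as many free entries as
\<open>\<bar>d\<bar>\<close> has values, and each independent linear constraint removes one.\<close>
definition compatible :: "'i set \<Rightarrow> ('i \<Rightarrow> int) \<Rightarrow> ('i \<Rightarrow> int) \<Rightarrow> bool" where
  "compatible I d \<delta> \<longleftrightarrow> (\<forall>i\<in>I. \<forall>j\<in>I. (d i = d j \<longrightarrow> \<delta> i = \<delta> j) \<and> (d i = - d j \<longrightarrow> \<delta> i = - \<delta> j))"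

text \<open>Triviality of the kernel: a solution of the constraints that vanishes wherever \<open>\<bar>d\<bar>\<close>
takes a value in \<open>V\<close> vanishes. It bounds the dimension of the space of solutions by \<open>card
V\<close> without any linear algebra.\<close>
definition values_determine :: "'i set \<Rightarrow> 'i set set \<Rightarrow> ('i \<Rightarrow> int) \<Rightarrow> int set \<Rightarrow> bool" where
  "values_determine I \<W> d V \<longleftrightarrow> (\<forall>\<delta>. compatible I d \<delta> \<longrightarrow> (\<forall>w\<in>\<W>. sum \<delta> w = 0) \<longrightarrow>
     (\<forall>i\<in>I. \<bar>d i\<bar> \<in> V \<longrightarrow> \<delta> i = 0) \<longrightarrow> (\<forall>i\<in>I. \<delta> i = 0))"

abbreviation abs_values :: "'i set \<Rightarrow> ('i \<Rightarrow> int) \<Rightarrow> int set" where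
  "abs_values I d \<equiv> (\<lambda>i. \<bar>d i\<bar>) ` I"

lemma values_determine_all: "values_determine I \<W> d (abs_values I d)"
  by (auto simp: values_determine_def)

lemma compatible_abs_eq:
  assumes "compatible I d \<delta>" "i \<in> I" "j \<in> I" "\<bar>d i\<bar> = \<bar>d j\<bar>"
  shows "\<delta> i = \<delta> j \<or> \<delta> i = - \<delta> j"
proof -
  have "d i = d j \<or> d i = - d j" using assms(4) by linarith
  then show ?thesis using assms(1-3) unfolding compatible_def by blast
qed

text \<open>There are at most \<open>4\<^bsup>n\<^sup>2\<^esup>\<close> patterns on \<open>n\<close> indices, and a word
with a given pattern is determined by its entries at one index for each value in \<open>V\<close>, since the
difference of two words with this pattern is compatible with it. The exponent \<open>e\<close> on the left
states the gain of a power \<open>(2 m + 1) ^ e\<close> without subtraction of natural numbers.\<close>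
lemma card_constrained_words_le:
  fixes S :: "('i \<Rightarrow> int) set"
  assumes I: "finite I" and S: "S \<subseteq> PiE I (\<lambda>_. {- int m..int m})"
    and \<W>: "\<And>d w. d \<in> S \<Longrightarrow> w \<in> \<W> \<Longrightarrow> sum d w = 0"
    and ex: "\<And>d. d \<in> S \<Longrightarrow> \<exists>V\<subseteq>abs_values I d. card V + e \<le> f \<and> values_determine I \<W> d V"
  shows "card S * (2 * m + 1) ^ e \<le> 4 ^ (card I)\<^sup>2 * (2 * m + 1) ^ f"
proof -
  define pat where "pat d = ({(i, j)\<in>I \<times> I. d i = d j}, {(i, j)\<in>I \<times> I. d i = - d j})" for d :: "'i \<Rightarrow> int"
  define cls where "cls P = {d\<in>S. pat d = P}" for P
  have finS: "finite S" using S I finite_PiE[OF I, of "\<lambda>_. {- int m..int m}"] finite_subset by blast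
  have each: "card (cls P) * (2 * m + 1) ^ e \<le> (2 * m + 1) ^ f" if P: "P \<in> pat ` S" for P
  proof -
    obtain d where d: "d \<in> S" "pat d = P" using P by auto
    obtain V where V: "V \<subseteq> abs_values I d" "card V + e \<le> f" "values_determine I \<W> d V"
      using ex[OF d(1)] by blast
    obtain rep where rep: "\<And>v. v \<in> V \<Longrightarrow> rep v \<in> I \<and> \<bar>d (rep v)\<bar> = v"
      using V(1) by (metis (no_types, lifting) image_iff subsetD)
    define F where "F = rep ` V"
    have finV: "finite V" using V(1) I finite_subset by blast
    have F: "F \<subseteq> I" "finite F" "card F \<le> card V"
      using rep finV by (auto simp: F_def card_image_le)
    have "inj_on (\<lambda>d. restrict d F) (cls P)"
    proof (rule inj_onI)
      fix x y assume x: "x \<in> cls P" and y: "y \<in> cls P" and eq: "restrict x F = restrict y F"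
      define \<delta> where "\<delta> = (\<lambda>i. x i - y i)"
      have F0: "\<delta> i = 0" if "i \<in> F" for i
        using fun_cong[OF eq, of i] that by (simp add: \<delta>_def)
      have px: "pat x = pat d" and py: "pat y = pat d" using x y d by (auto simp: cls_def)
      have comp: "compatible I d \<delta>"
        unfolding compatible_def
      proof (intro ballI conjI impI)
        fix i j assume ij: "i \<in> I" "j \<in> I"
        { assume "d i = d j"
          then have "(i, j) \<in> fst (pat d)" using ij by (simp add: pat_def)
          then have "(i, j) \<in> fst (pat x)" "(i, j) \<in> fst (pat y)" using px py by simp_all
          then show "\<delta> i = \<delta> j" by (simp add: pat_def \<delta>_def) }
        { assume "d i = - d j"
          then have "(i, j) \<in> snd (pat d)" using ij by (simp add: pat_def)
          then have "(i, j) \<in> snd (pat x)" "(i, j) \<in> snd (pat y)" using px py by simp_all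
          then show "\<delta> i = - \<delta> j" by (simp add: pat_def \<delta>_def) }
      qed
      have "\<delta> i = 0" if "i \<in> I" "\<bar>d i\<bar> \<in> V" for i
      proof -
        have "\<delta> (rep \<bar>d i\<bar>) = 0" using that by (intro F0) (auto simp: F_def)
        then show ?thesis
          using compatible_abs_eq[OF comp that(1), of "rep \<bar>d i\<bar>"] rep[OF that(2)] by auto
      qed
      moreover have "sum \<delta> w = 0" if "w \<in> \<W>" for w
        using \<W>[OF _ that] x y by (simp add: \<delta>_def sum_subtractf cls_def)
      ultimately have "\<forall>i\<in>I. \<delta> i = 0"
        using V(3) comp unfolding values_determine_def by blast
      moreover have "x \<in> PiE I (\<lambda>_. {- int m..int m})" "y \<in> PiE I (\<lambda>_. {- int m..int m})"
        using x y S by (auto simp: cls_def)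
      ultimately show "x = y" by (intro PiE_ext) (auto simp: \<delta>_def)
    qed
    moreover have "(\<lambda>d. restrict d F) ` cls P \<subseteq> PiE F (\<lambda>_. {- int m..int m})"
      using S F(1) by (fastforce simp: cls_def PiE_def Pi_def)
    ultimately have "card (cls P) \<le> card (PiE F (\<lambda>_. {- int m..int m}))"
      using F(2) by (intro card_inj_on_le) (auto intro: finite_PiE)
    also have "\<dots> = (2 * m + 1) ^ card F"
      using F(2) by (simp add: card_PiE nat_add_distrib nat_mult_distrib)
    also have "\<dots> \<le> (2 * m + 1) ^ card V" by (rule power_increasing[OF F(3)]) simp
    finally have "card (cls P) * (2 * m + 1) ^ e \<le> (2 * m + 1) ^ card V * (2 * m + 1) ^ e"
      by (rule mult_le_mono1)
    also have "\<dots> = (2 * m + 1) ^ (card V + e)" by (simp add: power_add)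
    also have "\<dots> \<le> (2 * m + 1) ^ f" by (rule power_increasing[OF V(2)]) simp
    finally show ?thesis .
  qed
  have "pat ` S \<subseteq> Pow (I \<times> I) \<times> Pow (I \<times> I)" by (auto simp: pat_def)
  then have "card (pat ` S) \<le> card (Pow (I \<times> I) \<times> Pow (I \<times> I))"
    using I by (intro card_mono) auto
  also have "\<dots> = 4 ^ (card I)\<^sup>2"
    using I by (simp add: card_cartesian_product card_Pow power2_eq_square flip: power_mult_distrib)
  finally have cp: "card (pat ` S) \<le> 4 ^ (card I)\<^sup>2" .
  have "S = (\<Union>P\<in>pat ` S. cls P)" by (auto simp: cls_def)
  then have "card S \<le> (\<Sum>P\<in>pat ` S. card (cls P))"
    using card_UN_le[of "pat ` S" cls] finS by simp
  then have "card S * (2 * m + 1) ^ e \<le> (\<Sum>P\<in>pat ` S. card (cls P) * (2 * m + 1) ^ e)"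
    by (metis mult_le_mono1 sum_distrib_right)
  also have "\<dots> \<le> (\<Sum>P\<in>pat ` S. (2 * m + 1) ^ f)" by (intro sum_mono each)
  also have "\<dots> = card (pat ` S) * (2 * m + 1) ^ f" by simp
  also have "\<dots> \<le> 4 ^ (card I)\<^sup>2 * (2 * m + 1) ^ f" using cp by (rule mult_le_mono1)
  finally show ?thesis .
qed

lemma sum_signs_parity:
  fixes t :: int
  assumes "finite A" "\<And>i. i \<in> A \<Longrightarrow> f i = t \<or> f i = - t"
  shows "\<exists>z. sum f A = t * z \<and> (odd z \<longleftrightarrow> odd (card A))"
  using assms
proof (induction A)
  case (insert x A)
  then obtain z where z: "sum f A = t * z" "odd z \<longleftrightarrow> odd (card A)" by auto
  show ?case
  proof (cases "f x = t")
    case True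
    then show ?thesis using insert z by (intro exI[of _ "z + 1"]) (auto simp: algebra_simps)
  next
    case False
    then have "f x = - t" using insert.prems by auto
    then show ?thesis using insert z by (intro exI[of _ "z - 1"]) (auto simp: algebra_simps)
  qed
qed (auto intro: exI[of _ 0])

text \<open>If \<open>v\<close> occurs an odd number of times in \<open>w\<close>, the entries there sum to an odd multiple
of a common value, so the constraint on \<open>w\<close> can be solved for that value.\<close>
lemma odd_multiplicity_determines:
  assumes I: "finite I" "w \<subseteq> I" and comp: "compatible I d \<delta>" and sum: "sum \<delta> w = 0"
    and zero: "\<And>i. i \<in> w \<Longrightarrow> \<bar>d i\<bar> \<noteq> v \<Longrightarrow> \<delta> i = 0"
    and odd: "odd (card {i\<in>w. \<bar>d i\<bar> = v})"
    and i: "i \<in> I" "\<bar>d i\<bar> = v"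
  shows "\<delta> i = 0"
proof -
  have fw: "finite w" using I finite_subset by blast
  have "0 = sum \<delta> {i\<in>w. \<bar>d i\<bar> = v}"
    using sum zero fw by (subst sum.mono_neutral_left[of w]) auto
  moreover have "\<delta> j = \<delta> i \<or> \<delta> j = - \<delta> i" if "j \<in> {i\<in>w. \<bar>d i\<bar> = v}" for j
    using that I(2) i by (intro compatible_abs_eq[OF comp]) auto
  then obtain z where "sum \<delta> {i\<in>w. \<bar>d i\<bar> = v} = \<delta> i * z" "odd z"
    using sum_signs_parity[of "{i\<in>w. \<bar>d i\<bar> = v}" \<delta> "\<delta> i"] odd fw by auto
  ultimately show ?thesis by auto
qed

lemma card_eq_sum_fibres:
  assumes "finite I"
  shows "card I = (\<Sum>v\<in>g ` I. card {i\<in>I. g i = v})"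
  using sum.image_gen[OF assms, of "\<lambda>_. 1::nat" g] by simp

lemma repeated_fibre_ge_2:
  assumes I: "finite I" and rep: "\<And>i. i \<in> I \<Longrightarrow> \<exists>j\<in>I. j \<noteq> i \<and> g j = g i"
    and v: "v \<in> g ` I"
  shows "2 \<le> card {i\<in>I. g i = v}"
proof -
  obtain i where i: "i \<in> I" "g i = v" using v by auto
  then obtain j where "j \<in> I" "j \<noteq> i" "g j = v" using rep by metis
  then have "card {i, j} \<le> card {i\<in>I. g i = v}" using i I by (intro card_mono) auto
  then show ?thesis using \<open>j \<noteq> i\<close> by simp
qed

lemma card_values_repeated:
  assumes I: "finite I" and rep: "\<And>i. i \<in> I \<Longrightarrow> \<exists>j\<in>I. j \<noteq> i \<and> g j = g i"
  shows "2 * card (g ` I) \<le> card I"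
    and "v \<in> g ` I \<Longrightarrow> card {i\<in>I. g i = v} \<noteq> 2 \<Longrightarrow> 2 * card (g ` I) < card I"
proof -
  have ge: "2 \<le> card {i\<in>I. g i = v}" if "v \<in> g ` I" for v
    using repeated_fibre_ge_2[OF I, of g v] rep that by blast
  have eq: "2 * card (g ` I) = (\<Sum>v\<in>g ` I. 2)" by simp
  show "2 * card (g ` I) \<le> card I"
    unfolding eq card_eq_sum_fibres[OF I, of g] by (intro sum_mono ge)
  assume v: "v \<in> g ` I" "card {i\<in>I. g i = v} \<noteq> 2"
  then show "2 * card (g ` I) < card I"
    unfolding eq card_eq_sum_fibres[OF I, of g] using I ge[OF v(1)] v
    by (intro sum_strict_mono_ex1 ballI ge bexI[of _ v]) auto
qed

text \<open>The index \<open>(t, l)\<close> stands for position \<open>l\<close> of word \<open>t\<close>. There are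
\<open>4 r\<close> positions and all values are repeated, so there are at most \<open>2 r\<close> values; two of
them have to be saved. If every value occurs exactly twice, two of the four sums have to be used; if some value
occurs more often, one value is saved already and one sum suffices, provided that some value has odd
multiplicity in some word. Otherwise the linking values occur at least twice in each word that they meet, and so
often in total that two values are saved by repetition alone.\<close>
lemma four_linked_words_determine:
  fixes d :: "nat \<times> nat \<Rightarrow> int" and r :: nat
  defines "I \<equiv> {..<4} \<times> {1..r}"
  assumes rep: "\<And>i. i \<in> I \<Longrightarrow> \<exists>j\<in>I. j \<noteq> i \<and> \<bar>d j\<bar> = \<bar>d i\<bar>"
    and link: "\<And>t. t < 4 \<Longrightarrow> \<exists>i\<in>I. \<exists>j\<in>I. fst i = t \<and> fst j \<noteq> t \<and> \<bar>d i\<bar> = \<bar>d j\<bar>"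
  shows "\<exists>V\<subseteq>abs_values I d. card V + 2 \<le> 2 * r \<and> values_determine I ((\<lambda>t. {t} \<times> {1..r}) ` {..<4}) d V"
proof -
  define A where "A = abs_values I d"
  define fib where "fib v = {i\<in>I. \<bar>d i\<bar> = v}" for v
  define w where "w t = {t} \<times> {1..r}" for t :: nat
  define \<W> where "\<W> = w ` {..<4}"
  have I: "finite I" "card I = 4 * r" by (auto simp: I_def)
  have A: "finite A" using I by (simp add: A_def)
  have wI: "w t \<subseteq> I" if "t < 4" for t using that by (auto simp: w_def I_def)
  have fw: "{i\<in>w t. \<bar>d i\<bar> = v} = fib v \<inter> w t" if "t < 4" for t v
    using wI[OF that] by (auto simp: fib_def)
  have card_fib: "2 \<le> card (fib v)" if "v \<in> A" for v
    unfolding fib_def using that rep by (intro repeated_fibre_ge_2 I) (auto simp: A_def)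
  have finfib: "finite (fib v)" for v using I by (simp add: fib_def)
  have det_odd: "\<delta> i = 0"
    if "t < 4" "compatible I d \<delta>" "sum \<delta> (w t) = 0" "\<And>i. i \<in> w t \<Longrightarrow> \<bar>d i\<bar> \<noteq> v \<Longrightarrow> \<delta> i = 0"
       "odd (card (fib v \<inter> w t))" "i \<in> fib v" for \<delta> t v i
    using odd_multiplicity_determines[OF I(1) wI[OF that(1)] that(2-4), of v i] that(5,6) fw[OF that(1)]
    by (auto simp: fib_def)
  have link': "\<exists>v\<in>A. \<exists>t'<4. t' \<noteq> t \<and> fib v \<inter> w t \<noteq> {} \<and> fib v \<inter> w t' \<noteq> {}" if t: "t < 4" for t
  proof -
    obtain i j where ij: "i \<in> I" "j \<in> I" "fst i = t" "fst j \<noteq> t" "\<bar>d i\<bar> = \<bar>d j\<bar>"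
      using link[OF t] by blast
    then have "i \<in> fib \<bar>d i\<bar> \<inter> w t" "j \<in> fib \<bar>d i\<bar> \<inter> w (fst j)" "fst j < 4" "\<bar>d i\<bar> \<in> A"
      by (auto simp: fib_def w_def I_def A_def)
    then show ?thesis using ij by blast
  qed
  have "\<exists>V\<subseteq>A. card V + 2 \<le> 2 * r \<and> values_determine I \<W> d V"
  proof (cases "\<forall>v\<in>A. card (fib v) = 2")
    case pairs: True
    \<comment> \<open>The value \<open>v\<close> links word 0 to some word \<open>t'\<close>, and \<open>s\<close> is a third word with a linking value \<open>v'\<close>.
      As \<open>v\<close> does not occur in word \<open>s\<close>, the sum over word \<open>s\<close> gives the entries at \<open>v'\<close>, and then the sum over
      word 0 gives those at \<open>v\<close>.\<close>
    have cA: "card A = 2 * r"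
      using card_eq_sum_fibres[OF I(1), of "\<lambda>i. \<bar>d i\<bar>"] pairs I(2) unfolding A_def fib_def by simp
    have single: "card (fib v \<inter> w t) = 1 \<and> (\<forall>s. s \<noteq> t \<and> s \<noteq> t' \<longrightarrow> fib v \<inter> w s = {})"
      if *: "v \<in> A" "t' \<noteq> t" "fib v \<inter> w t \<noteq> {}" "fib v \<inter> w t' \<noteq> {}" for v t t'
    proof -
      obtain i j where i: "i \<in> fib v \<inter> w t" and j: "j \<in> fib v \<inter> w t'" using * by blast
      then have "i \<noteq> j" using * by (auto simp: w_def)
      then have "{i, j} = fib v" using pairs *(1) i j by (intro card_seteq finfib) auto
      then have fv: "fib v = {i, j}" ..
      then have "fib v \<inter> w t = {i}" "\<And>s. s \<noteq> t \<and> s \<noteq> t' \<Longrightarrow> fib v \<inter> w s = {}"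
        using i j * by (auto simp: w_def)
      then show ?thesis by simp
    qed
    obtain v t' where v: "v \<in> A" "t' < 4" "t' \<noteq> 0" "fib v \<inter> w 0 \<noteq> {}" "fib v \<inter> w t' \<noteq> {}"
      using link'[of 0] by auto
    define s where "s = (if t' = 1 then 2 else 1 :: nat)"
    have s: "s < 4" "s \<noteq> 0" "s \<noteq> t'" by (auto simp: s_def)
    obtain v' s' where v': "v' \<in> A" "s' < 4" "s' \<noteq> s" "fib v' \<inter> w s \<noteq> {}" "fib v' \<inter> w s' \<noteq> {}"
      using link'[OF s(1)] by auto
    have vs: "fib v \<inter> w s = {}" and v1: "card (fib v \<inter> w 0) = 1"
      using single[of v t' 0] v s by auto
    have v'1: "card (fib v' \<inter> w s) = 1" using single[of v' s' s] v' by auto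
    have vv': "v \<noteq> v'" using vs v' by auto
    have "values_determine I \<W> d (A - {v, v'})"
      unfolding values_determine_def
    proof (intro allI impI)
      fix \<delta> assume comp: "compatible I d \<delta>" and sums: "\<forall>w\<in>\<W>. sum \<delta> w = 0"
        and z: "\<forall>i\<in>I. \<bar>d i\<bar> \<in> A - {v, v'} \<longrightarrow> \<delta> i = 0"
      have z': "\<delta> i = 0" if "i \<in> I" "\<bar>d i\<bar> \<noteq> v" "\<bar>d i\<bar> \<noteq> v'" for i
        using z that by (auto simp: A_def)
      have zv': "\<delta> i = 0" if i: "i \<in> fib v'" for i
      proof (rule det_odd[OF s(1) comp _ _ _ i])
        show "sum \<delta> (w s) = 0" using sums s by (auto simp: \<W>_def)
        show "odd (card (fib v' \<inter> w s))" using v'1 by simp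
        fix i assume i: "i \<in> w s" "\<bar>d i\<bar> \<noteq> v'"
        then have "i \<in> I" using wI[OF s(1)] by auto
        moreover from this have "\<bar>d i\<bar> \<noteq> v" using i vs unfolding fib_def by blast
        ultimately show "\<delta> i = 0" using i(2) by (rule z')
      qed
      have zv: "\<delta> i = 0" if i: "i \<in> fib v" for i
      proof (rule det_odd[of 0, OF _ comp _ _ _ i])
        show "sum \<delta> (w 0) = 0" using sums by (auto simp: \<W>_def)
        show "odd (card (fib v \<inter> w 0))" using v1 by simp
        fix i assume i: "i \<in> w 0" "\<bar>d i\<bar> \<noteq> v"
        then have "i \<in> I" using wI[of 0] by auto
        then show "\<delta> i = 0" using z'[of i] zv'[of i] i unfolding fib_def by blast
      qed simp
      show "\<forall>i\<in>I. \<delta> i = 0" using z' zv zv' unfolding fib_def by blast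
    qed
    moreover have "card (A - {v, v'}) + 2 = 2 * r"
    proof -
      have "card {v, v'} \<le> card A" using v v' A by (intro card_mono) auto
      then show ?thesis using v v' vv' A cA by (subst card_Diff_subset) auto
    qed
    ultimately show ?thesis by (intro exI[of _ "A - {v, v'}"]) auto
  next
    case False
    then obtain u where u: "u \<in> A" "card (fib u) \<noteq> 2" by auto
    have "2 * card A < card I"
      unfolding A_def using u rep by (intro card_values_repeated(2)[OF I(1), of _ u]) (auto simp: A_def fib_def)
    then have cA: "card A + 1 \<le> 2 * r" using I by simp
    show ?thesis
    proof (cases "\<exists>t<4. \<exists>v\<in>A. odd (card (fib v \<inter> w t))")
      case True
      then obtain t v where tv: "t < 4" "v \<in> A" "odd (card (fib v \<inter> w t))" by auto
      have "values_determine I \<W> d (A - {v})"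
        unfolding values_determine_def
      proof (intro allI impI)
        fix \<delta> assume comp: "compatible I d \<delta>" and sums: "\<forall>w\<in>\<W>. sum \<delta> w = 0"
          and z: "\<forall>i\<in>I. \<bar>d i\<bar> \<in> A - {v} \<longrightarrow> \<delta> i = 0"
        have z': "\<delta> i = 0" if "i \<in> I" "\<bar>d i\<bar> \<noteq> v" for i
          using z that by (auto simp: A_def)
        have zv: "\<delta> i = 0" if i: "i \<in> fib v" for i
        proof (rule det_odd[OF tv(1) comp _ _ tv(3) i])
          show "sum \<delta> (w t) = 0" using sums tv by (auto simp: \<W>_def)
        qed (use z' wI[OF tv(1)] in blast)
        show "\<forall>i\<in>I. \<delta> i = 0" using z' zv unfolding fib_def by blast
      qed
      moreover have "card (A - {v}) + 1 = card A"
        using card_Suc_Diff1[OF A tv(2)] by simp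
      ultimately show ?thesis using cA by (intro exI[of _ "A - {v}"]) auto
    next
      case False
      \<comment> \<open>The set \<open>h v\<close> of words met by \<open>v\<close> gives \<open>card (fib v) \<ge> 2 * card (h v)\<close>. This exceeds 2 by at least \<open>card (h v)\<close> when
        \<open>v\<close> is a linking value, and the sets \<open>h v\<close> of the linking values cover all four words.\<close>
      define h where "h v = {t. t < 4 \<and> fib v \<inter> w t \<noteq> {}}" for v
      have finh: "finite (h v)" for v by (rule finite_subset[of _ "{..<4}"]) (auto simp: h_def)
      have fib_h: "2 * card (h v) \<le> card (fib v)" if "v \<in> A" for v
      proof -
        have "2 * card (h v) = (\<Sum>t\<in>h v. 2)" by simp
        also have "\<dots> \<le> (\<Sum>t\<in>h v. card (fib v \<inter> w t))"
        proof (intro sum_mono)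
          fix t assume t: "t \<in> h v"
          then have "card (fib v \<inter> w t) \<noteq> 0" using finfib by (auto simp: h_def)
          moreover have "even (card (fib v \<inter> w t))" using False t that by (auto simp: h_def)
          ultimately show "2 \<le> card (fib v \<inter> w t)" by (cases "card (fib v \<inter> w t) = 1") auto
        qed
        also have "\<dots> = card (\<Union>t\<in>h v. fib v \<inter> w t)"
          using finh finfib by (intro card_UN_disjoint[symmetric]) (auto simp: w_def)
        also have "\<dots> \<le> card (fib v)" using finfib by (intro card_mono) auto
        finally show ?thesis .
      qed
      define L where "L = {v\<in>A. 2 \<le> card (h v)}"
      have "{..<4} \<subseteq> (\<Union>v\<in>L. h v)"
      proof
        fix t :: nat assume "t \<in> {..<4}"
        then obtain v t' where v: "v \<in> A" "t' < 4" "t' \<noteq> t" "fib v \<inter> w t \<noteq> {}" "fib v \<inter> w t' \<noteq> {}"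
          using link'[of t] by auto
        then have "{t, t'} \<subseteq> h v" using \<open>t \<in> {..<4}\<close> by (auto simp: h_def)
        then have "card {t, t'} \<le> card (h v)" by (intro card_mono finh)
        then show "t \<in> (\<Union>v\<in>L. h v)" using v \<open>{t, t'} \<subseteq> h v\<close> by (auto simp: L_def)
      qed
      then have "card {..<4::nat} \<le> card (\<Union>v\<in>L. h v)"
        using A finh by (intro card_mono) (auto simp: L_def)
      also have "\<dots> \<le> (\<Sum>v\<in>L. card (h v))" using A by (intro card_UN_le) (auto simp: L_def)
      finally have L4: "4 \<le> (\<Sum>v\<in>L. card (h v))" by simp
      have "2 * card A + 4 \<le> (\<Sum>v\<in>A. 2) + (\<Sum>v\<in>L. card (h v))" using L4 by simp
      also have "(\<Sum>v\<in>L. card (h v)) = (\<Sum>v\<in>A. if 2 \<le> card (h v) then card (h v) else 0)"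
        unfolding L_def using A by (intro sum.inter_filter)
      also have "(\<Sum>v\<in>A. 2) + \<dots> = (\<Sum>v\<in>A. 2 + (if 2 \<le> card (h v) then card (h v) else 0))"
        by (simp only: sum.distrib)
      also have "\<dots> \<le> (\<Sum>v\<in>A. card (fib v))"
      proof (intro sum_mono)
        fix v assume "v \<in> A"
        then show "2 + (if 2 \<le> card (h v) then card (h v) else 0) \<le> card (fib v)"
          using fib_h[of v] card_fib[of v] by auto
      qed
      also have "\<dots> = 4 * r"
        using card_eq_sum_fibres[OF I(1), of "\<lambda>i. \<bar>d i\<bar>"] I(2) by (simp add: A_def fib_def)
      finally have "card A + 2 \<le> 2 * r" by simp
      then show ?thesis using values_determine_all[of I \<W> d] by (auto simp: A_def)
    qed
  qed
  then show ?thesis by (simp add: A_def \<W>_def w_def)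
qed

text \<open>Two equal steps in a pair contribute twice their value to the sum, while pairs of opposite steps cancel: the sum
over all of \<open>I\<close> can be solved for that value.\<close>
lemma values_determine_if_not_pairing:
  assumes I: "finite I" "card I = 2 * k" and rep: "\<And>i. i \<in> I \<Longrightarrow> \<exists>j\<in>I. j \<noteq> i \<and> \<bar>d j\<bar> = \<bar>d i\<bar>"
    and sum: "sum d I = 0"
    and not_opp: "\<not> ((\<forall>v\<in>abs_values I d. card {i\<in>I. \<bar>d i\<bar> = v} = 2) \<and>
       (\<forall>i\<in>I. \<forall>j\<in>I. i \<noteq> j \<longrightarrow> \<bar>d i\<bar> = \<bar>d j\<bar> \<longrightarrow> d j = - d i))"
  shows "\<exists>V\<subseteq>abs_values I d. card V + 1 \<le> k \<and> values_determine I {I} d V"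
proof (cases "\<forall>v\<in>abs_values I d. card {i\<in>I. \<bar>d i\<bar> = v} = 2")
  case False
  then obtain v where v: "v \<in> abs_values I d" "card {i\<in>I. \<bar>d i\<bar> = v} \<noteq> 2" by blast
  have "2 * card (abs_values I d) < card I"
    using v rep by (intro card_values_repeated(2)[OF I(1)]) auto
  then show ?thesis using I values_determine_all by (intro exI[of _ "abs_values I d"]) auto
next
  case True
  then obtain i j where ij: "i \<in> I" "j \<in> I" "i \<noteq> j" "\<bar>d i\<bar> = \<bar>d j\<bar>" "d j \<noteq> - d i"
    using not_opp by blast
  let ?A = "abs_values I d" and ?F = "{l\<in>I. \<bar>d l\<bar> = \<bar>d i\<bar>}"
  have eq: "d i = d j" using ij by linarith
  have F: "{i, j} = ?F" using True ij I by (intro card_seteq) auto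
  have cA: "card ?A = k"
    using card_eq_sum_fibres[OF I(1), of "\<lambda>i. \<bar>d i\<bar>"] True I(2) by simp
  have "values_determine I {I} d (?A - {\<bar>d i\<bar>})"
    unfolding values_determine_def
  proof (intro allI impI)
    fix \<delta> assume comp: "compatible I d \<delta>" and s: "\<forall>w\<in>{I}. sum \<delta> w = 0"
      and z: "\<forall>l\<in>I. \<bar>d l\<bar> \<in> ?A - {\<bar>d i\<bar>} \<longrightarrow> \<delta> l = 0"
    have z': "\<delta> l = 0" if "l \<in> I" "l \<notin> {i, j}" for l
      using z that unfolding F by auto
    have "0 = sum \<delta> {i, j}"
      using s z' I ij by (subst sum.mono_neutral_left[of I]) auto
    also have "\<dots> = \<delta> i + \<delta> j" using ij by simp
    also have "\<delta> i = \<delta> j" using comp ij eq unfolding compatible_def by blast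
    finally have "\<delta> j = 0" "\<delta> i = 0" using \<open>\<delta> i = \<delta> j\<close> by auto
    then show "\<forall>l\<in>I. \<delta> l = 0" using z' by blast
  qed
  moreover have "card (?A - {\<bar>d i\<bar>}) + 1 = card ?A"
    using card_Suc_Diff1[of ?A "\<bar>d i\<bar>"] I ij by simp
  ultimately show ?thesis using cA by (intro exI[of _ "?A - {\<bar>d i\<bar>}"]) auto
qed

section \<open>Independence and expectations of products of entries\<close>

text \<open>The common part of the Hermitian and the symmetric case. In the symmetric case the entries are real, so that
\<open>a\<^bsub>-j\<^esub> = a\<^sub>j = cnj a\<^sub>j\<close>; in the Hermitian case \<open>a\<^sub>j\<close>
is a function of the pair \<open>Re a\<^sub>j\<close>, \<open>Im a\<^sub>j\<close>.\<close>
locale independent_toeplitz_entries = toeplitz_entries M a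
  for M :: "'w measure" and a :: "int \<Rightarrow> 'w \<Rightarrow> complex" +
  assumes conj_sym: "\<omega> \<in> space M \<Longrightarrow> a (- j) \<omega> = cnj (a j \<omega>)"
    and indep_entries: "indep_vars (\<lambda>_. borel) (\<lambda>(j::nat) \<omega>. a (int j) \<omega>) UNIV"

lemma (in prob_space) indep_vars_cong_space:
  assumes "indep_vars N X I" "\<And>i \<omega>. i \<in> I \<Longrightarrow> \<omega> \<in> space M \<Longrightarrow> X i \<omega> = Y i \<omega>"
  shows "indep_vars N Y I"
proof -
  have pre: "X i -` A \<inter> space M = Y i -` A \<inter> space M" if "i \<in> I" for i A
    using assms(2)[OF that] by auto
  have "random_variable (N i) (Y i)" if "i \<in> I" for i
    using assms that measurable_cong[of M "X i" "Y i" "N i"] by (auto simp: indep_vars_def2)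
  moreover have "indep_sets (\<lambda>i. {Y i -` A \<inter> space M |A. A \<in> sets (N i)}) I"
    using assms(1) pre unfolding indep_vars_def2
    by (subst (asm) indep_sets_cong[OF refl, of I _ "\<lambda>i. {Y i -` A \<inter> space M |A. A \<in> sets (N i)}"]) auto
  ultimately show ?thesis unfolding indep_vars_def2 by blast
qed

lemma symmetric_imp_independent_entries:
  assumes "symmetric_toeplitz_entries M a"
  shows "independent_toeplitz_entries M a"
proof -
  interpret symmetric_toeplitz_entries M a by fact
  have sym: "a (- j) \<omega> = a j \<omega>" if "\<omega> \<in> space M" for j \<omega>
    using entry_sym[of j \<omega>] entry_sym[of "- j" \<omega>] that by (cases "j \<ge> 0") auto
  show ?thesis
  proof
    show "a (- j) \<omega> = cnj (a j \<omega>)" if "\<omega> \<in> space M" for \<omega> j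
      using sym[OF that] entry_real[OF that, of j] by (simp add: Reals_cnj_iff)
    have "indep_vars (\<lambda>_. borel) (\<lambda>(j::nat) \<omega>. complex_of_real (Re (a (int j) \<omega>))) UNIV"
      by (rule indep_vars_compose2[OF indep]) auto
    then show "indep_vars (\<lambda>_. borel) (\<lambda>(j::nat) \<omega>. a (int j) \<omega>) UNIV"
      by (rule indep_vars_cong_space) (auto simp: entry_real of_real_Re)
  qed
qed

lemma hermitian_imp_independent_entries:
  assumes "hermitian_toeplitz_entries M a"
  shows "independent_toeplitz_entries M a"
proof -
  interpret hermitian_toeplitz_entries M a by fact
  have pos: "a (- j) \<omega> = cnj (a j \<omega>)" if "\<omega> \<in> space M" "j \<ge> 1" for j \<omega>
    using Re_sym[OF that(2,1)] Im_antisym[OF that(2,1)] by (simp add: complex_eq_iff)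
  have conj: "a (- j) \<omega> = cnj (a j \<omega>)" if "\<omega> \<in> space M" for j \<omega>
  proof (cases j "0 :: int" rule: linorder_cases)
    case less
    then show ?thesis using pos[OF that, of "- j"] by simp
  next
    case equal
    then show ?thesis using diag_real[OF that] by (simp add: Reals_cnj_iff)
  next
    case greater
    then show ?thesis using pos[OF that, of j] by simp
  qed
  define K :: "nat \<Rightarrow> (nat + nat) set" where "K j = (if j = 0 then {Inl 0} else {Inl j, Inr j})" for j
  define h :: "nat \<Rightarrow> (nat + nat \<Rightarrow> real) \<Rightarrow> complex" where
    "h j x = (if j = 0 then of_real (x (Inl 0)) else of_real (x (Inl j)) + \<i> * of_real (x (Inr j)))" for j x
  have ind': "indep_vars (\<lambda>j. PiM (K j) (\<lambda>_. borel))
     (\<lambda>j \<omega>. restrict (\<lambda>i. case i of Inl j \<Rightarrow> Re (a (int j) \<omega>) | Inr j \<Rightarrow> Im (a (int j) \<omega>)) (K j)) UNIV"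
    by (rule indep_vars_restrict[OF indep]) (auto simp: K_def disjoint_family_on_def split: if_splits)
  have "h j \<in> borel_measurable (PiM (K j) (\<lambda>_. borel))" for j
    unfolding h_def K_def by (cases "j = 0") auto
  then have "indep_vars (\<lambda>_. borel) (\<lambda>j \<omega>. h j
     (restrict (\<lambda>i. case i of Inl j \<Rightarrow> Re (a (int j) \<omega>) | Inr j \<Rightarrow> Im (a (int j) \<omega>)) (K j))) UNIV"
    by (rule indep_vars_compose2[where Y = h, OF ind'])
  then have ind: "indep_vars (\<lambda>_. borel) (\<lambda>(j::nat) \<omega>. a (int j) \<omega>) UNIV"
  proof (rule indep_vars_cong_space)
    fix j :: nat and \<omega> assume "\<omega> \<in> space M"
    then show "h j (restrict (\<lambda>i. case i of Inl j \<Rightarrow> Re (a (int j) \<omega>) | Inr j \<Rightarrow> Im (a (int j) \<omega>)) (K j)) = a (int j) \<omega>"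
      using diag_real[of \<omega>] complex_eq[of "a (int j) \<omega>"] by (cases "j = 0") (simp_all add: h_def K_def)
  qed
  show ?thesis
    by unfold_locales (use conj ind in auto)
qed

text \<open>A crude substitute for Hoelder's inequality: the product is at most the largest factor to the power \<open>card
I\<close>.\<close>
lemma prod_le_sum_power:
  fixes x :: "'i \<Rightarrow> real"
  assumes "finite I" "I \<noteq> {}" "\<And>i. i \<in> I \<Longrightarrow> 0 \<le> x i"
  shows "(\<Prod>i\<in>I. x i) \<le> (\<Sum>i\<in>I. x i ^ card I)"
proof -
  have "Max (x ` I) \<in> x ` I" using assms by (intro Max_in) auto
  then obtain m where m: "m \<in> I" "Max (x ` I) = x m" by blast
  then have "x i \<le> x m" if "i \<in> I" for i
    using Max_ge[of "x ` I" "x i"] assms that by auto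
  then have "(\<Prod>i\<in>I. x i) \<le> (\<Prod>i\<in>I. x m)" using assms by (intro prod_mono) auto
  also have "\<dots> = x m ^ card I" by simp
  also have "\<dots> \<le> (\<Sum>i\<in>I. x i ^ card I)" using assms m by (intro member_le_sum) auto
  finally show ?thesis .
qed

context independent_toeplitz_entries
begin

definition entry_product :: "'i set \<Rightarrow> ('i \<Rightarrow> int) \<Rightarrow> 'w \<Rightarrow> complex" where
  "entry_product I d \<omega> = (\<Prod>i\<in>I. a (d i) \<omega>)"

definition moment_bound :: "nat \<Rightarrow> real" where
  "moment_bound k = (SUP j. expectation (\<lambda>\<omega>. cmod (a j \<omega>) ^ k))"

lemma moment_le_bound: "expectation (\<lambda>\<omega>. cmod (a j \<omega>) ^ k) \<le> moment_bound k"
  unfolding moment_bound_def by (rule cSUP_upper[OF UNIV_I entry_moment_bounded])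

lemma measurable_entry [measurable]: "a j \<in> borel_measurable M"
  using entry_measurable[of j] .

lemma measurable_entry_product [measurable]: "entry_product I d \<in> borel_measurable M"
  unfolding entry_product_def by measurable

lemma
  assumes I: "finite I"
  shows integrable_entry_product_power: "integrable M (\<lambda>\<omega>. cmod (entry_product I d \<omega>) ^ n)"
    and expectation_entry_product_power_le:
      "expectation (\<lambda>\<omega>. cmod (entry_product I d \<omega>) ^ n) \<le> 1 + card I * moment_bound (n * card I)"
proof -
  have le: "cmod (entry_product I d \<omega>) ^ n \<le> 1 + (\<Sum>i\<in>I. cmod (a (d i) \<omega>) ^ (n * card I))" for \<omega>
  proof (cases "I = {}")
    case False
    have "cmod (entry_product I d \<omega>) ^ n = (\<Prod>i\<in>I. cmod (a (d i) \<omega>) ^ n)"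
      by (simp add: entry_product_def prod_norm[symmetric] prod_power_distrib)
    also have "\<dots> \<le> (\<Sum>i\<in>I. (cmod (a (d i) \<omega>) ^ n) ^ card I)"
      using I False by (intro prod_le_sum_power) auto
    finally show ?thesis by (simp add: power_mult)
  qed (simp add: entry_product_def)
  have int: "integrable M (\<lambda>\<omega>. 1 + (\<Sum>i\<in>I. cmod (a (d i) \<omega>) ^ (n * card I)))"
    by (intro Bochner_Integration.integrable_add Bochner_Integration.integrable_sum entry_moment_integrable) auto
  show int': "integrable M (\<lambda>\<omega>. cmod (entry_product I d \<omega>) ^ n)"
    by (rule Bochner_Integration.integrable_bound[OF int]) (use le in \<open>auto intro: order_trans[OF _ abs_ge_self]\<close>)
  have "expectation (\<lambda>\<omega>. cmod (entry_product I d \<omega>) ^ n)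
      \<le> expectation (\<lambda>\<omega>. 1 + (\<Sum>i\<in>I. cmod (a (d i) \<omega>) ^ (n * card I)))"
    by (intro integral_mono int int' le)
  also have "\<dots> = 1 + (\<Sum>i\<in>I. expectation (\<lambda>\<omega>. cmod (a (d i) \<omega>) ^ (n * card I)))"
    by (simp add: entry_moment_integrable prob_space)
  also have "\<dots> \<le> 1 + (\<Sum>i\<in>I. moment_bound (n * card I))"
    by (intro add_left_mono sum_mono moment_le_bound)
  finally show "expectation (\<lambda>\<omega>. cmod (entry_product I d \<omega>) ^ n) \<le> 1 + card I * moment_bound (n * card I)"
    by simp
qed

lemma integrable_entry_product:
  assumes "finite I" shows "integrable M (entry_product I d)"
  using integrable_entry_product_power[OF assms, of d 1] by (simp add: integrable_norm_iff)

lemma norm_expectation_entry_product_le: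
  assumes "finite I"
  shows "norm (expectation (entry_product I d)) \<le> 1 + card I * moment_bound (card I)"
  by (rule order_trans[OF integral_norm_bound])
     (use expectation_entry_product_power_le[OF assms, of d 1] in simp)

text \<open>An entry with a negative index is the conjugate of the one with the opposite index, so dependence is recorded by
nonnegative indices only, and absolute values of indices appear below.\<close>
definition depends_on :: "nat set \<Rightarrow> ('w \<Rightarrow> complex) \<Rightarrow> bool" where
  "depends_on D X \<longleftrightarrow> (\<exists>f\<in>borel_measurable (PiM D (\<lambda>_. borel)).
     \<forall>\<omega>\<in>space M. X \<omega> = f (\<lambda>j\<in>D. a (int j) \<omega>))"

lemma depends_on_entry:
  assumes "nat \<bar>j\<bar> \<in> D"
  shows "depends_on D (a j)"
proof -
  define f where "f x = (if j \<ge> 0 then x (nat \<bar>j\<bar>) else cnj (x (nat \<bar>j\<bar>)))" for x :: "nat \<Rightarrow> complex"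
  have comp: "(\<lambda>x. x (nat \<bar>j\<bar>)) \<in> borel_measurable (PiM D (\<lambda>_. borel :: complex measure))"
    using assms by measurable
  have "f \<in> borel_measurable (PiM D (\<lambda>_. borel))"
  proof (cases "j \<ge> 0")
    case False
    have "(\<lambda>x. cnj (x (nat \<bar>j\<bar>))) \<in> borel_measurable (PiM D (\<lambda>_. borel :: complex measure))"
      by (rule measurable_compose[OF comp borel_measurable_continuous_onI]) (intro continuous_intros)
    then show ?thesis using False by (simp add: f_def[abs_def])
  qed (use comp in \<open>simp add: f_def[abs_def]\<close>)
  moreover have "a j \<omega> = f (\<lambda>j\<in>D. a (int j) \<omega>)" if "\<omega> \<in> space M" for \<omega>
    using assms conj_sym[OF that, of "- j"] by (cases "j \<ge> 0") (auto simp: f_def)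
  ultimately show ?thesis unfolding depends_on_def by blast
qed

lemma depends_on_const: "depends_on D (\<lambda>_. c)"
  unfolding depends_on_def by (rule bexI[of _ "\<lambda>_. c"]) auto

lemma depends_on_binop:
  assumes "depends_on D X" "depends_on D Y"
    and g: "(\<lambda>z. g (fst z) (snd z)) \<in> borel_measurable (borel \<Otimes>\<^sub>M borel)"
  shows "depends_on D (\<lambda>\<omega>. g (X \<omega>) (Y \<omega>))"
proof -
  obtain f1 f2 where f: "f1 \<in> borel_measurable (PiM D (\<lambda>_. borel))" "f2 \<in> borel_measurable (PiM D (\<lambda>_. borel))"
    "\<And>\<omega>. \<omega> \<in> space M \<Longrightarrow> X \<omega> = f1 (\<lambda>j\<in>D. a (int j) \<omega>)" "\<And>\<omega>. \<omega> \<in> space M \<Longrightarrow> Y \<omega> = f2 (\<lambda>j\<in>D. a (int j) \<omega>)"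
    using assms unfolding depends_on_def by blast
  have "(\<lambda>x. g (f1 x) (f2 x)) \<in> borel_measurable (PiM D (\<lambda>_. borel))"
    using measurable_compose[OF measurable_Pair[OF f(1,2)] g] by simp
  then show ?thesis unfolding depends_on_def using f by (intro bexI[of _ "\<lambda>x. g (f1 x) (f2 x)"]) auto
qed

lemma depends_on_mult: "depends_on D X \<Longrightarrow> depends_on D Y \<Longrightarrow> depends_on D (\<lambda>\<omega>. X \<omega> * Y \<omega>)"
  by (rule depends_on_binop) (auto simp: borel_prod[symmetric])

lemma depends_on_diff: "depends_on D X \<Longrightarrow> depends_on D Y \<Longrightarrow> depends_on D (\<lambda>\<omega>. X \<omega> - Y \<omega>)"
  by (rule depends_on_binop) (auto simp: borel_prod[symmetric])

lemma depends_on_prod: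
  "(\<And>i. i \<in> I \<Longrightarrow> depends_on D (X i)) \<Longrightarrow> depends_on D (\<lambda>\<omega>. \<Prod>i\<in>I. X i \<omega>)"
  by (induction I rule: infinite_finite_induct) (auto intro: depends_on_const depends_on_mult)

lemma depends_on_entry_product:
  "(\<And>i. i \<in> I \<Longrightarrow> nat \<bar>d i\<bar> \<in> D) \<Longrightarrow> depends_on D (entry_product I d)"
  unfolding entry_product_def[abs_def] by (intro depends_on_prod depends_on_entry)

lemma expectation_mult_disjoint:
  assumes D: "D1 \<inter> D2 = {}" and X: "depends_on D1 X" "integrable M X" and Y: "depends_on D2 Y" "integrable M Y"
  shows "expectation (\<lambda>\<omega>. X \<omega> * Y \<omega>) = expectation X * expectation Y"
proof -
  obtain f g where f: "f \<in> borel_measurable (PiM D1 (\<lambda>_. borel))" "\<And>\<omega>. \<omega> \<in> space M \<Longrightarrow> X \<omega> = f (\<lambda>j\<in>D1. a (int j) \<omega>)"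
    and g: "g \<in> borel_measurable (PiM D2 (\<lambda>_. borel))" "\<And>\<omega>. \<omega> \<in> space M \<Longrightarrow> Y \<omega> = g (\<lambda>j\<in>D2. a (int j) \<omega>)"
    using X(1) Y(1) unfolding depends_on_def by blast
  have "indep_vars (\<lambda>b. PiM (case_bool D1 D2 b) (\<lambda>_. borel))
      (\<lambda>b \<omega>. restrict (\<lambda>j. a (int j) \<omega>) (case_bool D1 D2 b)) UNIV"
    using D by (intro indep_vars_restrict[OF indep_entries]) (auto simp: disjoint_family_on_def split: bool.splits)
  then have "indep_vars (\<lambda>b. borel) (\<lambda>b \<omega>. case_bool f g b (restrict (\<lambda>j. a (int j) \<omega>) (case_bool D1 D2 b))) UNIV"
    by (rule indep_vars_compose2[where Y = "case_bool f g"]) (use f(1) g(1) in \<open>auto split: bool.splits\<close>)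
  then have "indep_vars (\<lambda>b. borel) (\<lambda>b. case_bool X Y b) UNIV"
    by (rule indep_vars_cong_space) (auto simp: f(2) g(2) split: bool.splits)
  moreover have "(\<lambda>b. borel) = case_bool (borel :: complex measure) borel" by (auto simp: fun_eq_iff split: bool.splits)
  ultimately have "indep_var borel X borel Y" unfolding indep_var_def by simp
  then show ?thesis by (intro indep_var_lebesgue_integral X Y)
qed

lemma expectation_entry_product_split:
  assumes I: "finite I" and J: "J \<subseteq> I" and dis: "\<And>i j. i \<in> J \<Longrightarrow> j \<in> I - J \<Longrightarrow> \<bar>d i\<bar> \<noteq> \<bar>d j\<bar>"
  shows "expectation (entry_product I d) = expectation (entry_product J d) * expectation (entry_product (I - J) d)"
proof -
  have fin: "finite J" "finite (I - J)" using I J finite_subset by auto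
  have eq: "entry_product I d = (\<lambda>\<omega>. entry_product J d \<omega> * entry_product (I - J) d \<omega>)"
    unfolding entry_product_def by (rule ext, subst prod.subset_diff[OF J I]) (rule mult.commute)
  have "(\<lambda>i. nat \<bar>d i\<bar>) ` J \<inter> (\<lambda>i. nat \<bar>d i\<bar>) ` (I - J) = {}" using dis by fastforce
  then show ?thesis
    unfolding eq by (intro expectation_mult_disjoint[of "(\<lambda>i. nat \<bar>d i\<bar>) ` J" "(\<lambda>i. nat \<bar>d i\<bar>) ` (I - J)"]
        depends_on_entry_product integrable_entry_product fin) auto
qed

text \<open>A value that occurs only once contributes an independent factor of mean 0.\<close>
lemma expectation_entry_product_single:
  assumes I: "finite I" and i: "i \<in> I" and single: "\<And>j. j \<in> I \<Longrightarrow> j \<noteq> i \<Longrightarrow> \<bar>d j\<bar> \<noteq> \<bar>d i\<bar>"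
  shows "expectation (entry_product I d) = 0"
proof -
  have "expectation (entry_product {i} d) = 0"
    using entry_mean[of "d i"] by (simp add: entry_product_def[abs_def])
  then show ?thesis
    using expectation_entry_product_split[OF I, of "{i}" d] i single by force
qed

text \<open>Each pair contributes an independent factor \<open>a\<^sub>j cnj a\<^sub>j\<close> of mean 1.\<close>
lemma expectation_entry_product_opposite_pairs:
  assumes I: "finite I" and pairs: "\<And>v. v \<in> (\<lambda>i. \<bar>d i\<bar>) ` I \<Longrightarrow> card {i\<in>I. \<bar>d i\<bar> = v} = 2"
    and opp: "\<And>i j. i \<in> I \<Longrightarrow> j \<in> I \<Longrightarrow> i \<noteq> j \<Longrightarrow> \<bar>d i\<bar> = \<bar>d j\<bar> \<Longrightarrow> d j = - d i"
  shows "expectation (entry_product I d) = 1"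
  using assms
proof (induction I rule: finite_psubset_induct)
  case (psubset I)
  show ?case
  proof (cases "I = {}")
    case True
    then show ?thesis by (simp add: entry_product_def prob_space)
  next
    case False
    then obtain i where i: "i \<in> I" by blast
    define J where "J = {l\<in>I. \<bar>d l\<bar> = \<bar>d i\<bar>}"
    have "card J = 2" using psubset.prems(1)[of "\<bar>d i\<bar>"] i by (auto simp: J_def)
    moreover have "i \<in> J" using i by (simp add: J_def)
    ultimately obtain j where j: "J = {i, j}" "j \<noteq> i" by (auto simp: card_2_iff doubleton_eq_iff)
    have jI: "j \<in> I" "\<bar>d i\<bar> = \<bar>d j\<bar>" using j by (auto simp: J_def)
    then have dj: "d j = - d i" using psubset.prems(2) i j by blast
    have "expectation (entry_product J d) = expectation (\<lambda>\<omega>. complex_of_real ((cmod (a (d i) \<omega>))\<^sup>2))"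
    proof (intro Bochner_Integration.integral_cong refl)
      fix \<omega> assume "\<omega> \<in> space M"
      then show "entry_product J d \<omega> = complex_of_real ((cmod (a (d i) \<omega>))\<^sup>2)"
        using conj_sym[of \<omega> "d i"] j(2) dj unfolding j(1) entry_product_def
        by (simp add: complex_norm_square del: of_real_power)
    qed
    also have "\<dots> = of_real (expectation (\<lambda>\<omega>. (cmod (a (d i) \<omega>))\<^sup>2))" by (rule integral_complex_of_real)
    also have "\<dots> = 1" using entry_variance[of "d i"] by simp
    finally have EJ: "expectation (entry_product J d) = 1" .
    have "expectation (entry_product (I - J) d) = 1"
    proof (rule psubset.IH)
      show "I - J \<subset> I" using \<open>i \<in> J\<close> i by auto
      fix v assume v: "v \<in> (\<lambda>i. \<bar>d i\<bar>) ` (I - J)"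
      then have "{l\<in>I - J. \<bar>d l\<bar> = v} = {l\<in>I. \<bar>d l\<bar> = v}" by (auto simp: J_def)
      then show "card {l\<in>I - J. \<bar>d l\<bar> = v} = 2" using psubset.prems(1)[of v] v by auto
    qed (use psubset.prems(2) in auto)
    moreover have "expectation (entry_product I d) = expectation (entry_product J d) * expectation (entry_product (I - J) d)"
      using psubset.hyps by (intro expectation_entry_product_split) (auto simp: J_def)
    ultimately show ?thesis using EJ by simp
  qed
qed

end

section \<open>Riemann sums for the partition integrals\<close>

abbreviation lebesgue_power :: "nat \<Rightarrow> (nat \<Rightarrow> real) measure" where
  "lebesgue_power k \<equiv> (\<Pi>\<^sub>M l\<in>{0..k}. lborel)"

text \<open>Graphs over a coordinate hyperplane are null sets, by Fubini's theorem. This takes care of the points where the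
limit integrand jumps and of the faces of the box.\<close>
lemma AE_coordinate_neq:
  assumes l: "l \<le> k" and h: "h \<in> borel_measurable (lebesgue_power k)"
    and indep: "\<And>y t. h (y(l := t)) = h y"
  shows "AE y in lebesgue_power k. y l \<noteq> h y"
proof -
  interpret product_sigma_finite "\<lambda>_::nat. lborel :: real measure" by standard
  define J where "J = {0..k} - {l}"
  have ins: "{0..k} = insert l J" using l by (auto simp: J_def)
  have meas: "(\<lambda>y. y l) \<in> borel_measurable (lebesgue_power k)"
    using l measurable_component_singleton[of l "{0..k}" "\<lambda>_. lborel :: real measure"] by simp
  have S: "{y \<in> space (lebesgue_power k). y l = h y} \<in> sets (lebesgue_power k)"
    using meas h by measurable
  have ind: "indicator {y \<in> space (lebesgue_power k). y l = h y} \<in> borel_measurable (PiM (insert l J) (\<lambda>_. lborel :: real measure))"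
    using S unfolding ins by (intro borel_measurable_indicator)
  have "emeasure (lebesgue_power k) {y \<in> space (lebesgue_power k). y l = h y}
      = (\<integral>\<^sup>+y. indicator {y \<in> space (lebesgue_power k). y l = h y} y \<partial>lebesgue_power k)"
    using S by simp
  also have "\<dots> = (\<integral>\<^sup>+x. \<integral>\<^sup>+t. indicator {y \<in> space (lebesgue_power k). y l = h y} (x(l := t)) \<partial>lborel \<partial>PiM J (\<lambda>_. lborel))"
    using ind unfolding ins by (intro product_nn_integral_insert) (auto simp: J_def)
  also have "\<dots> \<le> (\<integral>\<^sup>+x. \<integral>\<^sup>+t. indicator {h x} t \<partial>lborel \<partial>PiM J (\<lambda>_. lborel))"
    by (intro nn_integral_mono) (auto simp: indicator_def indep)
  also have "\<dots> = 0" by simp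
  finally have "emeasure (lebesgue_power k) {y \<in> space (lebesgue_power k). y l = h y} = 0" by simp
  then show ?thesis by (intro AE_I[of _ _ "{y \<in> space (lebesgue_power k). y l = h y}"] S) auto
qed

context
  fixes k n :: nat and s :: "nat \<Rightarrow> int" and \<beta> :: "nat \<Rightarrow> nat"
  assumes \<beta>: "\<And>i. i \<in> {1..n} \<Longrightarrow> \<beta> i \<in> {1..k}"
begin

text \<open>The step \<open>i\<close> of the path is \<open>s i * z (\<beta> i)\<close>, where \<open>z 0\<close> is the starting point and \<open>z 1, \<dots>, z k\<close> are the free
  values; below, \<open>\<beta>\<close> and \<open>s\<close> are the block numbers and signs of a pair partition.\<close>

definition partial_sum :: "(nat \<Rightarrow> int) \<Rightarrow> nat \<Rightarrow> int" where
  "partial_sum z j = (\<Sum>i=1..j. s i * z (\<beta> i))"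

definition real_partial_sum :: "(nat \<Rightarrow> real) \<Rightarrow> nat \<Rightarrow> real" where
  "real_partial_sum y j = (\<Sum>i=1..j. of_int (s i) * y (\<beta> i))"

text \<open>Coordinate 0 cuts \<open>[0, 1)\<close> into \<open>N\<close> cells, the others cut \<open>[-1, 1)\<close> into
\<open>2 m + 1\<close> cells, one for each of the integers from \<open>-m\<close> to \<open>m\<close>. All cells
of a coordinate have the same length, so the sum over the grid is exactly the integral of a step function, up to
normalisation.\<close>
definition cell :: "nat \<Rightarrow> nat \<Rightarrow> nat \<Rightarrow> int \<Rightarrow> real set" where
  "cell N m l c = (if l = 0 then {of_int c / N ..< (of_int c + 1) / N}
     else {2 * (of_int c + m) / (2 * real m + 1) - 1 ..< 2 * (of_int c + m + 1) / (2 * real m + 1) - 1})"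

definition cell_index :: "nat \<Rightarrow> nat \<Rightarrow> nat \<Rightarrow> real \<Rightarrow> int" where
  "cell_index N m l y = (if l = 0 then \<lfloor>N * y\<rfloor> else \<lfloor>(y + 1) * (2 * real m + 1) / 2\<rfloor> - int m)"

definition grid :: "nat \<Rightarrow> nat \<Rightarrow> (nat \<Rightarrow> int) set" where
  "grid N m = PiE {0..k} (\<lambda>l. if l = 0 then {0..<int N} else {- int m..int m})"

definition allowed :: "nat \<Rightarrow> (nat \<Rightarrow> int) \<Rightarrow> bool" where
  "allowed N z \<longleftrightarrow> (\<forall>j\<in>{1..n}. z 0 + partial_sum z j \<in> {0..<int N})"

definition box :: "(nat \<Rightarrow> real) set" where
  "box = PiE {0..k} (\<lambda>l. if l = 0 then {0..<1} else {-1..<1})"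

definition limit_integrand :: "real \<Rightarrow> (nat \<Rightarrow> real) \<Rightarrow> real" where
  "limit_integrand b y = (\<Prod>j=1..n. indicator {0..1} (y 0 + b * real_partial_sum y j))"

definition step_integrand :: "nat \<Rightarrow> nat \<Rightarrow> (nat \<Rightarrow> real) \<Rightarrow> real" where
  "step_integrand N m y = (\<Sum>z\<in>grid N m. of_bool (allowed N z) * indicator (PiE {0..k} (\<lambda>l. cell N m l (z l))) y)"

lemma finite_grid [simp]: "finite (grid N m)"
  unfolding grid_def by (intro finite_PiE) auto

lemma mem_cell_iff:
  assumes "N \<ge> 1"
  shows "y \<in> cell N m l c \<longleftrightarrow> cell_index N m l y = c"
proof (cases "l = 0")
  case True
  have "y \<in> cell N m l c \<longleftrightarrow> of_int c \<le> N * y \<and> N * y < of_int c + 1"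
    using True assms by (auto simp: cell_def field_simps)
  then show ?thesis using True by (simp add: cell_index_def floor_eq_iff)
next
  case False
  have "y \<in> cell N m l c \<longleftrightarrow> of_int (c + int m) \<le> (y + 1) * (2 * real m + 1) / 2 \<and> (y + 1) * (2 * real m + 1) / 2 < of_int (c + int m) + 1"
    using False by (auto simp: cell_def field_simps)
  also have "\<dots> \<longleftrightarrow> \<lfloor>(y + 1) * (2 * real m + 1) / 2\<rfloor> = c + int m" by (simp only: floor_eq_iff)
  finally show ?thesis using False by (auto simp: cell_index_def)
qed

lemma cell_index_range:
  assumes "N \<ge> 1"
  shows "cell_index N m l y \<in> (if l = 0 then {0..<int N} else {- int m..int m}) \<longleftrightarrow>
    y \<in> (if l = 0 then {0..<1} else {-1..<1})"
proof (cases "l = 0")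
  case True
  have "\<lfloor>N * y\<rfloor> < int N \<longleftrightarrow> y < 1" using assms by (simp add: floor_less_iff)
  moreover have "0 \<le> \<lfloor>N * y\<rfloor> \<longleftrightarrow> 0 \<le> y" using assms by (simp add: zero_le_mult_iff)
  ultimately show ?thesis using True by (simp add: cell_index_def)
next
  case False
  have "\<lfloor>(y + 1) * (2 * real m + 1) / 2\<rfloor> < 2 * int m + 1 \<longleftrightarrow> (y + 1) / 2 * (2 * real m + 1) < 1 * (2 * real m + 1)"
    by (subst floor_less_iff) simp
  also have "\<dots> \<longleftrightarrow> (y + 1) / 2 < 1" by (rule mult_less_cancel_right_pos) simp
  also have "\<dots> \<longleftrightarrow> y < 1" by auto
  finally have "\<lfloor>(y + 1) * (2 * real m + 1) / 2\<rfloor> < 2 * int m + 1 \<longleftrightarrow> y < 1" .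
  moreover have "0 \<le> \<lfloor>(y + 1) * (2 * real m + 1) / 2\<rfloor> \<longleftrightarrow> 0 * (2 * real m + 1) \<le> (y + 1) / 2 * (2 * real m + 1)"
    by simp
  moreover have "\<dots> \<longleftrightarrow> 0 \<le> (y + 1) / 2" by (rule mult_le_cancel_right_pos) simp
  moreover have "0 \<le> (y + 1) / 2 \<longleftrightarrow> -1 \<le> y" by auto
  ultimately show ?thesis using False by (auto simp: cell_index_def)
qed

lemma step_integrand_eq:
  assumes N: "N \<ge> 1"
  shows "step_integrand N m y = (if y \<in> box \<and> allowed N (\<lambda>l\<in>{0..k}. cell_index N m l (y l)) then 1 else 0)"
proof -
  let ?z = "\<lambda>l\<in>{0..k}. cell_index N m l (y l)"
  have iff: "y \<in> PiE {0..k} (\<lambda>l. cell N m l (z l)) \<longleftrightarrow> y \<in> extensional {0..k} \<and> z = ?z" if "z \<in> grid N m" for z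
  proof -
    have "z \<in> extensional {0..k}" using that by (auto simp: grid_def PiE_def)
    then show ?thesis
      by (auto simp: PiE_iff mem_cell_iff[OF N] extensional_def fun_eq_iff)
  qed
  have zg: "?z \<in> grid N m \<and> y \<in> extensional {0..k} \<longleftrightarrow> y \<in> box"
    unfolding grid_def box_def PiE_iff using cell_index_range[OF N, of m] by auto
  have "step_integrand N m y = (\<Sum>z\<in>grid N m. if z = ?z then of_bool (allowed N ?z \<and> y \<in> extensional {0..k}) else 0)"
    unfolding step_integrand_def by (intro sum.cong refl) (auto simp: indicator_def iff)
  also have "\<dots> = (if ?z \<in> grid N m then of_bool (allowed N ?z \<and> y \<in> extensional {0..k}) else 0)"
    by (simp add: sum.delta)
  also have "\<dots> = (if y \<in> box \<and> allowed N ?z then 1 else 0)" using zg by auto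
  finally show ?thesis .
qed

lemma emeasure_cell:
  assumes N: "N \<ge> 1"
  shows "emeasure lborel (cell N m l c) = ennreal (if l = 0 then 1 / N else 2 / (2 * real m + 1))"
proof (cases "l = 0")
  case True
  have "emeasure lborel {of_int c / N ..< (of_int c + 1) / N :: real} = ennreal ((of_int c + 1) / N - of_int c / N)"
    using N by (intro emeasure_lborel_Ico) (simp add: divide_right_mono)
  also have "(of_int c + 1) / N - of_int c / N = (1 / N :: real)" by (simp add: add_divide_distrib)
  finally show ?thesis using True by (simp add: cell_def)
next
  case False
  have "emeasure lborel {2 * (of_int c + m) / (2 * real m + 1) - 1 ..< 2 * (of_int c + m + 1) / (2 * real m + 1) - 1 :: real}
    = ennreal ((2 * (of_int c + m + 1) / (2 * real m + 1) - 1) - (2 * (of_int c + m) / (2 * real m + 1) - 1))"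
    by (intro emeasure_lborel_Ico) (simp add: divide_right_mono)
  also have "(2 * (of_int c + m + 1) / (2 * real m + 1) - 1) - (2 * (of_int c + m) / (2 * real m + 1) - 1) = (2 / (2 * real m + 1) :: real)"
    by (simp add: diff_divide_distrib[symmetric])
  finally show ?thesis using False by (simp add: cell_def)
qed

lemma cell_box_measure:
  assumes N: "N \<ge> 1"
  shows "PiE {0..k} (\<lambda>l. cell N m l (z l)) \<in> sets (lebesgue_power k)"
    and "emeasure (lebesgue_power k) (PiE {0..k} (\<lambda>l. cell N m l (z l))) = ennreal (1 / N * (2 / (2 * real m + 1)) ^ k)"
proof -
  interpret product_sigma_finite "\<lambda>_::nat. lborel :: real measure" by standard
  show "PiE {0..k} (\<lambda>l. cell N m l (z l)) \<in> sets (lebesgue_power k)"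
    by (intro sets_PiM_I_finite) (auto simp: cell_def)
  have "emeasure (lebesgue_power k) (PiE {0..k} (\<lambda>l. cell N m l (z l))) = (\<Prod>l\<in>{0..k}. emeasure lborel (cell N m l (z l)))"
    by (rule emeasure_PiM) (auto simp: cell_def)
  also have "\<dots> = (\<Prod>l\<in>{0..k}. ennreal (if l = 0 then 1 / N else 2 / (2 * real m + 1)))"
    by (simp only: emeasure_cell[OF N])
  also have "\<dots> = ennreal (\<Prod>l\<in>{0..k}. if l = 0 then 1 / N else 2 / (2 * real m + 1))"
    by (rule prod_ennreal) auto
  also have "(\<Prod>l\<in>{0..k}. if l = 0 then 1 / N else 2 / (2 * real m + 1)) = 1 / N * (2 / (2 * real m + 1) :: real) ^ k"
    by (simp add: prod.atLeast_Suc_atMost)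
  finally show "emeasure (lebesgue_power k) (PiE {0..k} (\<lambda>l. cell N m l (z l))) = ennreal (1 / N * (2 / (2 * real m + 1)) ^ k)" .
qed

lemma integral_step_integrand:
  assumes N: "N \<ge> 1"
  shows "(\<integral>y. step_integrand N m y \<partial>lebesgue_power k) = card {z\<in>grid N m. allowed N z} * (1 / N * (2 / (2 * real m + 1)) ^ k)"
proof -
  have I: "integrable (lebesgue_power k) (indicat_real (PiE {0..k} (\<lambda>l. cell N m l (z l))))" for z
    using cell_box_measure[OF N, of m z] by (intro integrable_real_indicator) auto
  have "(\<integral>y. step_integrand N m y \<partial>lebesgue_power k)
      = (\<Sum>z\<in>grid N m. of_bool (allowed N z) * measure (lebesgue_power k) (PiE {0..k} (\<lambda>l. cell N m l (z l))))"
    unfolding step_integrand_def using I cell_box_measure(1)[OF N, of m]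
    by (subst Bochner_Integration.integral_sum) auto
  also have "\<dots> = (\<Sum>z\<in>grid N m. of_bool (allowed N z) * (1 / N * (2 / (2 * real m + 1)) ^ k))"
    using cell_box_measure(2)[OF N, of m] by (simp add: measure_def)
  also have "\<dots> = (\<Sum>z\<in>grid N m. of_bool (allowed N z)) * (1 / N * (2 / (2 * real m + 1)) ^ k)"
    by (simp only: sum_distrib_right)
  also have "(\<Sum>z\<in>grid N m. of_bool (allowed N z)) = real (card {z\<in>grid N m. allowed N z})"
    by (simp add: of_bool_def sum.If_cases Int_def)
  finally show ?thesis .
qed

lemma card_allowed:
  "card {z\<in>grid N m. allowed N z} = (\<Sum>x\<in>words k m. start_count N n (\<lambda>i. s i * x (\<beta> i)))"
proof -
  have ins: "{0..k} = insert 0 {1..k}" by auto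
  define T where "T = (\<lambda>l::nat. if l = 0 then {0..<int N} else {- int m..int m})"
  have T: "T 0 = {0..<int N}" "PiE {1..k} T = words k m"
    by (auto simp: T_def words_def intro!: PiE_cong)
  have "grid N m = PiE {0..k} T" by (simp add: grid_def T_def)
  also have "\<dots> = (\<lambda>(q, x). x(0 := q)) ` ({0..<int N} \<times> words k m)"
    unfolding ins PiE_insert_eq T ..
  finally have grid_eq: "grid N m = (\<lambda>(q, x). x(0 := q)) ` ({0..<int N} \<times> words k m)" .
  have inj: "inj_on (\<lambda>(q, x). x(0 := q)) ({0..<int N} \<times> words k m)"
    using inj_combinator[of 0 "{1..k}" T] unfolding T by simp
  define S where "S = (SIGMA x:words k m. {q\<in>{..<N}. allowed N (x(0 := int q))})"
  have "{z\<in>grid N m. allowed N z} = (\<lambda>(x, q). x(0 := int q)) ` S"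
  proof (intro subset_antisym subsetI)
    fix z assume "z \<in> {z\<in>grid N m. allowed N z}"
    then obtain q x where qx: "z = x(0 := q)" "q \<in> {0..<int N}" "x \<in> words k m" "allowed N z"
      using grid_eq by auto
    then have "(x, nat q) \<in> S" "z = x(0 := int (nat q))" by (auto simp: S_def)
    then show "z \<in> (\<lambda>(x, q). x(0 := int q)) ` S" by (intro image_eqI[of _ _ "(x, nat q)"]) auto
  next
    fix z assume "z \<in> (\<lambda>(x, q). x(0 := int q)) ` S"
    then obtain x q where "z = x(0 := int q)" "x \<in> words k m" "q < N" "allowed N z" by (auto simp: S_def)
    then show "z \<in> {z\<in>grid N m. allowed N z}"
      unfolding grid_eq by (auto intro!: image_eqI[of _ _ "(int q, x)"])
  qed
  moreover have "inj_on (\<lambda>(x, q). x(0 := int q)) S"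
  proof (rule inj_onI)
    fix u v assume "u \<in> S" "v \<in> S" "(case u of (x, q) \<Rightarrow> x(0 := int q)) = (case v of (x, q) \<Rightarrow> x(0 := int q))"
    then show "u = v"
      using inj_onD[OF inj, of "(int (snd u), fst u)" "(int (snd v), fst v)"]
      by (cases u, cases v) (simp add: S_def)
  qed
  ultimately have "card {z\<in>grid N m. allowed N z} = card S" by (simp add: card_image)
  also have "card S = card (SIGMA x:words k m. {q\<in>{..<N}. allowed N (x(0 := int q))})"
    by (simp only: S_def)
  also have "\<dots> = (\<Sum>x\<in>words k m. card {q\<in>{..<N}. allowed N (x(0 := int q))})"
    by (subst card_SigmaI) auto
  also have "\<dots> = (\<Sum>x\<in>words k m. start_count N n (\<lambda>i. s i * x (\<beta> i)))"
  proof (intro sum.cong refl)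
    fix x
    have "partial_sum (x(0 := q)) j = (\<Sum>i=1..j. s i * x (\<beta> i))" if "j \<in> {1..n}" for j q
      unfolding partial_sum_def
    proof (intro sum.cong refl)
      fix i assume "i \<in> {1..j}"
      then have "\<beta> i \<noteq> 0" using \<beta>[of i] that by auto
      then show "s i * (x(0 := q)) (\<beta> i) = s i * x (\<beta> i)" by simp
    qed
    then have "allowed N (x(0 := int q)) \<longleftrightarrow> stays N n q (\<lambda>i. s i * x (\<beta> i))" for q
      unfolding allowed_def stays_def by simp
    then show "card {q\<in>{..<N}. allowed N (x(0 := int q))} = start_count N n (\<lambda>i. s i * x (\<beta> i))"
      unfolding start_count_def by simp
  qed
  finally show ?thesis .
qed

lemma tendsto_floor_divide:
  assumes "(\<lambda>N. f N / real N) \<longlonglongrightarrow> c"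
  shows "(\<lambda>N. of_int \<lfloor>f N\<rfloor> / real N) \<longlonglongrightarrow> c"
proof -
  have "(\<lambda>N. f N / real N - frac (f N) / real N) \<longlonglongrightarrow> c - 0"
  proof (intro tendsto_diff assms)
    have "norm (frac (f N) / real N) \<le> 1 / real N" for N
      using frac_lt_1[of "f N"] frac_ge_0[of "f N"] by (simp add: divide_right_mono)
    then show "(\<lambda>N. frac (f N) / real N) \<longlonglongrightarrow> 0"
      by (intro Lim_null_comparison[OF _ lim_1_over_n]) auto
  qed
  moreover have "f N / real N - frac (f N) / real N = of_int \<lfloor>f N\<rfloor> / real N" for N
    by (simp add: frac_def diff_divide_distrib)
  ultimately show ?thesis by simp
qed

lemma cell_index_tendsto:
  assumes "(\<lambda>N. real (bN N) / real N) \<longlonglongrightarrow> b"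
  shows "(\<lambda>N. of_int (cell_index N (bN N) l y) / real N) \<longlonglongrightarrow> (if l = 0 then y else b * y)"
proof (cases "l = 0")
  case True
  have "(\<lambda>N. (real N * y) / real N) \<longlonglongrightarrow> y"
    by (rule tendsto_eventually) (use eventually_gt_at_top[of 0] in eventually_elim, auto)
  from tendsto_floor_divide[OF this] show ?thesis using True by (simp add: cell_index_def)
next
  case False
  have "(\<lambda>N. (y + 1) * (real (bN N) / real N) + (y + 1) / 2 * (1 / real N)) \<longlonglongrightarrow> (y + 1) * b + (y + 1) / 2 * 0"
    by (intro tendsto_intros assms lim_1_over_n)
  moreover have "(y + 1) * (real (bN N) / real N) + (y + 1) / 2 * (1 / real N) = ((y + 1) * (2 * real (bN N) + 1) / 2) / real N" for N
    by (cases "N = 0") (simp_all add: field_simps)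
  ultimately have "(\<lambda>N. ((y + 1) * (2 * real (bN N) + 1) / 2) / real N) \<longlonglongrightarrow> (y + 1) * b" by simp
  from tendsto_diff[OF tendsto_floor_divide[OF this] assms] 
  have "(\<lambda>N. of_int \<lfloor>(y + 1) * (2 * real (bN N) + 1) / 2\<rfloor> / real N - real (bN N) / real N) \<longlonglongrightarrow> b * y"
    by (simp add: algebra_simps)
  then show ?thesis using False by (simp add: cell_index_def diff_divide_distrib)
qed

text \<open>If \<open>m = b\<^sub>N\<close>, the integer that belongs to \<open>y \<in> [-1, 1)\<close> is \<open>b N y +
o(N)\<close>, which is where the factor \<open>b\<close> in the integrand comes from. The condition on
\<open>y\<close> keeps the rescaled path away from the endpoints of \<open>[0, 1]\<close>.\<close>
lemma step_integrand_tendsto: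
  assumes lim: "(\<lambda>N. real (bN N) / real N) \<longlonglongrightarrow> b"
    and y: "\<And>j. j \<in> {1..n} \<Longrightarrow> y 0 + b * real_partial_sum y j \<noteq> 0 \<and> y 0 + b * real_partial_sum y j \<noteq> 1"
  shows "(\<lambda>N. step_integrand N (bN N) y) \<longlonglongrightarrow> indicator box y * limit_integrand b y"
proof -
  define z where "z N = (\<lambda>l\<in>{0..k}. cell_index N (bN N) l (y l))" for N
  define L where "L j = y 0 + b * real_partial_sum y j" for j
  have lim_z: "(\<lambda>N. of_int (z N 0 + partial_sum (z N) j) / real N) \<longlonglongrightarrow> L j" if j: "j \<in> {1..n}" for j
  proof -
    have "(\<lambda>N. of_int (cell_index N (bN N) 0 (y 0)) / real N
        + (\<Sum>i=1..j. of_int (s i) * (of_int (cell_index N (bN N) (\<beta> i) (y (\<beta> i))) / real N)))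
      \<longlonglongrightarrow> (if (0::nat) = 0 then y 0 else b * y 0) + (\<Sum>i=1..j. of_int (s i) * (if \<beta> i = 0 then y (\<beta> i) else b * y (\<beta> i)))"
      by (intro tendsto_intros cell_index_tendsto lim)
    moreover have "(if (0::nat) = 0 then y 0 else b * y 0) + (\<Sum>i=1..j. of_int (s i) * (if \<beta> i = 0 then y (\<beta> i) else b * y (\<beta> i))) = L j"
    proof -
      have "(\<Sum>i=1..j. of_int (s i) * (if \<beta> i = 0 then y (\<beta> i) else b * y (\<beta> i))) = b * real_partial_sum y j"
        unfolding real_partial_sum_def sum_distrib_left
      proof (intro sum.cong refl)
        fix i assume "i \<in> {1..j}"
        then have "\<beta> i \<noteq> 0" using \<beta>[of i] j by auto
        then show "of_int (s i) * (if \<beta> i = 0 then y (\<beta> i) else b * y (\<beta> i)) = b * (of_int (s i) * y (\<beta> i))" by simp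
      qed
      then show ?thesis by (simp add: L_def)
    qed
    moreover have "of_int (cell_index N (bN N) 0 (y 0)) / real N
        + (\<Sum>i=1..j. of_int (s i) * (of_int (cell_index N (bN N) (\<beta> i) (y (\<beta> i))) / real N))
      = of_int (z N 0 + partial_sum (z N) j) / real N" for N
    proof -
      have "partial_sum (z N) j = (\<Sum>i=1..j. s i * cell_index N (bN N) (\<beta> i) (y (\<beta> i)))"
        unfolding partial_sum_def
      proof (intro sum.cong refl)
        fix i assume "i \<in> {1..j}"
        then have "\<beta> i \<in> {0..k}" using \<beta>[of i] j by auto
        then show "s i * z N (\<beta> i) = s i * cell_index N (bN N) (\<beta> i) (y (\<beta> i))" by (simp add: z_def)
      qed
      then show ?thesis by (simp add: z_def add_divide_distrib sum_divide_distrib)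
    qed
    ultimately show ?thesis by simp
  qed
  have N1: "\<forall>\<^sub>F N in sequentially. N \<ge> 1" by (rule eventually_ge_at_top)
  define X where "X N j = of_int (z N 0 + partial_sum (z N) j) / real N" for N j
  have lim_X: "(\<lambda>N. X N j) \<longlonglongrightarrow> L j" if "j \<in> {1..n}" for j
    using lim_z[OF that] by (simp add: X_def)
  have rng: "(z N 0 + partial_sum (z N) j \<in> {0..<int N}) \<longleftrightarrow> (0 \<le> X N j \<and> X N j < 1)" if "N \<ge> 1" for N j
  proof -
    have "X N j < 1 \<longleftrightarrow> real_of_int (z N 0 + partial_sum (z N) j) < real_of_int (int N)"
      unfolding X_def using that by simp
    moreover have "0 \<le> X N j \<longleftrightarrow> 0 \<le> real_of_int (z N 0 + partial_sum (z N) j)"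
      unfolding X_def using that by (simp add: zero_le_divide_iff)
    ultimately show ?thesis by (simp only: of_int_less_iff of_int_0_le_iff atLeastLessThan_iff)
  qed
  have ev: "\<forall>\<^sub>F N in sequentially. (z N 0 + partial_sum (z N) j \<in> {0..<int N}) \<longleftrightarrow> L j \<in> {0..1}" if j: "j \<in> {1..n}" for j
  proof -
    have ne: "L j \<noteq> 0" "L j \<noteq> 1" using y[OF j] by (auto simp: L_def)
    then consider "L j < 0" | "0 < L j" "L j < 1" | "L j > 1" by linarith
    then show ?thesis
    proof cases
      case 1
      show ?thesis using order_tendstoD(2)[OF lim_X[OF j] 1] N1
      proof eventually_elim
        case (elim N)
        then show ?case unfolding rng[OF elim(2)] using 1 by auto
      qed
    next
      case 2
      show ?thesis using order_tendstoD(1)[OF lim_X[OF j] 2(1)] order_tendstoD(2)[OF lim_X[OF j] 2(2)] N1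
      proof eventually_elim
        case (elim N)
        then show ?case unfolding rng[OF elim(3)] using 2 by auto
      qed
    next
      case 3
      show ?thesis using order_tendstoD(1)[OF lim_X[OF j] 3] N1
      proof eventually_elim
        case (elim N)
        then show ?case unfolding rng[OF elim(2)] using 3 by auto
      qed
    qed
  qed
  have "\<forall>\<^sub>F N in sequentially. \<forall>j\<in>{1..n}. (z N 0 + partial_sum (z N) j \<in> {0..<int N}) \<longleftrightarrow> L j \<in> {0..1}"
    using ev by (intro eventually_ball_finite) auto
  then have "\<forall>\<^sub>F N in sequentially. step_integrand N (bN N) y = indicator box y * limit_integrand b y"
    using N1
  proof eventually_elim
    case (elim N)
    have "allowed N (z N) \<longleftrightarrow> (\<forall>j\<in>{1..n}. L j \<in> {0..1})" using elim by (simp add: allowed_def)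
    moreover have "limit_integrand b y = of_bool (\<forall>j\<in>{1..n}. L j \<in> {0..1})"
      unfolding limit_integrand_def L_def
      by (cases "\<forall>j\<in>{1..n}. y 0 + b * real_partial_sum y j \<in> {0..1}") (auto simp: indicator_def intro!: prod.neutral)
    ultimately show ?case
      using step_integrand_eq[OF elim(2), of "bN N" y] by (auto simp: z_def indicator_def)
  qed
  then show ?thesis by (rule tendsto_eventually)
qed

lemma measurable_rpartial: "j \<le> n \<Longrightarrow> (\<lambda>y. real_partial_sum y j) \<in> borel_measurable (lebesgue_power k)"
  unfolding real_partial_sum_def
proof (intro borel_measurable_sum borel_measurable_times borel_measurable_const)
  fix i assume "j \<le> n" "i \<in> {1..j}"
  then have "\<beta> i \<in> {0..k}" using \<beta>[of i] by auto
  then show "(\<lambda>y. y (\<beta> i)) \<in> borel_measurable (lebesgue_power k)"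
    using measurable_component_singleton[of "\<beta> i" "{0..k}" "\<lambda>_. lborel :: real measure"] by simp
qed

lemma real_partial_sum_upd_0: "j \<le> n \<Longrightarrow> real_partial_sum (y(0 := t)) j = real_partial_sum y j"
  unfolding real_partial_sum_def
proof (intro sum.cong refl)
  fix i assume "j \<le> n" "i \<in> {1..j}"
  then have "\<beta> i \<noteq> 0" using \<beta>[of i] by auto
  then show "of_int (s i) * (y(0 := t)) (\<beta> i) = of_int (s i) * y (\<beta> i)" by simp
qed

lemma AE_generic:
  "AE y in lebesgue_power k. (\<forall>j\<in>{1..n}. y 0 + b * real_partial_sum y j \<noteq> 0 \<and> y 0 + b * real_partial_sum y j \<noteq> 1) \<and> (\<forall>l\<in>{0..k}. y l \<noteq> 1)"
proof -
  have 1: "AE y in lebesgue_power k. y 0 \<noteq> c - b * real_partial_sum y j" if "j \<in> {1..n}" for j c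
    using that measurable_rpartial[of j] by (intro AE_coordinate_neq) (auto simp: real_partial_sum_upd_0)
  have 2: "AE y in lebesgue_power k. y l \<noteq> 1" if "l \<in> {0..k}" for l
    using that by (intro AE_coordinate_neq) auto
  have "AE y in lebesgue_power k. \<forall>j\<in>{1..n}. y 0 \<noteq> 0 - b * real_partial_sum y j \<and> y 0 \<noteq> 1 - b * real_partial_sum y j"
    by (intro AE_finite_allI AE_conjI 1) auto
  moreover have "AE y in lebesgue_power k. \<forall>l\<in>{0..k}. y l \<noteq> 1"
    by (intro AE_finite_allI 2) auto
  ultimately show ?thesis by eventually_elim (auto simp: algebra_simps)
qed

text \<open>Dominated convergence for the step functions. The factor \<open>b ^ k\<close> is the limit of the ratio
\<open>((2 b\<^sub>N + 1) / (2 N)) ^ k\<close> of grid points to volume.\<close>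
lemma normalized_start_counts_tendsto:
  assumes lim: "(\<lambda>N. real (bN N) / real N) \<longlonglongrightarrow> b"
  shows "(\<lambda>N. (\<Sum>x\<in>words k (bN N). real (start_count N n (\<lambda>i. s i * x (\<beta> i)))) / real N ^ (k + 1))
    \<longlonglongrightarrow> b ^ k * (LINT y : (PiE {0..k} (\<lambda>l. if l = 0 then {0..1} else {-1..1})) | lebesgue_power k. limit_integrand b y)"
proof -
  interpret product_sigma_finite "\<lambda>_::nat. lborel :: real measure" by standard
  let ?Q = "PiE {0..k} (\<lambda>l. if l = 0 then {0..1} else {-1..1::real})"
  have box_sets: "box \<in> sets (lebesgue_power k)"
    unfolding box_def by (intro sets_PiM_I_finite) auto
  have "emeasure (lebesgue_power k) box = (\<Prod>l\<in>{0..k}. emeasure lborel (if l = 0 then {0..<1} else {-1..<1::real}))"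
    unfolding box_def by (rule emeasure_PiM) auto
  also have "\<dots> < \<infinity>" by (auto simp: ennreal_prod_eq_top less_top[symmetric] split: if_splits)
  finally have int_box: "integrable (lebesgue_power k) (indicat_real box)"
    using box_sets by (intro integrable_real_indicator) auto
  have y0: "(\<lambda>y. y 0) \<in> borel_measurable (lebesgue_power k)"
    using measurable_component_singleton[of 0 "{0..k}" "\<lambda>_. lborel :: real measure"] by simp
  have lim_meas: "limit_integrand b \<in> borel_measurable (lebesgue_power k)"
    unfolding limit_integrand_def[abs_def]
  proof (intro borel_measurable_prod)
    fix j assume "j \<in> {1..n}"
    then have "(\<lambda>y. y 0 + b * real_partial_sum y j) \<in> borel_measurable (lebesgue_power k)"
      using y0 measurable_rpartial[of j] by auto
    then show "(\<lambda>y. indicat_real {0..1} (y 0 + b * real_partial_sum y j)) \<in> borel_measurable (lebesgue_power k)"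
      by (rule measurable_compose) simp
  qed
  have "(\<lambda>N. \<integral>y. step_integrand (Suc N) (bN (Suc N)) y \<partial>lebesgue_power k)
    \<longlonglongrightarrow> (\<integral>y. indicator box y * limit_integrand b y \<partial>lebesgue_power k)"
  proof (rule integral_dominated_convergence[where w = "indicat_real box"])
    show "(\<lambda>y. indicator box y * limit_integrand b y) \<in> borel_measurable (lebesgue_power k)"
      using lim_meas box_sets by auto
    show "step_integrand (Suc N) (bN (Suc N)) \<in> borel_measurable (lebesgue_power k)" for N
      unfolding step_integrand_def[abs_def] using cell_box_measure(1)[of "Suc N"] by auto
    show "AE y in lebesgue_power k. (\<lambda>N. step_integrand (Suc N) (bN (Suc N)) y) \<longlonglongrightarrow> indicator box y * limit_integrand b y"
      using AE_generic[of b]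
    proof eventually_elim
      case (elim y)
      then show ?case using step_integrand_tendsto[OF lim, of y] by (intro LIMSEQ_Suc) auto
    qed
    show "AE y in lebesgue_power k. norm (step_integrand (Suc N) (bN (Suc N)) y) \<le> indicat_real box y" for N
      by (intro AE_I2) (simp add: step_integrand_eq)
  qed (rule int_box)
  then have conv: "(\<lambda>N. \<integral>y. step_integrand N (bN N) y \<partial>lebesgue_power k)
    \<longlonglongrightarrow> (\<integral>y. indicator box y * limit_integrand b y \<partial>lebesgue_power k)"
    by (rule LIMSEQ_imp_Suc)
  have "(\<integral>y. indicator box y * limit_integrand b y \<partial>lebesgue_power k)
      = (\<integral>y. indicator ?Q y *\<^sub>R limit_integrand b y \<partial>lebesgue_power k)"
  proof (rule integral_cong_AE)
    show "(\<lambda>y. indicator box y * limit_integrand b y) \<in> borel_measurable (lebesgue_power k)"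
      using lim_meas box_sets by auto
    have "?Q \<in> sets (lebesgue_power k)" by (intro sets_PiM_I_finite) auto
    then show "(\<lambda>y. indicator ?Q y *\<^sub>R limit_integrand b y) \<in> borel_measurable (lebesgue_power k)"
      using lim_meas by auto
    show "AE y in lebesgue_power k. indicator box y * limit_integrand b y = indicator ?Q y *\<^sub>R limit_integrand b y"
      using AE_generic[of b]
    proof eventually_elim
      case (elim y)
      have "y l \<in> (if l = 0 then {0..<1} else {-1..<1}) \<longleftrightarrow> y l \<in> (if l = 0 then {0..1} else {-1..1})"
        if "l \<in> {0..k}" for l
      proof -
        have "y l \<noteq> 1" using elim that by blast
        then have "y l < 1 \<longleftrightarrow> y l \<le> 1" by linarith
        then show ?thesis by (cases "l = 0") simp_all
      qed
      then have "(\<forall>l\<in>{0..k}. y l \<in> (if l = 0 then {0..<1} else {-1..<1})) \<longleftrightarrow>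
          (\<forall>l\<in>{0..k}. y l \<in> (if l = 0 then {0..1} else {-1..1}))"
        by (rule ball_cong[OF refl])
      then have "y \<in> box \<longleftrightarrow> y \<in> ?Q" unfolding box_def PiE_iff by (rule arg_cong)
      then show ?case by (simp add: indicator_def)
    qed
  qed
  then have eq: "(\<integral>y. indicator box y * limit_integrand b y \<partial>lebesgue_power k)
      = (LINT y : ?Q | lebesgue_power k. limit_integrand b y)"
    by (simp add: set_lebesgue_integral_def)
  have "(\<lambda>N. real (bN N) / real N + 1 / 2 * (1 / real N)) \<longlonglongrightarrow> b + 1 / 2 * 0"
    by (intro tendsto_intros lim lim_1_over_n)
  then have "(\<lambda>N. (real (bN N) / real N + 1 / 2 * (1 / real N)) ^ k
      * (\<integral>y. step_integrand N (bN N) y \<partial>lebesgue_power k))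
    \<longlonglongrightarrow> (b + 1 / 2 * 0) ^ k * (\<integral>y. indicator box y * limit_integrand b y \<partial>lebesgue_power k)"
    by (intro tendsto_mult tendsto_power conv)
  moreover have "\<forall>\<^sub>F N in sequentially. (real (bN N) / real N + 1 / 2 * (1 / real N)) ^ k
      * (\<integral>y. step_integrand N (bN N) y \<partial>lebesgue_power k)
      = (\<Sum>x\<in>words k (bN N). real (start_count N n (\<lambda>i. s i * x (\<beta> i)))) / real N ^ (k + 1)"
    using eventually_ge_at_top[of "1::nat"]
  proof eventually_elim
    case (elim N)
    have "real (bN N) / real N + 1 / 2 * (1 / real N) = (2 * real (bN N) + 1) / 2 / real N"
      by (cases "N = 0") (simp_all add: field_simps)
    moreover have "(2 * real (bN N) + 1) / 2 / real N * (2 / (2 * real (bN N) + 1)) = 1 / real N"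
      using elim by (simp add: divide_simps)
    ultimately have "(real (bN N) / real N + 1 / 2 * (1 / real N)) ^ k * (2 / (2 * real (bN N) + 1)) ^ k = (1 / real N) ^ k"
      unfolding power_mult_distrib[symmetric] by simp
    then have "(real (bN N) / real N + 1 / 2 * (1 / real N)) ^ k * (C * (1 / real N * (2 / (2 * real (bN N) + 1)) ^ k))
        = C * (1 / real N * (1 / real N) ^ k)" for C
      by (metis mult.assoc mult.left_commute)
    also have "C * (1 / real N * (1 / real N) ^ k) = C / real N ^ (k + 1)" for C
      by (simp add: power_one_over)
    finally show ?case
      using integral_step_integrand[OF elim, of "bN N"] card_allowed[of N "bN N"] by simp
  qed
  ultimately show ?thesis unfolding eq by (auto elim: Lim_transform_eventually)
qed

end

section \<open>Words given by pair partitions\<close>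

definition int_sign :: "nat set set \<Rightarrow> nat \<Rightarrow> int" where
  "int_sign \<pi> i = (if i = Min (block_of \<pi> i) then 1 else - 1)"

text \<open>The word that \<open>\<pi>\<close> makes of the free values \<open>x\<close>: the two positions of block
\<open>c\<close> carry \<open>x c\<close> and \<open>- x c\<close>.\<close>
definition pair_word :: "nat \<Rightarrow> nat set set \<Rightarrow> (nat \<Rightarrow> int) \<Rightarrow> nat \<Rightarrow> int" where
  "pair_word k \<pi> x = (\<lambda>i\<in>{1..2*k}. int_sign \<pi> i * x (block_number \<pi> i))"

lemma block_sign_eq: "block_sign \<pi> i = of_int (int_sign \<pi> i)"
  by (simp add: block_sign_def int_sign_def)

lemma start_count_cong:
  assumes "\<And>i. i \<in> {1..r} \<Longrightarrow> d i = d' i"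
  shows "start_count N r d = start_count N r d'"
proof -
  have "(\<Sum>l=1..j. d l) = (\<Sum>l=1..j. d' l)" if "j \<in> {1..r}" for j
    using that assms by (intro sum.cong) auto
  then show ?thesis unfolding start_count_def stays_def by simp
qed

lemma start_count_le: "start_count N r d \<le> N"
  unfolding start_count_def using card_mono[of "{..<N}" "{q\<in>{..<N}. stays N r q d}"] by auto

context
  fixes k :: nat and \<pi> :: "nat set set"
  assumes \<pi>: "\<pi> \<in> pair_partitions (2 * k)"
begin

lemma partition_on_blocks: "partition_on {1..2*k} \<pi>" and card_block: "V \<in> \<pi> \<Longrightarrow> card V = 2"
  using \<pi> by (auto simp: pair_partitions_def)

lemma block_of_eq: "V \<in> \<pi> \<Longrightarrow> i \<in> V \<Longrightarrow> block_of \<pi> i = V"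
  unfolding block_of_def using partition_on_blocks by (intro the_equality) (auto simp: partition_on_def disjoint_def)

lemma block_of_mem:
  assumes "i \<in> {1..2*k}"
  shows "block_of \<pi> i \<in> \<pi>" "i \<in> block_of \<pi> i"
proof -
  have "i \<in> \<Union>\<pi>" using partition_on_blocks assms by (simp add: partition_on_def)
  then obtain V where "V \<in> \<pi>" "i \<in> V" by blast
  then show "block_of \<pi> i \<in> \<pi>" "i \<in> block_of \<pi> i" using block_of_eq by auto
qed

lemma block_subset: "V \<in> \<pi> \<Longrightarrow> V \<subseteq> {1..2*k}"
  using partition_on_blocks by (auto simp: partition_on_def)

lemma finite_block: "V \<in> \<pi> \<Longrightarrow> finite V"
  using block_subset finite_subset by blast

lemma finite_partition: "finite \<pi>"
  using finite_elements[OF _ partition_on_blocks] by simp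

lemma block_ne: "V \<in> \<pi> \<Longrightarrow> V \<noteq> {}"
  using card_block by fastforce

lemma Min_block_mem: "V \<in> \<pi> \<Longrightarrow> Min V \<in> V"
  using finite_block block_ne by simp

lemma Min_block_inj: "V \<in> \<pi> \<Longrightarrow> V' \<in> \<pi> \<Longrightarrow> Min V = Min V' \<Longrightarrow> V = V'"
  using Min_block_mem[of V] Min_block_mem[of V'] block_of_eq by metis

lemma card_partition: "card \<pi> = k"
proof -
  have "card (\<Union>\<pi>) = (\<Sum>V\<in>\<pi>. card V)"
    using partition_on_blocks finite_block by (intro card_Union_disjoint) (auto simp: partition_on_def disjoint_def pairwise_def disjnt_def)
  also have "\<dots> = (\<Sum>V\<in>\<pi>. 2)" using card_block by (intro sum.cong) auto
  finally show ?thesis using partition_on_blocks by (simp add: partition_on_def)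
qed

definition rank_of :: "nat set \<Rightarrow> nat" where
  "rank_of V = card {V'\<in>\<pi>. Min V' \<le> Min V}"

lemma block_number_eq: "block_number \<pi> i = rank_of (block_of \<pi> i)"
  by (simp add: block_number_def rank_of_def)

lemma rank_of_bij: "bij_betw rank_of \<pi> {1..k}"
proof -
  have lt: "rank_of V < rank_of V'" if "V' \<in> \<pi>" "Min V < Min V'" for V V'
    unfolding rank_of_def
  proof (rule psubset_card_mono)
    have "V' \<in> {W\<in>\<pi>. Min W \<le> Min V'} - {W\<in>\<pi>. Min W \<le> Min V}" using that by simp
    moreover have "{W\<in>\<pi>. Min W \<le> Min V} \<subseteq> {W\<in>\<pi>. Min W \<le> Min V'}" using that by auto
    ultimately show "{W\<in>\<pi>. Min W \<le> Min V} \<subset> {W\<in>\<pi>. Min W \<le> Min V'}" by blast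
  qed (use finite_partition in simp)
  have inj: "inj_on rank_of \<pi>"
  proof (rule inj_onI)
    fix V V' assume "V \<in> \<pi>" "V' \<in> \<pi>" "rank_of V = rank_of V'"
    then have "\<not> Min V < Min V'" "\<not> Min V' < Min V" using lt[of V' V] lt[of V V'] by auto
    then have "Min V = Min V'" by simp
    then show "V = V'" using Min_block_inj \<open>V \<in> \<pi>\<close> \<open>V' \<in> \<pi>\<close> by blast
  qed
  have "rank_of V \<in> {1..k}" if V: "V \<in> \<pi>" for V
  proof -
    have "card {V'\<in>\<pi>. Min V' \<le> Min V} \<le> card \<pi>" using finite_partition by (intro card_mono) auto
    moreover have "card {V} \<le> card {V'\<in>\<pi>. Min V' \<le> Min V}" using finite_partition V by (intro card_mono) auto
    ultimately show ?thesis by (simp add: rank_of_def card_partition)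
  qed
  then have "rank_of ` \<pi> \<subseteq> {1..k}" by auto
  then have "rank_of ` \<pi> = {1..k}"
    using card_image[OF inj] card_partition by (intro card_subset_eq) auto
  then show ?thesis using inj by (simp add: bij_betw_def)
qed

lemma block_number_range: "i \<in> {1..2*k} \<Longrightarrow> block_number \<pi> i \<in> {1..k}"
  using rank_of_bij block_of_mem(1) by (auto simp: block_number_eq bij_betw_def)

lemma block_number_eq_iff:
  assumes "i \<in> {1..2*k}" "j \<in> {1..2*k}"
  shows "block_number \<pi> i = block_number \<pi> j \<longleftrightarrow> block_of \<pi> i = block_of \<pi> j"
  using rank_of_bij assms block_of_mem(1) by (auto simp: block_number_eq bij_betw_def inj_on_def)

lemma same_block_signs:
  assumes "i \<in> {1..2*k}" "j \<in> {1..2*k}" "i \<noteq> j" "block_of \<pi> i = block_of \<pi> j"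
  shows "int_sign \<pi> j = - int_sign \<pi> i"
proof -
  let ?V = "block_of \<pi> i"
  have V: "?V \<in> \<pi>" "i \<in> ?V" "j \<in> ?V" using block_of_mem assms by auto
  then have "{i, j} = ?V" using card_block[OF V(1)] assms(3) finite_block[OF V(1)] by (intro card_seteq) auto
  moreover have "Min ?V \<in> ?V" using V Min_block_mem by auto
  ultimately have "Min ?V = i \<or> Min ?V = j" by auto
  then show ?thesis using assms(3,4) by (auto simp: int_sign_def)
qed

lemma pair_word_mem: "x \<in> words k m \<Longrightarrow> pair_word k \<pi> x \<in> words (2 * k) m"
proof -
  assume x: "x \<in> words k m"
  have "pair_word k \<pi> x i \<in> {- int m..int m}" if i: "i \<in> {1..2*k}" for i
  proof -
    have "x (block_number \<pi> i) \<in> {- int m..int m}"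
      using x block_number_range[OF i] by (auto simp: words_def)
    then show ?thesis using i by (auto simp: pair_word_def int_sign_def)
  qed
  moreover have "pair_word k \<pi> x \<in> extensional {1..2*k}" by (auto simp: pair_word_def)
  ultimately show ?thesis by (auto simp: words_def PiE_iff)
qed

lemma abs_pair_word: "i \<in> {1..2*k} \<Longrightarrow> \<bar>pair_word k \<pi> x i\<bar> = \<bar>x (block_number \<pi> i)\<bar>"
  by (simp add: pair_word_def int_sign_def)

end

definition opposite_pairs :: "'i set \<Rightarrow> ('i \<Rightarrow> int) \<Rightarrow> bool" where
  "opposite_pairs I d \<longleftrightarrow> (\<forall>v\<in>abs_values I d. card {i\<in>I. \<bar>d i\<bar> = v} = 2) \<and>
     (\<forall>i\<in>I. \<forall>j\<in>I. i \<noteq> j \<longrightarrow> \<bar>d i\<bar> = \<bar>d j\<bar> \<longrightarrow> d j = - d i)"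

definition abs_inj_words :: "nat \<Rightarrow> nat \<Rightarrow> (nat \<Rightarrow> int) set" where
  "abs_inj_words k m = {x\<in>words k m. inj_on (\<lambda>c. \<bar>x c\<bar>) {1..k}}"

lemma sum_opposite_pairs:
  assumes "finite I" "opposite_pairs I d"
  shows "sum d I = 0"
proof -
  have "sum d I = (\<Sum>v\<in>abs_values I d. sum d {i\<in>I. \<bar>d i\<bar> = v})"
    by (rule sum.image_gen[OF assms(1)])
  also have "\<dots> = 0"
  proof (rule sum.neutral, rule ballI)
    fix v assume v: "v \<in> abs_values I d"
    then have "card {i\<in>I. \<bar>d i\<bar> = v} = 2" using assms by (auto simp: opposite_pairs_def)
    then obtain i j where ij: "{i\<in>I. \<bar>d i\<bar> = v} = {i, j}" "i \<noteq> j" by (auto simp: card_2_iff)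
    then have "i \<in> {i\<in>I. \<bar>d i\<bar> = v}" "j \<in> {i\<in>I. \<bar>d i\<bar> = v}" by auto
    then have "i \<in> I" "j \<in> I" "\<bar>d i\<bar> = \<bar>d j\<bar>" by auto
    then have "d j = - d i" using assms(2) ij(2) unfolding opposite_pairs_def by blast
    then show "sum d {i\<in>I. \<bar>d i\<bar> = v} = 0" using ij by simp
  qed
  finally show ?thesis .
qed

lemma fibre_pair_word:
  assumes \<pi>: "\<pi> \<in> pair_partitions (2 * k)" and x: "inj_on (\<lambda>c. \<bar>x c\<bar>) {1..k}" and i: "i \<in> {1..2*k}"
  shows "{j\<in>{1..2*k}. \<bar>pair_word k \<pi> x j\<bar> = \<bar>pair_word k \<pi> x i\<bar>} = block_of \<pi> i"
proof -
  have "\<bar>pair_word k \<pi> x j\<bar> = \<bar>pair_word k \<pi> x i\<bar> \<longleftrightarrow> j \<in> block_of \<pi> i" if j: "j \<in> {1..2*k}" for j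
  proof -
    have "\<bar>pair_word k \<pi> x j\<bar> = \<bar>pair_word k \<pi> x i\<bar> \<longleftrightarrow> block_number \<pi> j = block_number \<pi> i"
      using inj_on_eq_iff[OF x block_number_range[OF \<pi> j] block_number_range[OF \<pi> i]] i j
      by (simp add: abs_pair_word[OF \<pi>])
    also have "\<dots> \<longleftrightarrow> block_of \<pi> j = block_of \<pi> i" by (rule block_number_eq_iff[OF \<pi> j i])
    also have "\<dots> \<longleftrightarrow> j \<in> block_of \<pi> i"
      using block_of_mem[OF \<pi> j] block_of_mem[OF \<pi> i] block_of_eq[OF \<pi>] by metis
    finally show ?thesis .
  qed
  then show ?thesis using block_subset[OF \<pi> block_of_mem(1)[OF \<pi> i]] by blast
qed

lemma opposite_pairs_pair_word:
  assumes \<pi>: "\<pi> \<in> pair_partitions (2 * k)" and x: "inj_on (\<lambda>c. \<bar>x c\<bar>) {1..k}"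
  shows "opposite_pairs {1..2*k} (pair_word k \<pi> x)"
  unfolding opposite_pairs_def
proof (intro conjI ballI impI)
  fix v assume "v \<in> abs_values {1..2*k} (pair_word k \<pi> x)"
  then obtain i where i: "i \<in> {1..2*k}" "v = \<bar>pair_word k \<pi> x i\<bar>" by blast
  show "card {i\<in>{1..2*k}. \<bar>pair_word k \<pi> x i\<bar> = v} = 2"
    unfolding i(2) fibre_pair_word[OF \<pi> x i(1)] by (rule card_block[OF \<pi> block_of_mem(1)[OF \<pi> i(1)]])
next
  fix i j assume ij: "i \<in> {1..2*k}" "j \<in> {1..2*k}" "i \<noteq> j"
    "\<bar>pair_word k \<pi> x i\<bar> = \<bar>pair_word k \<pi> x j\<bar>"
  then have "j \<in> block_of \<pi> i" using fibre_pair_word[OF \<pi> x ij(1)] by auto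
  then have b: "block_of \<pi> i = block_of \<pi> j" using block_of_eq[OF \<pi> block_of_mem(1)[OF \<pi> ij(1)]] by simp
  then have "block_number \<pi> i = block_number \<pi> j" using block_number_eq_iff[OF \<pi> ij(1,2)] by simp
  then show "pair_word k \<pi> x j = - pair_word k \<pi> x i"
    using same_block_signs[OF \<pi> ij(1,2,3) b] ij by (simp add: pair_word_def)
qed

text \<open>A word made of opposite pairs is given by the partition of its positions into the level sets of
\<open>\<bar>d\<bar>\<close> and by the values at the smaller element of each block. The free values then have
different absolute values, which is needed for \<open>\<pi>\<close> to be recovered from the word.\<close>
lemma bij_betw_pair_word:
  "bij_betw (\<lambda>(\<pi>, x). pair_word k \<pi> x) (pair_partitions (2 * k) \<times> abs_inj_words k m)
     {d\<in>words (2 * k) m. opposite_pairs {1..2*k} d}"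
  unfolding bij_betw_def
proof (intro conjI)
  show "inj_on (\<lambda>(\<pi>, x). pair_word k \<pi> x) (pair_partitions (2 * k) \<times> abs_inj_words k m)"
  proof (rule inj_onI, clarify)
    fix \<pi> x \<rho> y
    assume \<pi>: "\<pi> \<in> pair_partitions (2 * k)" and x: "x \<in> abs_inj_words k m"
      and \<rho>: "\<rho> \<in> pair_partitions (2 * k)" and y: "y \<in> abs_inj_words k m"
      and eq: "pair_word k \<pi> x = pair_word k \<rho> y"
    have xi: "inj_on (\<lambda>c. \<bar>x c\<bar>) {1..k}" and yi: "inj_on (\<lambda>c. \<bar>y c\<bar>) {1..k}"
      using x y by (auto simp: abs_inj_words_def)
    have bl: "block_of \<pi> i = block_of \<rho> i" if "i \<in> {1..2*k}" for i
      using fibre_pair_word[OF \<pi> xi that] fibre_pair_word[OF \<rho> yi that] eq by simp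
    have img: "\<sigma> = block_of \<sigma> ` {1..2*k}" if \<sigma>: "\<sigma> \<in> pair_partitions (2 * k)" for \<sigma>
    proof (intro subset_antisym subsetI)
      fix V assume V: "V \<in> \<sigma>"
      then show "V \<in> block_of \<sigma> ` {1..2*k}"
        using block_of_eq[OF \<sigma> V Min_block_mem[OF \<sigma> V]] block_subset[OF \<sigma> V] Min_block_mem[OF \<sigma> V] by blast
    qed (use block_of_mem(1)[OF \<sigma>] in auto)
    have "\<pi> = \<rho>" using img[OF \<pi>] img[OF \<rho>] bl by (metis (no_types, lifting) image_cong)
    moreover have "x c = y c" for c
    proof (cases "c \<in> {1..k}")
      case True
      then have "c \<in> rank_of \<pi> ` \<pi>" using rank_of_bij[OF \<pi>] by (simp add: bij_betw_def)
      then obtain V where V: "V \<in> \<pi>" "rank_of \<pi> V = c" by blast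
      define i where "i = Min V"
      have i: "i \<in> V" "i \<in> {1..2*k}" "block_of \<pi> i = V"
        using Min_block_mem[OF \<pi> V(1)] block_subset[OF \<pi> V(1)] block_of_eq[OF \<pi> V(1)] by (auto simp: i_def)
      have "block_number \<pi> i = c" "int_sign \<pi> i = 1"
        using V i by (auto simp: block_number_eq[OF \<pi>] int_sign_def i_def)
      then show ?thesis using fun_cong[OF eq, of i] i \<open>\<pi> = \<rho>\<close> by (simp add: pair_word_def)
    next
      case False
      then show ?thesis using x y by (auto simp: abs_inj_words_def words_def PiE_iff extensional_def)
    qed
    ultimately show "\<pi> = \<rho> \<and> x = y" by auto
  qed
next
  show "(\<lambda>(\<pi>, x). pair_word k \<pi> x) ` (pair_partitions (2 * k) \<times> abs_inj_words k m)
      = {d\<in>words (2 * k) m. opposite_pairs {1..2*k} d}"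
  proof (intro subset_antisym subsetI)
    fix d assume "d \<in> (\<lambda>(\<pi>, x). pair_word k \<pi> x) ` (pair_partitions (2 * k) \<times> abs_inj_words k m)"
    then show "d \<in> {d\<in>words (2 * k) m. opposite_pairs {1..2*k} d}"
      using pair_word_mem opposite_pairs_pair_word by (auto simp: abs_inj_words_def)
  next
    fix d assume d: "d \<in> {d\<in>words (2 * k) m. opposite_pairs {1..2*k} d}"
    define fib where "fib i = {j\<in>{1..2*k}. \<bar>d j\<bar> = \<bar>d i\<bar>}" for i
    define \<pi> where "\<pi> = fib ` {1..2*k}"
    have "partition_on {1..2*k} \<pi>"
      unfolding partition_on_def \<pi>_def fib_def disjoint_def by auto
    moreover have "card V = 2" if "V \<in> \<pi>" for V
      using that d by (auto simp: \<pi>_def fib_def opposite_pairs_def)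
    ultimately have \<pi>: "\<pi> \<in> pair_partitions (2 * k)" by (auto simp: pair_partitions_def)
    have blk: "block_of \<pi> i = fib i" if "i \<in> {1..2*k}" for i
      using that by (intro block_of_eq[OF \<pi>]) (auto simp: \<pi>_def fib_def)
    define x where "x = (\<lambda>c\<in>{1..k}. d (Min (the_inv_into \<pi> (rank_of \<pi>) c)))"
    have inv: "the_inv_into \<pi> (rank_of \<pi>) c \<in> \<pi>" "rank_of \<pi> (the_inv_into \<pi> (rank_of \<pi>) c) = c" if "c \<in> {1..k}" for c
      using that rank_of_bij[OF \<pi>] the_inv_into_into[of "rank_of \<pi>" \<pi> c \<pi>] f_the_inv_into_f[of "rank_of \<pi>" \<pi> c]
      by (auto simp: bij_betw_def)
    have minI: "Min V \<in> {1..2*k}" if "V \<in> \<pi>" for V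
      using Min_block_mem[OF \<pi> that] block_subset[OF \<pi> that] by auto
    have xb: "x (block_number \<pi> i) = d (Min (fib i))" if i: "i \<in> {1..2*k}" for i
    proof -
      have "the_inv_into \<pi> (rank_of \<pi>) (rank_of \<pi> (fib i)) = fib i"
        using rank_of_bij[OF \<pi>] block_of_mem(1)[OF \<pi> i] blk[OF i] by (simp add: bij_betw_def the_inv_into_f_f)
      then show ?thesis using block_number_range[OF \<pi> i] blk[OF i] by (simp add: x_def block_number_eq[OF \<pi>])
    qed
    have dw: "d i \<in> {- int m..int m}" if "i \<in> {1..2*k}" for i using d that by (auto simp: words_def)
    have "x \<in> words k m"
      unfolding words_def using inv(1) minI dw by (auto simp: x_def PiE_iff)
    moreover have "inj_on (\<lambda>c. \<bar>x c\<bar>) {1..k}"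
    proof (rule inj_onI)
      fix c c' assume c: "c \<in> {1..k}" "c' \<in> {1..k}" "\<bar>x c\<bar> = \<bar>x c'\<bar>"
      let ?V = "the_inv_into \<pi> (rank_of \<pi>) c" and ?V' = "the_inv_into \<pi> (rank_of \<pi>) c'"
      have V: "?V \<in> \<pi>" "?V' \<in> \<pi>" using inv c by auto
      have "\<bar>d (Min ?V)\<bar> = \<bar>d (Min ?V')\<bar>" using c by (simp add: x_def)
      then have "fib (Min ?V) = fib (Min ?V')" by (simp add: fib_def)
      then have "block_of \<pi> (Min ?V) = block_of \<pi> (Min ?V')" using blk minI V by simp
      then have "?V = ?V'" using block_of_eq[OF \<pi>] V Min_block_mem[OF \<pi>] by metis
      then show "c = c'" using inv(2) c by metis
    qed
    ultimately have x: "x \<in> abs_inj_words k m" by (simp add: abs_inj_words_def)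
    have "pair_word k \<pi> x = d"
    proof
      fix i
      show "pair_word k \<pi> x i = d i"
      proof (cases "i \<in> {1..2*k}")
        case i: True
        have mf: "Min (fib i) \<in> fib i"
          using Min_block_mem[OF \<pi> block_of_mem(1)[OF \<pi> i]] blk[OF i] by simp
        show ?thesis
        proof (cases "i = Min (fib i)")
          case True
          then show ?thesis using xb[OF i] blk[OF i] i by (simp add: pair_word_def int_sign_def)
        next
          case False
          have "d i = - d (Min (fib i))"
          proof -
            have m: "Min (fib i) \<in> {1..2*k}" "\<bar>d (Min (fib i))\<bar> = \<bar>d i\<bar>" using mf by (auto simp only: fib_def)
            have "opposite_pairs {1..2*k} d" using d by blast
            then have "i \<noteq> Min (fib i) \<Longrightarrow> d i = - d (Min (fib i))"
              using m i unfolding opposite_pairs_def by metis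
            then show ?thesis using False .
          qed
          then show ?thesis using False xb[OF i] blk[OF i] i by (simp add: pair_word_def int_sign_def)
        qed
      next
        case False
        then show ?thesis using d by (auto simp: pair_word_def words_def PiE_iff extensional_def)
      qed
    qed
    then show "d \<in> (\<lambda>(\<pi>, x). pair_word k \<pi> x) ` (pair_partitions (2 * k) \<times> abs_inj_words k m)"
      using \<pi> x by (intro image_eqI[of _ _ "(\<pi>, x)"]) auto
  qed
qed

lemma words_mono: "m \<le> N \<Longrightarrow> words r m \<subseteq> words r N"
  unfolding words_def by (intro PiE_mono) auto

lemma card_not_abs_inj_words:
  assumes "m \<le> N"
  shows "card (words k m - abs_inj_words k m) * (2 * N + 1) \<le> 4 ^ k\<^sup>2 * (2 * N + 1) ^ k"
proof -
  have "card (words k m - abs_inj_words k m) * (2 * N + 1) ^ 1 \<le> 4 ^ (card {1..k})\<^sup>2 * (2 * N + 1) ^ k"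
  proof (rule card_constrained_words_le[where \<W> = "{}"])
    show "words k m - abs_inj_words k m \<subseteq> PiE {1..k} (\<lambda>_. {- int N..int N})"
      using words_mono[OF assms, of k] by (auto simp: words_def)
    fix d assume d: "d \<in> words k m - abs_inj_words k m"
    then have "\<not> inj_on (\<lambda>c. \<bar>d c\<bar>) {1..k}" by (simp add: abs_inj_words_def)
    then have "card (abs_values {1..k} d) \<noteq> card {1..k}" by (metis eq_card_imp_inj_on finite_atLeastAtMost)
    moreover have "card (abs_values {1..k} d) \<le> card {1..k}" by (intro card_image_le) auto
    ultimately have "card (abs_values {1..k} d) + 1 \<le> k" by simp
    then show "\<exists>V\<subseteq>abs_values {1..k} d. card V + 1 \<le> k \<and> values_determine {1..k} {} d V"
      using values_determine_all by blast
  qed auto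
  then show ?thesis by simp
qed

definition repeated :: "'i set \<Rightarrow> ('i \<Rightarrow> int) \<Rightarrow> bool" where
  "repeated I d \<longleftrightarrow> (\<forall>i\<in>I. \<exists>j\<in>I. j \<noteq> i \<and> \<bar>d j\<bar> = \<bar>d i\<bar>)"

lemma card_repeated_not_opposite:
  assumes "m \<le> N"
  shows "card {d\<in>words (2 * k) m. (\<Sum>l=1..2*k. d l) = 0 \<and> repeated {1..2*k} d \<and> \<not> opposite_pairs {1..2*k} d} * (2 * N + 1)
    \<le> 4 ^ (2 * k)\<^sup>2 * (2 * N + 1) ^ k" (is "card ?S * _ \<le> _")
proof -
  have "card ?S * (2 * N + 1) ^ 1 \<le> 4 ^ (card {1..2*k})\<^sup>2 * (2 * N + 1) ^ k"
  proof (rule card_constrained_words_le[where \<W> = "{{1..2*k}}"])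
    show "?S \<subseteq> PiE {1..2*k} (\<lambda>_. {- int N..int N})"
      using words_mono[OF assms, of "2*k"] by (auto simp: words_def)
    fix d assume d: "d \<in> ?S"
    show "\<exists>V\<subseteq>abs_values {1..2*k} d. card V + 1 \<le> k \<and> values_determine {1..2*k} {{1..2*k}} d V"
      by (rule values_determine_if_not_pairing) (use d in \<open>auto simp: repeated_def opposite_pairs_def\<close>)
  qed auto
  then show ?thesis by simp
qed

lemma card_repeated_odd:
  assumes "m \<le> N"
  shows "card {d\<in>words (2 * k + 1) m. repeated {1..2*k+1} d} \<le> 4 ^ (2 * k + 1)\<^sup>2 * (2 * N + 1) ^ k" (is "card ?S \<le> _")
proof -
  have "card ?S * (2 * N + 1) ^ 0 \<le> 4 ^ (card {1..2*k+1})\<^sup>2 * (2 * N + 1) ^ k"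
  proof (rule card_constrained_words_le[where \<W> = "{}"])
    show "?S \<subseteq> PiE {1..2*k+1} (\<lambda>_. {- int N..int N})"
      using words_mono[OF assms, of "2*k+1"] by (auto simp: words_def)
    fix d assume d: "d \<in> ?S"
    have "2 * card (abs_values {1..2*k+1} d) \<le> card {1..2*k+1}"
      using d by (intro card_values_repeated(1)) (auto simp: repeated_def)
    then have "card (abs_values {1..2*k+1} d) + 0 \<le> k" by simp
    then show "\<exists>V\<subseteq>abs_values {1..2*k+1} d. card V + 0 \<le> k \<and> values_determine {1..2*k+1} {} d V"
      using values_determine_all by blast
  qed auto
  then show ?thesis by simp
qed

section \<open>Fourth moments of centred traces\<close>

lemma norm_diff_power_le:
  fixes x c :: "'a::real_normed_vector"
  shows "norm (x - c) ^ n \<le> 2 ^ n * (norm x ^ n + norm c ^ n)"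
proof -
  have "norm (x - c) ^ n \<le> (2 * max (norm x) (norm c)) ^ n"
    using norm_triangle_ineq4[of x c] by (intro power_mono) auto
  also have "\<dots> = 2 ^ n * max (norm x) (norm c) ^ n" by (simp add: power_mult_distrib)
  also have "\<dots> \<le> 2 ^ n * (norm x ^ n + norm c ^ n)"
    by (intro mult_left_mono) (auto simp: max_def)
  finally show ?thesis .
qed

context independent_toeplitz_entries
begin

text \<open>Random variables with all absolute moments form an algebra, so every product below is integrable.\<close>
definition all_moments :: "('w \<Rightarrow> complex) \<Rightarrow> bool" where
  "all_moments X \<longleftrightarrow> X \<in> borel_measurable M \<and> (\<forall>n. integrable M (\<lambda>\<omega>. cmod (X \<omega>) ^ n))"

lemma all_moments_integrable:
  assumes "all_moments X" shows "integrable M X"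
proof -
  have "X \<in> borel_measurable M" "integrable M (\<lambda>\<omega>. cmod (X \<omega>) ^ 1)"
    using assms unfolding all_moments_def by blast+
  then show ?thesis by (simp add: integrable_norm_iff)
qed

lemma all_moments_entry: "all_moments (a j)"
  by (simp add: all_moments_def entry_moment_integrable)

lemma all_moments_const: "all_moments (\<lambda>_. c)"
  by (simp add: all_moments_def)

lemma all_moments_mult:
  assumes "all_moments X" "all_moments Y"
  shows "all_moments (\<lambda>\<omega>. X \<omega> * Y \<omega>)"
  unfolding all_moments_def
proof (intro conjI allI)
  show "(\<lambda>\<omega>. X \<omega> * Y \<omega>) \<in> borel_measurable M" using assms by (auto simp: all_moments_def)
  fix n
  have le: "cmod (X \<omega> * Y \<omega>) ^ n \<le> cmod (X \<omega>) ^ (2 * n) + cmod (Y \<omega>) ^ (2 * n)" for \<omega>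
  proof -
    have "2 * (cmod (X \<omega>) ^ n * cmod (Y \<omega>) ^ n) \<le> (cmod (X \<omega>) ^ n)\<^sup>2 + (cmod (Y \<omega>) ^ n)\<^sup>2"
      using sum_squares_bound[of "cmod (X \<omega>) ^ n" "cmod (Y \<omega>) ^ n"] by (simp add: mult.assoc)
    moreover have "0 \<le> cmod (X \<omega>) ^ n * cmod (Y \<omega>) ^ n" by simp
    moreover have "cmod (X \<omega> * Y \<omega>) ^ n = cmod (X \<omega>) ^ n * cmod (Y \<omega>) ^ n"
      by (simp add: norm_mult power_mult_distrib)
    moreover have "(cmod (X \<omega>) ^ n)\<^sup>2 = cmod (X \<omega>) ^ (2 * n)" "(cmod (Y \<omega>) ^ n)\<^sup>2 = cmod (Y \<omega>) ^ (2 * n)"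
      by (simp_all add: power_mult[symmetric] mult.commute)
    ultimately show ?thesis by linarith
  qed
  show "integrable M (\<lambda>\<omega>. cmod (X \<omega> * Y \<omega>) ^ n)"
  proof (rule Bochner_Integration.integrable_bound)
    show "integrable M (\<lambda>\<omega>. cmod (X \<omega>) ^ (2 * n) + cmod (Y \<omega>) ^ (2 * n))"
      using assms by (auto simp: all_moments_def)
    show "(\<lambda>\<omega>. cmod (X \<omega> * Y \<omega>) ^ n) \<in> borel_measurable M" using assms by (auto simp: all_moments_def)
  qed (use le in \<open>auto intro!: AE_I2\<close>)
qed

lemma all_moments_diff_const:
  assumes "all_moments X"
  shows "all_moments (\<lambda>\<omega>. X \<omega> - c)"
  unfolding all_moments_def
proof (intro conjI allI)
  show "(\<lambda>\<omega>. X \<omega> - c) \<in> borel_measurable M" using assms by (auto simp: all_moments_def)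
  fix n
  show "integrable M (\<lambda>\<omega>. cmod (X \<omega> - c) ^ n)"
  proof (rule Bochner_Integration.integrable_bound)
    show "integrable M (\<lambda>\<omega>. 2 ^ n * (cmod (X \<omega>) ^ n + cmod c ^ n))"
      using assms by (auto simp: all_moments_def)
    show "(\<lambda>\<omega>. cmod (X \<omega> - c) ^ n) \<in> borel_measurable M" using assms by (auto simp: all_moments_def)
  qed (use norm_diff_power_le in \<open>auto intro!: AE_I2 order_trans[OF norm_diff_power_le]\<close>)
qed

lemma all_moments_prod:
  "(\<And>i. i \<in> I \<Longrightarrow> all_moments (X i)) \<Longrightarrow> all_moments (\<lambda>\<omega>. \<Prod>i\<in>I. X i \<omega>)"
  by (induction I rule: infinite_finite_induct) (auto intro: all_moments_const all_moments_mult)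

lemma all_moments_entry_product: "all_moments (entry_product I d)"
  unfolding entry_product_def[abs_def] by (intro all_moments_prod all_moments_entry)

definition centred_product :: "'i set \<Rightarrow> ('i \<Rightarrow> int) \<Rightarrow> 'w \<Rightarrow> complex" where
  "centred_product I d \<omega> = entry_product I d \<omega> - expectation (entry_product I d)"

lemma all_moments_centred: "all_moments (centred_product I d)"
  unfolding centred_product_def[abs_def] by (intro all_moments_diff_const all_moments_entry_product)

lemma depends_on_centred: "(\<And>i. i \<in> I \<Longrightarrow> nat \<bar>d i\<bar> \<in> D) \<Longrightarrow> depends_on D (centred_product I d)"
  unfolding centred_product_def[abs_def]
  by (intro depends_on_diff depends_on_entry_product depends_on_const)

lemma expectation_centred:
  assumes "finite I" shows "expectation (centred_product I d) = 0"
  unfolding centred_product_def[abs_def] using integrable_entry_product[OF assms, of d]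
  by (simp add: prob_space)

context
  fixes r :: nat and T :: "nat set" and g :: "nat \<Rightarrow> nat \<Rightarrow> int"
  assumes T: "finite T"
begin

text \<open>The word \<open>t\<close> shares no value with the others, so its centred product is an independent factor.\<close>
lemma expectation_centred_products_unlinked:
  assumes t: "t \<in> T"
    and unl: "\<And>l t' l'. l \<in> {1..r} \<Longrightarrow> t' \<in> T \<Longrightarrow> t' \<noteq> t \<Longrightarrow> l' \<in> {1..r} \<Longrightarrow> \<bar>g t l\<bar> \<noteq> \<bar>g t' l'\<bar>"
  shows "expectation (\<lambda>\<omega>. \<Prod>t\<in>T. centred_product {1..r} (g t) \<omega>) = 0"
proof -
  let ?R = "\<lambda>\<omega>. \<Prod>t'\<in>T - {t}. centred_product {1..r} (g t') \<omega>"
  let ?D1 = "(\<lambda>l. nat \<bar>g t l\<bar>) ` {1..r}" and ?D2 = "\<Union>t'\<in>T - {t}. (\<lambda>l. nat \<bar>g t' l\<bar>) ` {1..r}"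
  have "expectation (\<lambda>\<omega>. centred_product {1..r} (g t) \<omega> * ?R \<omega>)
      = expectation (centred_product {1..r} (g t)) * expectation ?R"
  proof (rule expectation_mult_disjoint[of ?D1 ?D2])
    have "nat \<bar>g t l\<bar> \<noteq> nat \<bar>g t' l'\<bar>" if "l \<in> {1..r}" "t' \<in> T - {t}" "l' \<in> {1..r}" for l t' l'
      using unl[of l t' l'] that by auto
    then show "?D1 \<inter> ?D2 = {}" by blast
    show "depends_on ?D1 (centred_product {1..r} (g t))" by (intro depends_on_centred) auto
    show "depends_on ?D2 ?R" by (intro depends_on_prod depends_on_centred) blast
    show "integrable M (centred_product {1..r} (g t))" "integrable M ?R"
      by (intro all_moments_integrable all_moments_prod all_moments_centred)+
  qed
  then show ?thesis using T t by (simp add: prod.remove expectation_centred)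
qed

text \<open>The word that contains the single value has mean 0, so centring it changes nothing, and the entry at that value
is an independent factor.\<close>
lemma expectation_centred_products_single:
  assumes t: "t \<in> T" and l: "l \<in> {1..r}"
    and single: "\<And>t' l'. t' \<in> T \<Longrightarrow> l' \<in> {1..r} \<Longrightarrow> (t', l') \<noteq> (t, l) \<Longrightarrow> \<bar>g t' l'\<bar> \<noteq> \<bar>g t l\<bar>"
  shows "expectation (\<lambda>\<omega>. \<Prod>t\<in>T. centred_product {1..r} (g t) \<omega>) = 0"
proof -
  let ?R = "\<lambda>\<omega>. entry_product ({1..r} - {l}) (g t) \<omega> * (\<Prod>t'\<in>T - {t}. centred_product {1..r} (g t') \<omega>)"
  let ?v = "nat \<bar>g t l\<bar>"
  have "expectation (entry_product {1..r} (g t)) = 0"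
    by (rule expectation_entry_product_single[OF _ l]) (use single[OF t] in auto)
  then have c: "centred_product {1..r} (g t) \<omega> = a (g t l) \<omega> * entry_product ({1..r} - {l}) (g t) \<omega>" for \<omega>
    using l by (simp add: centred_product_def entry_product_def prod.remove)
  have "expectation (\<lambda>\<omega>. a (g t l) \<omega> * ?R \<omega>) = expectation (a (g t l)) * expectation ?R"
  proof (rule expectation_mult_disjoint[of "{?v}" "- {?v}"])
    have ne: "nat \<bar>g t' l'\<bar> \<noteq> ?v" if "t' \<in> T" "l' \<in> {1..r}" "(t', l') \<noteq> (t, l)" for t' l'
      using single[OF that] by auto
    show "depends_on {?v} (a (g t l))" by (rule depends_on_entry) simp
    show "depends_on (- {?v}) ?R"
      using ne t by (intro depends_on_mult depends_on_prod depends_on_centred depends_on_entry_product) auto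
    show "integrable M (a (g t l))" "integrable M ?R"
      by (intro all_moments_integrable all_moments_prod all_moments_centred all_moments_mult
          all_moments_entry_product all_moments_entry)+
  qed simp
  moreover have "(\<Prod>t\<in>T. centred_product {1..r} (g t) \<omega>) = a (g t l) \<omega> * ?R \<omega>" for \<omega>
    unfolding prod.remove[OF T t] c by (simp add: mult.assoc)
  ultimately show ?thesis by (simp add: entry_mean)
qed

end

definition centred_bound :: "nat \<Rightarrow> real" where
  "centred_bound r = 4 * (16 * ((1 + r * moment_bound (4 * r)) + (1 + r * moment_bound r) ^ 4))"

lemma norm_expectation_centred_products_le:
  fixes g :: "nat \<Rightarrow> nat \<Rightarrow> int"
  shows "norm (expectation (\<lambda>\<omega>. \<Prod>t<4. centred_product {1..r} (g t) \<omega>)) \<le> centred_bound r"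
proof -
  let ?c = "\<lambda>t::nat. centred_product {1..r} (g t)" and ?P = "\<lambda>t. entry_product {1..r} (g t)"
  have int4: "integrable M (\<lambda>\<omega>. cmod (?c t \<omega>) ^ 4)" for t
    using all_moments_centred unfolding all_moments_def by blast
  have "norm (expectation (\<lambda>\<omega>. \<Prod>t<4. ?c t \<omega>)) \<le> expectation (\<lambda>\<omega>. norm (\<Prod>t<4. ?c t \<omega>))"
    by (rule integral_norm_bound)
  also have "\<dots> \<le> expectation (\<lambda>\<omega>. \<Sum>t<4. cmod (?c t \<omega>) ^ 4)"
  proof (intro integral_mono)
    show "integrable M (\<lambda>\<omega>. norm (\<Prod>t<4. ?c t \<omega>))"
      by (intro integrable_norm all_moments_integrable all_moments_prod all_moments_centred)
    show "integrable M (\<lambda>\<omega>. \<Sum>t<4. cmod (?c t \<omega>) ^ 4)" using int4 by simp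
    show "norm (\<Prod>t<4. ?c t \<omega>) \<le> (\<Sum>t<4. cmod (?c t \<omega>) ^ 4)" for \<omega>
    proof -
      have "0 \<in> {..<4::nat}" by simp
      then have "{..<4::nat} \<noteq> {}" by blast
      then show ?thesis
        using prod_le_sum_power[of "{..<4::nat}" "\<lambda>t. cmod (?c t \<omega>)"] by (simp add: prod_norm[symmetric])
    qed
  qed
  also have "\<dots> = (\<Sum>t<4. expectation (\<lambda>\<omega>. cmod (?c t \<omega>) ^ 4))" using int4 by simp
  also have "\<dots> \<le> (\<Sum>t<4::nat. 16 * ((1 + r * moment_bound (4 * r)) + (1 + r * moment_bound r) ^ 4))"
  proof (intro sum_mono)
    fix t
    have intP: "integrable M (\<lambda>\<omega>. cmod (?P t \<omega>) ^ 4)" by (rule integrable_entry_product_power) simp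
    have "expectation (\<lambda>\<omega>. cmod (?c t \<omega>) ^ 4)
        \<le> expectation (\<lambda>\<omega>. 2 ^ 4 * (cmod (?P t \<omega>) ^ 4 + cmod (expectation (?P t)) ^ 4))"
      using norm_diff_power_le[of _ _ 4] intP
      by (intro integral_mono int4) (auto simp: centred_product_def)
    also have "\<dots> = 16 * (expectation (\<lambda>\<omega>. cmod (?P t \<omega>) ^ 4) + cmod (expectation (?P t)) ^ 4)"
      using intP by (simp add: prob_space)
    also have "\<dots> \<le> 16 * ((1 + r * moment_bound (4 * r)) + (1 + r * moment_bound r) ^ 4)"
      using expectation_entry_product_power_le[of "{1..r}" "g t" 4]
        norm_expectation_entry_product_le[of "{1..r}" "g t"]
      by (intro mult_left_mono add_mono power_mono) auto
    finally show "expectation (\<lambda>\<omega>. cmod (?c t \<omega>) ^ 4)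
        \<le> 16 * ((1 + r * moment_bound (4 * r)) + (1 + r * moment_bound r) ^ 4)" .
  qed
  also have "\<dots> = centred_bound r" by (simp add: centred_bound_def)
  finally show ?thesis .
qed

lemma centred_bound_nonneg: "0 \<le> centred_bound r"
  using norm_ge_zero norm_expectation_centred_products_le by (rule order_trans)

end

text \<open>If one of the two conditions fails, the product of the four centred words has expectation 0.\<close>
definition linked_words :: "nat \<Rightarrow> (nat \<Rightarrow> nat \<Rightarrow> int) \<Rightarrow> bool" where
  "linked_words r g \<longleftrightarrow>
     (\<forall>t<4. \<forall>l\<in>{1..r}. \<exists>t'<4. \<exists>l'\<in>{1..r}. (t', l') \<noteq> (t, l) \<and> \<bar>g t' l'\<bar> = \<bar>g t l\<bar>) \<and>
     (\<forall>t<4. \<exists>l\<in>{1..r}. \<exists>t'<4. t' \<noteq> t \<and> (\<exists>l'\<in>{1..r}. \<bar>g t l\<bar> = \<bar>g t' l'\<bar>))"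

lemma card_linked_closed_words:
  assumes "m \<le> N"
  shows "card {g\<in>PiE {..<4} (\<lambda>_. closed_words r m). linked_words r g} * (2 * N + 1)\<^sup>2
    \<le> 4 ^ (4 * r)\<^sup>2 * (2 * N + 1) ^ (2 * r)" (is "card ?G * _ \<le> _")
proof -
  define I where "I = {..<4::nat} \<times> {1..r}"
  define u where "u g = restrict (\<lambda>(t, l). g t l) I" for g :: "nat \<Rightarrow> nat \<Rightarrow> int"
  have inj: "inj_on u ?G"
  proof (rule inj_onI)
    fix g h assume g: "g \<in> ?G" and h: "h \<in> ?G" and eq: "u g = u h"
    have "g t = h t" if t: "t < 4" for t
    proof -
      have "g t \<in> PiE {1..r} (\<lambda>_. {- int m..int m})" "h t \<in> PiE {1..r} (\<lambda>_. {- int m..int m})"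
        using g h t by (auto simp: closed_words_def words_def PiE_def Pi_def)
      moreover have "g t l = h t l" if "l \<in> {1..r}" for l
        using fun_cong[OF eq, of "(t, l)"] t that by (simp add: u_def I_def)
      ultimately show ?thesis by (intro PiE_ext)
    qed
    then show "g = h" using g h by (intro PiE_ext[where k = "{..<4}" and s = "\<lambda>_. closed_words r m"]) auto
  qed
  have "card (u ` ?G) * (2 * N + 1) ^ 2 \<le> 4 ^ (card I)\<^sup>2 * (2 * N + 1) ^ (2 * r)"
  proof (rule card_constrained_words_le[where \<W> = "(\<lambda>t. {t} \<times> {1..r}) ` {..<4}"])
    show "finite I" by (simp add: I_def)
    have "u g \<in> PiE I (\<lambda>_. {- int N..int N})" if "g \<in> ?G" for g
    proof -
      have "g t l \<in> {- int N..int N}" if "t < 4" "l \<in> {1..r}" for t l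
      proof -
        have "g t \<in> words r m" using \<open>g \<in> ?G\<close> that by (auto simp: closed_words_def PiE_def Pi_def)
        then have "g t l \<in> {- int m..int m}" using that unfolding words_def by blast
        then show ?thesis using assms by auto
      qed
      then show ?thesis by (auto simp: u_def I_def)
    qed
    then show "u ` ?G \<subseteq> PiE I (\<lambda>_. {- int N..int N})" by blast
  next
    fix d w assume "d \<in> u ` ?G" "w \<in> (\<lambda>t. {t} \<times> {1..r}) ` {..<4::nat}"
    then obtain g t where g: "g \<in> ?G" "d = u g" "t < 4" "w = {t} \<times> {1..r}" by blast
    have "sum d w = (\<Sum>l\<in>{1..r}. d (t, l))"
    proof -
      have "w = Pair t ` {1..r}" using g(4) by auto
      then show ?thesis by (simp add: sum.reindex inj_on_def)
    qed
    also have "\<dots> = (\<Sum>l\<in>{1..r}. g t l)" using g by (intro sum.cong) (auto simp: u_def I_def)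
    also have "\<dots> = 0" using g by (auto simp: closed_words_def PiE_def Pi_def)
    finally show "sum d w = 0" .
  next
    fix d assume "d \<in> u ` ?G"
    then obtain g where g: "g \<in> ?G" "d = u g" by blast
    have ug: "d (t, l) = g t l" if "t < 4" "l \<in> {1..r}" for t l using that g by (simp add: u_def I_def)
    have lw: "linked_words r g" using g by simp
    show "\<exists>V\<subseteq>abs_values I d. card V + 2 \<le> 2 * r \<and> values_determine I ((\<lambda>t. {t} \<times> {1..r}) ` {..<4}) d V"
      unfolding I_def
    proof (rule four_linked_words_determine)
      fix i assume "i \<in> {..<4::nat} \<times> {1..r}"
      then obtain t l where i: "i = (t, l)" "t < 4" "l \<in> {1..r}" by blast
      then obtain t' l' where "t' < 4" "l' \<in> {1..r}" "(t', l') \<noteq> (t, l)" "\<bar>g t' l'\<bar> = \<bar>g t l\<bar>"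
        using lw unfolding linked_words_def by blast
      then show "\<exists>j\<in>{..<4} \<times> {1..r}. j \<noteq> i \<and> \<bar>d j\<bar> = \<bar>d i\<bar>"
        using i ug by (intro bexI[of _ "(t', l')"]) auto
    next
      fix t :: nat assume t: "t < 4"
      then obtain l t' l' where "l \<in> {1..r}" "t' < 4" "t' \<noteq> t" "l' \<in> {1..r}" "\<bar>g t l\<bar> = \<bar>g t' l'\<bar>"
        using lw unfolding linked_words_def by blast
      then show "\<exists>i\<in>{..<4} \<times> {1..r}. \<exists>j\<in>{..<4} \<times> {1..r}. fst i = t \<and> fst j \<noteq> t \<and> \<bar>d i\<bar> = \<bar>d j\<bar>"
        using t ug by (intro bexI[of _ "(t, l)"] bexI[of _ "(t', l')"]) auto
    qed
  qed
  then show ?thesis using card_image[OF inj] by (simp add: I_def)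
qed

context independent_toeplitz_entries
begin

definition trace_fluctuation :: "nat \<Rightarrow> nat \<Rightarrow> nat \<Rightarrow> 'w \<Rightarrow> complex" where
  "trace_fluctuation N m r \<omega> =
     (\<Sum>d\<in>closed_words r m. of_nat (start_count N r d) * centred_product {1..r} d \<omega>)"

lemma trace_fluctuation_power4:
  "trace_fluctuation N m r \<omega> ^ 4 = (\<Sum>g\<in>PiE {..<4::nat} (\<lambda>_. closed_words r m).
    of_real (\<Prod>t<4::nat. real (start_count N r (g t))) * (\<Prod>t<4::nat. centred_product {1..r} (g t) \<omega>))"
proof -
  have "trace_fluctuation N m r \<omega> ^ 4
      = (\<Prod>t<4::nat. \<Sum>d\<in>closed_words r m. of_nat (start_count N r d) * centred_product {1..r} d \<omega>)"
    by (simp add: trace_fluctuation_def)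
  also have "\<dots> = (\<Sum>g\<in>PiE {..<4::nat} (\<lambda>_. closed_words r m).
      \<Prod>t<4. of_nat (start_count N r (g t)) * centred_product {1..r} (g t) \<omega>)"
    by (intro prod_sum_PiE) auto
  finally show ?thesis by (simp add: prod.distrib)
qed

lemma integrable_trace_fluctuation_power4: "integrable M (\<lambda>\<omega>. trace_fluctuation N m r \<omega> ^ 4)"
  unfolding trace_fluctuation_power4
  by (intro Bochner_Integration.integrable_sum integrable_mult_right all_moments_integrable
      all_moments_prod all_moments_centred)

text \<open>After division by \<open>N ^ (4 + 2 * r)\<close>, the right-hand side is bounded, and the factor \<open>(2 * N +
1)\<^sup>2\<close> on the left makes the fourth moments summable.\<close>
lemma trace_fluctuation_fourth_moment:
  assumes mN: "m \<le> N"
  shows "norm (expectation (\<lambda>\<omega>. trace_fluctuation N m r \<omega> ^ 4)) * (2 * real N + 1)\<^sup>2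
    \<le> centred_bound r * 4 ^ (4 * r)\<^sup>2 * real N ^ 4 * (2 * real N + 1) ^ (2 * r)"
proof -
  let ?P = "PiE {..<4::nat} (\<lambda>_. closed_words r m)"
  let ?W = "\<lambda>g. \<Prod>t<4::nat. real (start_count N r (g t))"
  let ?c = "\<lambda>g \<omega>. \<Prod>t<4::nat. centred_product {1..r} (g t) \<omega>"
  let ?G = "{g\<in>?P. linked_words r g}"
  have finP: "finite ?P" by (intro finite_PiE) auto
  have int: "integrable M (?c g)" for g
    by (intro all_moments_integrable all_moments_prod all_moments_centred)
  have zero: "expectation (?c g) = 0" if nl: "\<not> linked_words r g" for g
  proof -
    consider t l where "t < 4" "l \<in> {1..r}"
        "\<forall>t'<4. \<forall>l'\<in>{1..r}. (t', l') \<noteq> (t, l) \<longrightarrow> \<bar>g t' l'\<bar> \<noteq> \<bar>g t l\<bar>"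
      | t where "t < 4" "\<forall>l\<in>{1..r}. \<forall>t'<4. t' \<noteq> t \<longrightarrow> (\<forall>l'\<in>{1..r}. \<bar>g t l\<bar> \<noteq> \<bar>g t' l'\<bar>)"
      using nl unfolding linked_words_def by blast
    then show ?thesis
    proof cases
      case 1
      then show ?thesis by (intro expectation_centred_products_single[of _ t l]) auto
    next
      case 2
      then show ?thesis by (intro expectation_centred_products_unlinked[of _ t]) auto
    qed
  qed
  have W: "\<bar>?W g\<bar> \<le> real N ^ 4" for g
  proof -
    have "?W g \<le> (\<Prod>t<4::nat. real N)" using start_count_le by (intro prod_mono) auto
    then show ?thesis by (simp add: prod_nonneg)
  qed
  have "expectation (\<lambda>\<omega>. trace_fluctuation N m r \<omega> ^ 4) = (\<Sum>g\<in>?P. of_real (?W g) * expectation (?c g))"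
    unfolding trace_fluctuation_power4 using int by (subst Bochner_Integration.integral_sum) auto
  also have "\<dots> = (\<Sum>g\<in>?G. of_real (?W g) * expectation (?c g))"
    using zero finP by (intro sum.mono_neutral_right) auto
  finally have "norm (expectation (\<lambda>\<omega>. trace_fluctuation N m r \<omega> ^ 4))
      \<le> (\<Sum>g\<in>?G. norm (of_real (?W g) * expectation (?c g)))"
    by (simp add: norm_sum)
  also have "\<dots> \<le> (\<Sum>g\<in>?G. real N ^ 4 * centred_bound r)"
    unfolding norm_mult norm_of_real
    by (intro sum_mono mult_mono W norm_expectation_centred_products_le) auto
  also have "\<dots> = real (card ?G) * (real N ^ 4 * centred_bound r)" by simp
  finally have "norm (expectation (\<lambda>\<omega>. trace_fluctuation N m r \<omega> ^ 4)) * (2 * real N + 1)\<^sup>2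
      \<le> real (card ?G) * (real N ^ 4 * centred_bound r) * (2 * real N + 1)\<^sup>2"
    by (rule mult_right_mono) simp
  also have "\<dots> = real (card ?G * (2 * N + 1)\<^sup>2) * (real N ^ 4 * centred_bound r)" by simp
  also have "\<dots> \<le> real (4 ^ (4 * r)\<^sup>2 * (2 * N + 1) ^ (2 * r)) * (real N ^ 4 * centred_bound r)"
    using card_linked_closed_words[OF mN, of r] centred_bound_nonneg[of r]
    by (intro mult_right_mono of_nat_mono) auto
  finally show ?thesis by (simp add: mult_ac add_ac)
qed

section \<open>Mean traces\<close>

definition trace_sum :: "nat \<Rightarrow> nat \<Rightarrow> nat \<Rightarrow> 'w \<Rightarrow> complex" where
  "trace_sum N m r \<omega> =
     (\<Sum>d\<in>closed_words r m. of_nat (start_count N r d) * entry_product {1..r} d \<omega>)"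

lemma trace_sum_eq: "mat_trace (band_toeplitz N m (\<lambda>j. a j \<omega>) ^\<^sub>m r) = trace_sum N m r \<omega>"
  unfolding trace_band_toeplitz_pow trace_sum_def entry_product_def ..

lemma integrable_trace_sum: "integrable M (trace_sum N m r)"
  unfolding trace_sum_def[abs_def]
  by (intro Bochner_Integration.integrable_sum integrable_mult_right integrable_entry_product) auto

lemma expectation_trace_sum:
  "expectation (trace_sum N m r) = (\<Sum>d\<in>closed_words r m. of_nat (start_count N r d) * expectation (entry_product {1..r} d))"
  unfolding trace_sum_def[abs_def]
  by (subst Bochner_Integration.integral_sum) (auto intro!: integrable_mult_right integrable_entry_product)

lemma trace_fluctuation_eq:
  "trace_fluctuation N m r \<omega> = trace_sum N m r \<omega> - expectation (trace_sum N m r)"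
  unfolding expectation_trace_sum trace_sum_def trace_fluctuation_def centred_product_def
  by (simp add: sum_subtractf right_diff_distrib)

lemma expectation_entry_product_not_repeated:
  assumes "finite I" "\<not> repeated I d"
  shows "expectation (entry_product I d) = 0"
proof -
  obtain i where "i \<in> I" "\<forall>j\<in>I. j \<noteq> i \<longrightarrow> \<bar>d j\<bar> \<noteq> \<bar>d i\<bar>"
    using assms(2) unfolding repeated_def by blast
  then show ?thesis using assms(1) by (intro expectation_entry_product_single[of I i]) auto
qed

definition product_bound :: "nat \<Rightarrow> real" where
  "product_bound r = 1 + r * moment_bound r"

lemma product_bound_le: "norm (expectation (entry_product {1..r} d)) \<le> product_bound r"
  using norm_expectation_entry_product_le[of "{1..r}" d] by (simp add: product_bound_def)

lemma product_bound_nonneg: "0 \<le> product_bound r"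
  using norm_ge_zero product_bound_le by (rule order_trans)

lemma norm_weighted_sum_le:
  assumes "finite S"
  shows "norm (\<Sum>d\<in>S. of_nat (start_count N r d) * expectation (entry_product {1..r} d))
    \<le> card S * (N * product_bound r)"
proof -
  have "norm (\<Sum>d\<in>S. of_nat (start_count N r d) * expectation (entry_product {1..r} d))
      \<le> (\<Sum>d\<in>S. norm (of_nat (start_count N r d) * expectation (entry_product {1..r} d)))"
    by (rule norm_sum)
  also have "\<dots> \<le> (\<Sum>d\<in>S. N * product_bound r)"
    unfolding norm_mult norm_of_nat
    by (intro sum_mono mult_mono product_bound_le) (auto simp: start_count_le)
  finally show ?thesis by simp
qed

lemma expectation_trace_sum_odd:
  assumes "m \<le> N"
  shows "norm (expectation (trace_sum N m (2 * k + 1)))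
    \<le> 4 ^ (2 * k + 1)\<^sup>2 * product_bound (2 * k + 1) * N * (2 * N + 1) ^ k"
proof -
  let ?r = "2 * k + 1"
  let ?S = "{d\<in>closed_words ?r m. repeated {1..?r} d}"
  have "expectation (trace_sum N m ?r) = (\<Sum>d\<in>?S. of_nat (start_count N ?r d) * expectation (entry_product {1..?r} d))"
    unfolding expectation_trace_sum
    by (rule sum.mono_neutral_right) (auto simp: expectation_entry_product_not_repeated)
  then have "norm (expectation (trace_sum N m ?r)) \<le> card ?S * (N * product_bound ?r)"
    using norm_weighted_sum_le[of ?S N ?r] by simp
  also have "real (card ?S) \<le> real (4 ^ ?r\<^sup>2 * (2 * N + 1) ^ k)"
  proof (rule of_nat_mono)
    have "card ?S \<le> card {d\<in>words ?r m. repeated {1..?r} d}"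
      by (intro card_mono) (auto simp: closed_words_def)
    then show "card ?S \<le> 4 ^ ?r\<^sup>2 * (2 * N + 1) ^ k"
      using card_repeated_odd[OF assms, of k] by simp
  qed
  then have "card ?S * (N * product_bound ?r) \<le> real (4 ^ ?r\<^sup>2 * (2 * N + 1) ^ k) * (N * product_bound ?r)"
    by (rule mult_right_mono) (use product_bound_nonneg in simp)
  finally show ?thesis by (simp add: mult_ac)
qed

definition pairing_count :: "nat \<Rightarrow> nat \<Rightarrow> nat \<Rightarrow> real" where
  "pairing_count k N m = (\<Sum>\<pi>\<in>pair_partitions (2 * k). \<Sum>x\<in>words k m. real (start_count N (2 * k) (pair_word k \<pi> x)))"

lemma finite_pair_partitions [simp]: "finite (pair_partitions n)"
  by (simp add: pair_partitions_eq finite_pairings)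

definition even_error :: "nat \<Rightarrow> real" where
  "even_error k = 4 ^ (2 * k)\<^sup>2 * product_bound (2 * k) + card (pair_partitions (2 * k)) * 4 ^ k\<^sup>2"

text \<open>The two sums differ by the words with repeated values that are not made of opposite pairs, and by the choices of
free values among which two have the same absolute value. Both have one degree of freedom less than the main
term.\<close>
lemma expectation_trace_sum_even:
  assumes mN: "m \<le> N"
  shows "norm (expectation (trace_sum N m (2 * k)) - of_real (pairing_count k N m)) * (2 * real N + 1)
    \<le> even_error k * N * (2 * real N + 1) ^ k"
proof -
  let ?I = "{1..2*k}" and ?P = "pair_partitions (2 * k)"
  let ?f = "\<lambda>d. of_nat (start_count N (2 * k) d) * expectation (entry_product ?I d)"
  let ?G = "{d\<in>words (2 * k) m. opposite_pairs ?I d}"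
  let ?B = "{d\<in>words (2 * k) m. (\<Sum>l=1..2*k. d l) = 0 \<and> repeated ?I d \<and> \<not> opposite_pairs ?I d}"
  let ?s = "\<lambda>d. real (start_count N (2 * k) d)"
  have "expectation (trace_sum N m (2 * k)) = (\<Sum>d\<in>?G \<union> ?B. ?f d)"
    unfolding expectation_trace_sum
  proof (rule sum.mono_neutral_right)
    show "?G \<union> ?B \<subseteq> closed_words (2 * k) m" by (auto simp: closed_words_def sum_opposite_pairs)
    show "\<forall>d\<in>closed_words (2 * k) m - (?G \<union> ?B). ?f d = 0"
    proof
      fix d assume "d \<in> closed_words (2 * k) m - (?G \<union> ?B)"
      then have "\<not> repeated ?I d" unfolding closed_words_def by blast
      then show "?f d = 0" using expectation_entry_product_not_repeated[of ?I d] by simp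
    qed
  qed simp
  also have "\<dots> = (\<Sum>d\<in>?G. ?f d) + (\<Sum>d\<in>?B. ?f d)" by (rule sum.union_disjoint) auto
  also have "(\<Sum>d\<in>?G. ?f d) = (\<Sum>d\<in>?G. of_real (?s d))"
  proof (intro sum.cong refl)
    fix d assume "d \<in> ?G"
    then have "opposite_pairs ?I d" by blast
    then have "expectation (entry_product ?I d) = 1"
      unfolding opposite_pairs_def by (intro expectation_entry_product_opposite_pairs) auto
    then show "?f d = of_real (?s d)" by simp
  qed
  also have "\<dots> = (\<Sum>(\<pi>, x)\<in>?P \<times> abs_inj_words k m. of_real (?s (pair_word k \<pi> x)))"
    using sum.reindex_bij_betw[OF bij_betw_pair_word, of "\<lambda>d. complex_of_real (?s d)" k m]
    by (simp add: case_prod_unfold)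
  also have "\<dots> = of_real (\<Sum>\<pi>\<in>?P. \<Sum>x\<in>abs_inj_words k m. ?s (pair_word k \<pi> x))"
    by (simp add: sum.cartesian_product case_prod_unfold)
  finally have E: "expectation (trace_sum N m (2 * k))
      = of_real (\<Sum>\<pi>\<in>?P. \<Sum>x\<in>abs_inj_words k m. ?s (pair_word k \<pi> x)) + (\<Sum>d\<in>?B. ?f d)" .
  have split: "(\<Sum>x\<in>words k m. ?s (pair_word k \<pi> x)) = (\<Sum>x\<in>abs_inj_words k m. ?s (pair_word k \<pi> x))
      + (\<Sum>x\<in>words k m - abs_inj_words k m. ?s (pair_word k \<pi> x))" for \<pi>
  proof -
    have "abs_inj_words k m \<subseteq> words k m" by (auto simp: abs_inj_words_def)
    from sum.subset_diff[OF this finite_words] show ?thesis by (simp only: add.commute)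
  qed
  define R where "R = (\<Sum>\<pi>\<in>?P. \<Sum>x\<in>words k m - abs_inj_words k m. ?s (pair_word k \<pi> x))"
  have "expectation (trace_sum N m (2 * k)) - of_real (pairing_count k N m) = (\<Sum>d\<in>?B. ?f d) - of_real R"
    unfolding E pairing_count_def split R_def by (simp add: sum.distrib)
  then have "norm (expectation (trace_sum N m (2 * k)) - of_real (pairing_count k N m)) \<le> norm (\<Sum>d\<in>?B. ?f d) + \<bar>R\<bar>"
    using norm_triangle_ineq4[of "\<Sum>d\<in>?B. ?f d" "of_real R"] by simp
  also have "norm (\<Sum>d\<in>?B. ?f d) \<le> card ?B * (N * product_bound (2 * k))"
    by (rule norm_weighted_sum_le) simp
  also have "\<bar>R\<bar> \<le> card ?P * (card (words k m - abs_inj_words k m) * N)"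
  proof -
    have "\<bar>R\<bar> = R" unfolding R_def by (intro abs_of_nonneg sum_nonneg) auto
    also have "\<dots> \<le> (\<Sum>\<pi>\<in>?P. \<Sum>x\<in>words k m - abs_inj_words k m. real N)"
      unfolding R_def by (intro sum_mono) (simp add: start_count_le)
    finally show ?thesis by simp
  qed
  finally have "norm (expectation (trace_sum N m (2 * k)) - of_real (pairing_count k N m)) * (2 * real N + 1)
     \<le> (card ?B * (N * product_bound (2 * k)) + card ?P * (card (words k m - abs_inj_words k m) * N)) * (2 * real N + 1)"
    by (simp add: mult_right_mono)
  also have "\<dots> = real (card ?B * (2 * N + 1)) * (N * product_bound (2 * k))
     + real (card (words k m - abs_inj_words k m) * (2 * N + 1)) * (card ?P * N)"
    by (simp add: algebra_simps)
  also have "\<dots> \<le> real (4 ^ (2 * k)\<^sup>2 * (2 * N + 1) ^ k) * (N * product_bound (2 * k))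
     + real (4 ^ k\<^sup>2 * (2 * N + 1) ^ k) * (card ?P * N)"
    using card_repeated_not_opposite[OF mN, of k] card_not_abs_inj_words[OF mN, of k] product_bound_nonneg
    by (intro add_mono mult_right_mono of_nat_mono) auto
  also have "\<dots> = even_error k * N * (2 * real N + 1) ^ k"
    by (simp add: even_error_def algebra_simps)
  finally show ?thesis .
qed

end

lemma pairing_count_tendsto:
  assumes lim: "(\<lambda>N. real (bN N) / real N) \<longlonglongrightarrow> b"
  shows "(\<lambda>N. (\<Sum>\<pi>\<in>pair_partitions (2 * k). \<Sum>x\<in>words k (bN N). real (start_count N (2 * k) (pair_word k \<pi> x)))
      / real N ^ (k + 1)) \<longlonglongrightarrow> b ^ k * (\<Sum>\<pi>\<in>pair_partitions (2 * k). partition_integral b k \<pi>)"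
proof -
  have each: "(\<lambda>N. (\<Sum>x\<in>words k (bN N). real (start_count N (2 * k) (pair_word k \<pi> x))) / real N ^ (k + 1))
      \<longlonglongrightarrow> b ^ k * partition_integral b k \<pi>" if \<pi>: "\<pi> \<in> pair_partitions (2 * k)" for \<pi>
  proof -
    have eq: "start_count N (2 * k) (pair_word k \<pi> x) = start_count N (2 * k) (\<lambda>i. int_sign \<pi> i * x (block_number \<pi> i))" for N x
      by (rule start_count_cong) (simp add: pair_word_def)
    have \<beta>: "\<And>i. i \<in> {1..2 * k} \<Longrightarrow> block_number \<pi> i \<in> {1..k}"
      by (rule block_number_range[OF \<pi>])
    have "limit_integrand (2 * k) (int_sign \<pi>) (block_number \<pi>) b = (\<lambda>y. \<Prod>j=1..2*k.
        indicator {0..1} (y 0 + b * (\<Sum>i=1..j. block_sign \<pi> i * y (block_number \<pi> i))))"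
      by (rule ext) (simp only: limit_integrand_def[OF \<beta>] real_partial_sum_def[OF \<beta>] block_sign_eq)
    then have "partition_integral b k \<pi> = (LINT y : (PiE {0..k} (\<lambda>l. if l = 0 then {0..1} else {-1..1})) | lebesgue_power k.
        limit_integrand (2 * k) (int_sign \<pi>) (block_number \<pi>) b y)"
      by (simp only: partition_integral_def)
    then show ?thesis
      unfolding eq using normalized_start_counts_tendsto[OF \<beta> lim, where s = "int_sign \<pi>"] by simp
  qed
  have "(\<lambda>N. \<Sum>\<pi>\<in>pair_partitions (2 * k). (\<Sum>x\<in>words k (bN N). real (start_count N (2 * k) (pair_word k \<pi> x))) / real N ^ (k + 1))
      \<longlonglongrightarrow> (\<Sum>\<pi>\<in>pair_partitions (2 * k). b ^ k * partition_integral b k \<pi>)"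
    by (intro tendsto_sum each)
  then show ?thesis by (simp add: sum_divide_distrib sum_distrib_left)
qed

lemma (in prob_space) AE_tendsto_0_if_fourth_moments_summable:
  fixes U :: "nat \<Rightarrow> 'a \<Rightarrow> real"
  assumes int: "\<And>n. integrable M (\<lambda>\<omega>. U n \<omega> ^ 4)" and meas: "\<And>n. U n \<in> borel_measurable M"
    and le: "\<And>n. expectation (\<lambda>\<omega>. U n \<omega> ^ 4) \<le> c n" and sm: "summable c"
  shows "AE \<omega> in M. (\<lambda>n. U n \<omega>) \<longlonglongrightarrow> 0"
proof -
  have meas4: "(\<lambda>\<omega>. U n \<omega> ^ 4) \<in> borel_measurable M" for n using meas by simp
  have pos: "0 \<le> U n \<omega> ^ 4" for n \<omega> by (rule zero_le_even_power) simp
  have "summable (\<lambda>n. expectation (\<lambda>\<omega>. U n \<omega> ^ 4))"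
    by (rule summable_comparison_test_ev[OF _ sm])
       (auto intro!: always_eventually simp: integral_nonneg_AE pos le abs_of_nonneg)
  then have "(\<Sum>n. ennreal (expectation (\<lambda>\<omega>. U n \<omega> ^ 4))) \<noteq> \<infinity>"
    unfolding infinity_ennreal_def by (rule ennreal_suminf_neq_top) (simp add: integral_nonneg_AE pos)
  also have "(\<Sum>n. ennreal (expectation (\<lambda>\<omega>. U n \<omega> ^ 4))) = (\<Sum>n. \<integral>\<^sup>+\<omega>. ennreal (U n \<omega> ^ 4) \<partial>M)"
    by (subst nn_integral_eq_integral) (auto simp: int pos)
  also have "\<dots> = (\<integral>\<^sup>+\<omega>. (\<Sum>n. ennreal (U n \<omega> ^ 4)) \<partial>M)"
    using meas4 by (intro nn_integral_suminf[symmetric]) auto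
  finally have "AE \<omega> in M. (\<Sum>n. ennreal (U n \<omega> ^ 4)) \<noteq> \<infinity>"
    using meas4 by (intro nn_integral_PInf_AE) auto
  then show ?thesis
  proof eventually_elim
    case (elim \<omega>)
    then have "summable (\<lambda>n. U n \<omega> ^ 4)" by (intro summable_suminf_not_top pos) simp
    then have "(\<lambda>n. U n \<omega> ^ 4) \<longlonglongrightarrow> 0" by (rule summable_LIMSEQ_zero)
    then show ?case by simp
  qed
qed

section \<open>Almost sure convergence of the spectral moments\<close>

locale band_toeplitz_sequence = independent_toeplitz_entries M a
  for M :: "'w measure" and a :: "int \<Rightarrow> 'w \<Rightarrow> complex" +
  fixes b :: real and bN :: "nat \<Rightarrow> nat"
  assumes b_pos: "0 < b" and b_le: "b \<le> 1" and bN_less: "\<And>N. N \<ge> 1 \<Longrightarrow> bN N < N"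
    and bN_lim: "(\<lambda>N. real (bN N) / real N) \<longlonglongrightarrow> b"
begin

definition scale :: "nat \<Rightarrow> real" where
  "scale N = 1 / sqrt ((2 - b) * b * real N)"

definition scaled_matrix :: "nat \<Rightarrow> 'w \<Rightarrow> complex Matrix.mat" where
  "scaled_matrix N \<omega> = complex_of_real (scale N) \<cdot>\<^sub>m band_toeplitz N (bN N) (\<lambda>j. a j \<omega>)"

abbreviation spectral_moment :: "nat \<Rightarrow> nat \<Rightarrow> 'w \<Rightarrow> real" where
  "spectral_moment N r \<omega> \<equiv> (\<integral>x. x ^ r \<partial>eigenvalue_distribution (scaled_matrix N \<omega>))"

text \<open>The expectation is real (\<open>expectation_trace_sum_real\<close>); the real part only changes its type.\<close>
definition mean_moment :: "nat \<Rightarrow> nat \<Rightarrow> real" where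
  "mean_moment N r = scale N ^ r / N * Re (expectation (trace_sum N (bN N) r))"

definition limit_moments :: "nat \<Rightarrow> real" where
  "limit_moments r = (if even r then limit_moment b (r div 2) else 0)"

lemma variance_pos: "0 < (2 - b) * b"
  using b_pos b_le by simp

lemma scale_nonneg: "0 \<le> scale N" and scale_square: "scale N ^ (2 * k) = 1 / ((2 - b) * b * N) ^ k"
proof -
  have "0 \<le> (2 - b) * b * N" using variance_pos by simp
  then show "0 \<le> scale N" "scale N ^ (2 * k) = 1 / ((2 - b) * b * N) ^ k"
    by (simp_all add: scale_def power_mult power_divide)
qed

lemma scale_tendsto_0: "scale \<longlonglongrightarrow> 0"
proof -
  have "(\<lambda>N. sqrt (1 / ((2 - b) * b) * (1 / real N))) \<longlonglongrightarrow> sqrt (1 / ((2 - b) * b) * 0)"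
    by (intro tendsto_intros lim_1_over_n)
  moreover have "sqrt (1 / ((2 - b) * b) * (1 / real N)) = scale N" for N
    by (simp add: scale_def real_sqrt_divide)
  ultimately show ?thesis by simp
qed

lemma two_N_plus_1_power_le: "N \<ge> 1 \<Longrightarrow> (2 * real N + 1) ^ k \<le> 3 ^ k * real N ^ k"
  unfolding power_mult_distrib[symmetric] by (intro power_mono) auto

lemma bN_le: "N \<ge> 1 \<Longrightarrow> bN N \<le> N"
  using bN_less by (simp add: less_imp_le)

lemma scaled_matrix_carrier: "scaled_matrix N \<omega> \<in> carrier_mat N N"
  by (simp add: scaled_matrix_def)

lemma scaled_matrix_hermitian:
  assumes "\<omega> \<in> space M" "i < N" "j < N"
  shows "scaled_matrix N \<omega> $$ (j, i) = cnj (scaled_matrix N \<omega> $$ (i, j))"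
proof -
  have "a (int j - int i) \<omega> = cnj (a (int i - int j) \<omega>)"
    using conj_sym[OF assms(1), of "int i - int j"] by simp
  moreover have "\<bar>int j - int i\<bar> = \<bar>int i - int j\<bar>" by simp
  ultimately show ?thesis using assms(2,3) by (simp add: scaled_matrix_def band_toeplitz_def)
qed

lemma spectral_moment_trace:
  assumes "N \<ge> 1" "\<omega> \<in> space M"
  shows "integrable (eigenvalue_distribution (scaled_matrix N \<omega>)) (\<lambda>x. x ^ r)"
    and "of_real (real N * spectral_moment N r \<omega>) = of_real (scale N) ^ r * trace_sum N (bN N) r \<omega>"
proof -
  note * = eigenvalue_distribution_moment[OF scaled_matrix_carrier assms(1) scaled_matrix_hermitian[OF assms(2)]]
  show "integrable (eigenvalue_distribution (scaled_matrix N \<omega>)) (\<lambda>x. x ^ r)" by (rule *(1))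
  have "of_real (real N * spectral_moment N r \<omega>) = mat_trace (scaled_matrix N \<omega> ^\<^sub>m r)"
    using *(2) by simp
  also have "\<dots> = of_real (scale N) ^ r * mat_trace (band_toeplitz N (bN N) (\<lambda>j. a j \<omega>) ^\<^sub>m r)"
  proof -
    let ?T = "band_toeplitz N (bN N) (\<lambda>j. a j \<omega>)"
    have "?T ^\<^sub>m r \<in> carrier_mat N N" by simp
    then show ?thesis
      unfolding scaled_matrix_def pow_mat_smult[OF band_toeplitz_carrier] mat_trace_def
      using carrier_matD[OF band_toeplitz_carrier[of N "bN N" "\<lambda>j. a j \<omega>"]]
      by (auto simp: sum_distrib_left intro!: sum.cong)
  qed
  finally show "of_real (real N * spectral_moment N r \<omega>) = of_real (scale N) ^ r * trace_sum N (bN N) r \<omega>"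
    unfolding trace_sum_eq .
qed

text \<open>A trace of a power of a Hermitian matrix is a sum of powers of real eigenvalues.\<close>
lemma trace_sum_real:
  assumes N: "N \<ge> 1" and \<omega>: "\<omega> \<in> space M"
  shows "trace_sum N (bN N) r \<omega> \<in> \<real>"
proof -
  have "scale N \<noteq> 0" using variance_pos N b_pos b_le by (simp add: scale_def)
  then have "trace_sum N (bN N) r \<omega> = of_real (real N * spectral_moment N r \<omega>) / of_real (scale N) ^ r"
    using spectral_moment_trace(2)[OF N \<omega>, of r] by simp
  also have "\<dots> = of_real (real N * spectral_moment N r \<omega> / scale N ^ r)" by simp
  finally show ?thesis by (metis Reals_of_real)
qed

lemma expectation_trace_sum_real:
  assumes N: "N \<ge> 1"
  shows "expectation (trace_sum N (bN N) r) \<in> \<real>"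
proof -
  have "expectation (trace_sum N (bN N) r) = expectation (\<lambda>\<omega>. complex_of_real (Re (trace_sum N (bN N) r \<omega>)))"
    using trace_sum_real[OF N] by (intro Bochner_Integration.integral_cong) (auto simp: of_real_Re)
  also have "\<dots> = of_real (expectation (\<lambda>\<omega>. Re (trace_sum N (bN N) r \<omega>)))"
    by (rule integral_complex_of_real)
  finally show ?thesis by (metis Reals_of_real)
qed

definition moment_fluctuation :: "nat \<Rightarrow> nat \<Rightarrow> 'w \<Rightarrow> real" where
  "moment_fluctuation N r \<omega> = scale N ^ r / N * Re (trace_fluctuation N (bN N) r \<omega>)"

lemma spectral_moment_split:
  assumes N: "N \<ge> 1" and \<omega>: "\<omega> \<in> space M"
  shows "spectral_moment N r \<omega> = mean_moment N r + moment_fluctuation N r \<omega>"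
proof -
  have "real N * spectral_moment N r \<omega> = Re (of_real (real N * spectral_moment N r \<omega>))"
    by (rule Re_complex_of_real[symmetric])
  also have "\<dots> = scale N ^ r * Re (trace_sum N (bN N) r \<omega>)"
    unfolding spectral_moment_trace(2)[OF N \<omega>] by (simp flip: of_real_power)
  finally have "spectral_moment N r \<omega> = scale N ^ r / N * Re (trace_sum N (bN N) r \<omega>)"
    using N by (simp add: field_simps)
  then show ?thesis
    by (simp add: mean_moment_def moment_fluctuation_def trace_fluctuation_eq algebra_simps)
qed

lemma trace_fluctuation_real:
  assumes "N \<ge> 1" "\<omega> \<in> space M"
  shows "trace_fluctuation N (bN N) r \<omega> = of_real (Re (trace_fluctuation N (bN N) r \<omega>))"
  using trace_sum_real[OF assms] expectation_trace_sum_real[OF assms(1)]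
  by (simp add: trace_fluctuation_eq of_real_Re Reals_diff)

lemma measurable_trace_fluctuation: "trace_fluctuation N m r \<in> borel_measurable M"
  unfolding trace_fluctuation_def[abs_def]
proof (intro borel_measurable_sum borel_measurable_times borel_measurable_const)
  show "centred_product {1..r} d \<in> borel_measurable M" for d :: "nat \<Rightarrow> int"
    using all_moments_centred[of "{1..r}" d] unfolding all_moments_def by blast
qed

text \<open>As the fluctuation is real, its fourth power is the fourth power of the complex fluctuation, to which the count
of linked words applies.\<close>
lemma moment_fluctuation_fourth_moment:
  assumes N: "N \<ge> 1"
  shows "integrable M (\<lambda>\<omega>. moment_fluctuation N r \<omega> ^ 4)"
    and "expectation (\<lambda>\<omega>. moment_fluctuation N r \<omega> ^ 4)
      \<le> centred_bound r * 4 ^ (4 * r)\<^sup>2 * (3 / ((2 - b) * b)) ^ (2 * r) * (1 / real N ^ 2)"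
proof -
  let ?F = "trace_fluctuation N (bN N) r"
  have ReF: "Re (?F \<omega>) ^ 4 = Re (?F \<omega> ^ 4)" if "\<omega> \<in> space M" for \<omega>
    using trace_fluctuation_real[OF N that, of r] by (metis Re_complex_of_real of_real_power)
  have eq: "moment_fluctuation N r \<omega> ^ 4 = (scale N ^ r / N) ^ 4 * Re (?F \<omega> ^ 4)" if "\<omega> \<in> space M" for \<omega>
    using ReF[OF that] by (simp add: moment_fluctuation_def power_mult_distrib power_divide)
  have int: "integrable M (\<lambda>\<omega>. (scale N ^ r / N) ^ 4 * Re (?F \<omega> ^ 4))"
    using integrable_trace_fluctuation_power4 by (intro integrable_mult_right integrable_Re)
  show "integrable M (\<lambda>\<omega>. moment_fluctuation N r \<omega> ^ 4)"
    using int by (subst Bochner_Integration.integrable_cong[OF refl eq]) auto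
  define K where "K = centred_bound r * 4 ^ (4 * r)\<^sup>2"
  have K: "K \<ge> 0" using centred_bound_nonneg[of r] by (simp add: K_def)
  let ?V = "(2 - b) * b"
  have "expectation (\<lambda>\<omega>. moment_fluctuation N r \<omega> ^ 4) = (scale N ^ r / N) ^ 4 * expectation (\<lambda>\<omega>. Re (?F \<omega> ^ 4))"
    using integrable_trace_fluctuation_power4
    by (subst Bochner_Integration.integral_cong[OF refl eq]) (auto simp: integrable_Re)
  also have "expectation (\<lambda>\<omega>. Re (?F \<omega> ^ 4)) = Re (expectation (\<lambda>\<omega>. ?F \<omega> ^ 4))"
    by (rule integral_Re[OF integrable_trace_fluctuation_power4])
  also have "(scale N ^ r / N) ^ 4 * \<dots> \<le> (scale N ^ r / N) ^ 4 * (K * real N ^ 4 * (3 ^ (2 * r) * real N ^ (2 * r)) / real N ^ 2)"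
  proof (rule mult_left_mono)
    have "norm (expectation (\<lambda>\<omega>. ?F \<omega> ^ 4)) * real N ^ 2 \<le> norm (expectation (\<lambda>\<omega>. ?F \<omega> ^ 4)) * (2 * real N + 1)\<^sup>2"
      by (intro mult_left_mono power_mono) auto
    also have "\<dots> \<le> K * real N ^ 4 * (2 * real N + 1) ^ (2 * r)"
      using trace_fluctuation_fourth_moment[OF bN_le[OF N], of r] by (simp add: K_def)
    also have "\<dots> \<le> K * real N ^ 4 * (3 ^ (2 * r) * real N ^ (2 * r))"
      using K two_N_plus_1_power_le[OF N, of "2 * r"] by (intro mult_left_mono) auto
    finally have "norm (expectation (\<lambda>\<omega>. ?F \<omega> ^ 4)) \<le> K * real N ^ 4 * (3 ^ (2 * r) * real N ^ (2 * r)) / real N ^ 2"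
      using N by (simp add: pos_le_divide_eq)
    then show "Re (expectation (\<lambda>\<omega>. ?F \<omega> ^ 4)) \<le> K * real N ^ 4 * (3 ^ (2 * r) * real N ^ (2 * r)) / real N ^ 2"
      using complex_Re_le_cmod order_trans by blast
  qed simp
  also have "(scale N ^ r / N) ^ 4 = 1 / ((?V * N) ^ (2 * r) * real N ^ 4)"
  proof -
    have "(scale N ^ r / N) ^ 4 = scale N ^ (2 * (2 * r)) / real N ^ 4"
      by (simp add: power_divide mult.commute flip: power_mult)
    then show ?thesis by (simp only: scale_square) simp
  qed
  also have "1 / ((?V * N) ^ (2 * r) * real N ^ 4) * (K * real N ^ 4 * (3 ^ (2 * r) * real N ^ (2 * r)) / real N ^ 2)
      = K * (3 / ?V) ^ (2 * r) * (1 / real N ^ 2)"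
  proof -
    have "?V ^ (2 * r) \<noteq> 0" "real N \<noteq> 0" using variance_pos N by auto
    then show ?thesis unfolding power_mult_distrib power_divide by (simp add: divide_simps)
  qed
  finally show "expectation (\<lambda>\<omega>. moment_fluctuation N r \<omega> ^ 4)
      \<le> centred_bound r * 4 ^ (4 * r)\<^sup>2 * (3 / ?V) ^ (2 * r) * (1 / real N ^ 2)"
    by (simp add: K_def)
qed

lemma AE_moment_fluctuation_tendsto_0: "AE \<omega> in M. \<forall>r. (\<lambda>N. moment_fluctuation N r \<omega>) \<longlonglongrightarrow> 0"
  unfolding AE_all_countable
proof
  fix r
  define C where "C = centred_bound r * 4 ^ (4 * r)\<^sup>2 * (3 / ((2 - b) * b)) ^ (2 * r)"
  have "AE \<omega> in M. (\<lambda>N. moment_fluctuation (Suc N) r \<omega>) \<longlonglongrightarrow> 0"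
  proof (rule AE_tendsto_0_if_fourth_moments_summable[where c = "\<lambda>N. C * (1 / real (Suc N) ^ 2)"])
    fix N
    show "integrable M (\<lambda>\<omega>. moment_fluctuation (Suc N) r \<omega> ^ 4)"
      "expectation (\<lambda>\<omega>. moment_fluctuation (Suc N) r \<omega> ^ 4) \<le> C * (1 / real (Suc N) ^ 2)"
      unfolding C_def by (intro moment_fluctuation_fourth_moment; simp)+
    show "moment_fluctuation (Suc N) r \<in> borel_measurable M"
      unfolding moment_fluctuation_def[abs_def] using measurable_trace_fluctuation by measurable
  next
    have "summable (\<lambda>N. 1 / real N ^ 2)" using inverse_power_summable[of 2] by (simp add: divide_inverse power_inverse)
    then have "summable (\<lambda>N. 1 / real (Suc N) ^ 2)" by (subst summable_Suc_iff)
    then show "summable (\<lambda>N. C * (1 / real (Suc N) ^ 2))" by (rule summable_mult)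
  qed
  then show "AE \<omega> in M. (\<lambda>N. moment_fluctuation N r \<omega>) \<longlonglongrightarrow> 0"
    by eventually_elim (rule LIMSEQ_imp_Suc)
qed

lemma mean_moment_even_tendsto: "(\<lambda>N. mean_moment N (2 * k)) \<longlonglongrightarrow> limit_moment b k"
proof -
  let ?V = "(2 - b) * b"
  define p where "p N = pairing_count k N (bN N)" for N
  have "(\<lambda>N. p N / real N ^ (k + 1)) \<longlonglongrightarrow> b ^ k * (\<Sum>\<pi>\<in>pair_partitions (2 * k). partition_integral b k \<pi>)"
    unfolding p_def pairing_count_def by (rule pairing_count_tendsto[OF bN_lim])
  then have main: "(\<lambda>N. 1 / ?V ^ k * (p N / real N ^ (k + 1))) \<longlonglongrightarrow>
      1 / ?V ^ k * (b ^ k * (\<Sum>\<pi>\<in>pair_partitions (2 * k). partition_integral b k \<pi>))"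
    by (rule tendsto_mult_left)
  have lim_eq: "1 / ?V ^ k * (b ^ k * (\<Sum>\<pi>\<in>pair_partitions (2 * k). partition_integral b k \<pi>)) = limit_moment b k"
    using b_pos by (simp add: limit_moment_def power_mult_distrib)
  have mean: "mean_moment N (2 * k) = 1 / ?V ^ k * (Re (expectation (trace_sum N (bN N) (2 * k))) / real N ^ (k + 1))" for N
    by (simp add: mean_moment_def scale_square power_mult_distrib)
  define C where "C = 1 / ?V ^ k * (even_error k * 3 ^ k)"
  have "(\<lambda>N. mean_moment N (2 * k) - 1 / ?V ^ k * (p N / real N ^ (k + 1))) \<longlonglongrightarrow> 0"
  proof (rule Lim_null_comparison)
    have "(\<lambda>N. C * (1 / real N)) \<longlonglongrightarrow> C * 0" by (intro tendsto_intros lim_1_over_n)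
    then show "(\<lambda>N. C * (1 / real N)) \<longlonglongrightarrow> 0" by simp
    show "\<forall>\<^sub>F N in sequentially. norm (mean_moment N (2 * k) - 1 / ?V ^ k * (p N / real N ^ (k + 1))) \<le> C * (1 / real N)"
      using eventually_ge_at_top[of "1::nat"]
    proof eventually_elim
      case (elim N)
      let ?E = "expectation (trace_sum N (bN N) (2 * k))"
      have ee: "0 \<le> even_error k" using product_bound_nonneg[of "2 * k"] by (simp add: even_error_def)
      have "\<bar>Re ?E - p N\<bar> * real N \<le> norm (?E - of_real (p N)) * (2 * real N + 1)"
        using abs_Re_le_cmod[of "?E - of_real (p N)"] by (intro mult_mono) auto
      also have "\<dots> \<le> even_error k * N * (2 * real N + 1) ^ k"
        unfolding p_def by (rule expectation_trace_sum_even[OF bN_le[OF elim]])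
      also have "\<dots> \<le> even_error k * N * (3 ^ k * real N ^ k)"
        using two_N_plus_1_power_le[OF elim, of k] ee by (intro mult_left_mono) auto
      finally have *: "\<bar>Re ?E - p N\<bar> \<le> even_error k * 3 ^ k * real N ^ k"
        using elim by (simp add: algebra_simps)
      have "\<bar>mean_moment N (2 * k) - 1 / ?V ^ k * (p N / real N ^ (k + 1))\<bar> = 1 / ?V ^ k * (\<bar>Re ?E - p N\<bar> / real N ^ (k + 1))"
      proof -
        have "mean_moment N (2 * k) - 1 / ?V ^ k * (p N / real N ^ (k + 1)) = 1 / ?V ^ k * ((Re ?E - p N) / real N ^ (k + 1))"
          unfolding mean by (simp only: diff_divide_distrib right_diff_distrib)
        then show ?thesis using variance_pos by (simp add: abs_mult)
      qed
      also have "\<dots> \<le> 1 / ?V ^ k * (even_error k * 3 ^ k * real N ^ k / real N ^ (k + 1))"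
        using * variance_pos by (intro mult_left_mono divide_right_mono) auto
      also have "\<dots> = C * (1 / real N)" using elim by (simp add: C_def)
      finally show ?case by simp
    qed
  qed
  from tendsto_add[OF this main[unfolded lim_eq]] show ?thesis by simp
qed

lemma mean_moment_odd_tendsto: "(\<lambda>N. mean_moment N (2 * k + 1)) \<longlonglongrightarrow> 0"
proof (rule Lim_null_comparison)
  let ?V = "(2 - b) * b"
  define C where "C = 4 ^ (2 * k + 1)\<^sup>2 * product_bound (2 * k + 1) * 3 ^ k / ?V ^ k"
  have "(\<lambda>N. C * scale N) \<longlonglongrightarrow> C * 0" by (intro tendsto_intros scale_tendsto_0)
  then show "(\<lambda>N. C * scale N) \<longlonglongrightarrow> 0" by simp
  show "\<forall>\<^sub>F N in sequentially. norm (mean_moment N (2 * k + 1)) \<le> C * scale N"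
    using eventually_ge_at_top[of "1::nat"]
  proof eventually_elim
    case (elim N)
    let ?E = "expectation (trace_sum N (bN N) (2 * k + 1))"
    let ?K = "4 ^ (2 * k + 1)\<^sup>2 * product_bound (2 * k + 1)"
    have K: "0 \<le> ?K" using product_bound_nonneg by simp
    have "\<bar>Re ?E\<bar> \<le> ?K * N * (2 * real N + 1) ^ k"
      using order_trans[OF abs_Re_le_cmod expectation_trace_sum_odd[OF bN_le[OF elim], of k]]
      by (simp add: add_ac)
    also have "\<dots> \<le> ?K * N * (3 ^ k * real N ^ k)"
      using two_N_plus_1_power_le[OF elim, of k] K by (intro mult_left_mono) auto
    finally have *: "\<bar>Re ?E\<bar> \<le> ?K * N * (3 ^ k * real N ^ k)" .
    have "norm (mean_moment N (2 * k + 1)) = scale N * scale N ^ (2 * k) / N * \<bar>Re ?E\<bar>"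
      using scale_nonneg by (simp add: mean_moment_def abs_mult)
    also have "\<dots> \<le> scale N * scale N ^ (2 * k) / N * (?K * N * (3 ^ k * real N ^ k))"
      using * scale_nonneg by (intro mult_left_mono) auto
    also have "\<dots> = C * scale N"
      unfolding scale_square C_def using elim variance_pos by (simp add: power_mult_distrib)
    finally show ?case .
  qed
qed

lemma mean_moment_tendsto: "(\<lambda>N. mean_moment N r) \<longlonglongrightarrow> limit_moments r"
proof (cases "even r")
  case True
  then obtain k where "r = 2 * k" by auto
  then show ?thesis using mean_moment_even_tendsto[of k] by (simp add: limit_moments_def)
next
  case False
  then obtain k where "r = 2 * k + 1" by (auto elim: oddE)
  then show ?thesis using mean_moment_odd_tendsto[of k] by (simp add: limit_moments_def)
qed

lemma limit_moments_growth: "(\<lambda>k. t ^ (2 * k) / fact (2 * k) * limit_moments (2 * k)) \<longlonglongrightarrow> 0"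
  using limit_moment_growth[OF b_le, of t] by (simp add: limit_moments_def)

lemma AE_spectral_moments_tendsto:
  "AE \<omega> in M. \<forall>r. (\<lambda>N. spectral_moment (Suc N) r \<omega>) \<longlonglongrightarrow> limit_moments r"
  using AE_moment_fluctuation_tendsto_0 AE_space
proof eventually_elim
  case (elim \<omega>)
  show ?case
  proof
    fix r
    have "(\<lambda>N. mean_moment (Suc N) r + moment_fluctuation (Suc N) r \<omega>) \<longlonglongrightarrow> limit_moments r + 0"
      using elim by (intro tendsto_add LIMSEQ_Suc mean_moment_tendsto) auto
    then show "(\<lambda>N. spectral_moment (Suc N) r \<omega>) \<longlonglongrightarrow> limit_moments r"
      using spectral_moment_split[OF _ elim(2)] by simp
  qed
qed

section \<open>The limit distribution\<close>

text \<open>The odd moments exist because they are dominated by even ones, and vanish by symmetry.\<close>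
lemma limit_distribution_all_moments:
  assumes "is_limit_distribution b \<gamma>"
  shows "has_bochner_integral \<gamma> (\<lambda>x. x ^ r) (limit_moments r)"
proof (cases "even r")
  case True
  then show ?thesis using assms by (auto simp: is_limit_distribution_def limit_moments_def)
next
  case False
  interpret \<gamma>: real_distribution \<gamma> using assms by (simp add: is_limit_distribution_def)
  have sym: "distr \<gamma> borel uminus = \<gamma>" using assms by (simp add: is_limit_distribution_def)
  have int2: "integrable \<gamma> (\<lambda>x. x ^ (2 * r))"
    using assms by (auto simp: is_limit_distribution_def has_bochner_integral_iff)
  have int: "integrable \<gamma> (\<lambda>x. x ^ r)"
  proof (rule Bochner_Integration.integrable_bound[where f = "\<lambda>x. 1 + x ^ (2 * r)"])
    show "AE x in \<gamma>. norm (x ^ r) \<le> norm (1 + x ^ (2 * r))"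
    proof (rule AE_I2)
      fix x :: real
      have "0 \<le> (x ^ r)\<^sup>2 - 2 * \<bar>x ^ r\<bar> + 1"
        using zero_le_power2[of "\<bar>x ^ r\<bar> - 1"] by (simp add: power2_diff)
      moreover have "(x ^ r)\<^sup>2 = x ^ (2 * r)" by (simp add: mult.commute flip: power_mult)
      ultimately show "norm (x ^ r) \<le> norm (1 + x ^ (2 * r))"
        using abs_ge_zero[of "x ^ r"] zero_le_power2[of "x ^ r"] by simp
    qed
  qed (use int2 in auto)
  have "(\<integral>x. x ^ r \<partial>\<gamma>) = (\<integral>x. x ^ r \<partial>distr \<gamma> borel uminus)" by (simp add: sym)
  also have "\<dots> = (\<integral>x. (- x) ^ r \<partial>\<gamma>)" by (rule integral_distr) auto
  also have "\<dots> = - (\<integral>x. x ^ r \<partial>\<gamma>)" using False by simp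
  finally show ?thesis using int False by (simp add: has_bochner_integral_iff limit_moments_def)
qed

lemma limit_distribution_unique:
  "is_limit_distribution b \<gamma> \<Longrightarrow> is_limit_distribution b \<gamma>' \<Longrightarrow> \<gamma>' = \<gamma>"
  by (rule distribution_eqI_moments[OF _ _ _ _ limit_moments_growth])
     (auto simp: limit_distribution_all_moments is_limit_distribution_def)

lemma is_limit_distribution_if_moments:
  assumes \<gamma>: "real_distribution \<gamma>" "\<And>r. has_bochner_integral \<gamma> (\<lambda>x. x ^ r) (limit_moments r)"
  shows "is_limit_distribution b \<gamma>"
proof -
  interpret \<gamma>: real_distribution \<gamma> by fact
  have "distr \<gamma> borel uminus = \<gamma>"
  proof (rule distribution_eqI_moments[OF _ _ \<gamma> limit_moments_growth])
    show "real_distribution (distr \<gamma> borel uminus)"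
      by (rule \<gamma>.real_distribution_distr) simp
    fix r
    have int: "integrable \<gamma> (\<lambda>x. x ^ r)" and eq: "(\<integral>x. x ^ r \<partial>\<gamma>) = limit_moments r"
      using \<gamma>(2)[of r] by (auto simp: has_bochner_integral_iff)
    have sgn: "(- x) ^ r = (if even r then x ^ r else - (x ^ r))" for x :: real by simp
    have "integrable (distr \<gamma> borel uminus) (\<lambda>x. x ^ r)"
      using int by (subst integrable_distr_eq) (cases "even r"; simp)+
    moreover have "(\<integral>x. x ^ r \<partial>distr \<gamma> borel uminus) = (\<integral>x. (- x) ^ r \<partial>\<gamma>)"
      by (rule integral_distr) auto
    moreover have "\<dots> = limit_moments r"
      using eq by (auto simp: sgn limit_moments_def)
    ultimately show "has_bochner_integral (distr \<gamma> borel uminus) (\<lambda>x. x ^ r) (limit_moments r)"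
      by (simp add: has_bochner_integral_iff)
  qed
  moreover have "has_bochner_integral \<gamma> (\<lambda>x. x ^ (2 * k)) (limit_moment b k)" for k
    using \<gamma>(2)[of "2 * k"] by (simp add: limit_moments_def)
  ultimately show ?thesis using \<gamma>(1) by (simp add: is_limit_distribution_def)
qed

text \<open>The limit is obtained for each outcome separately, and its uniqueness shows that it does not depend on the
outcome. The moments are considered from \<open>N = 1\<close> on, as there are no eigenvalues for \<open>N =
0\<close>.\<close>
lemma AE_converges_to_limit_distribution:
  "AE \<omega> in M. \<exists>\<gamma>. is_limit_distribution b \<gamma> \<and>
     weak_conv_m (\<lambda>N. eigenvalue_distribution (scaled_matrix N \<omega>)) \<gamma>"
  using AE_spectral_moments_tendsto AE_space
proof eventually_elim
  case (elim \<omega>)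
  have "\<exists>\<gamma>. real_distribution \<gamma> \<and> (\<forall>k. has_bochner_integral \<gamma> (\<lambda>x. x ^ k) (limit_moments k)) \<and>
      weak_conv_m (\<lambda>N. eigenvalue_distribution (scaled_matrix (Suc N) \<omega>)) \<gamma>"
    using elim spectral_moment_trace(1)[OF _ elim(2)]
    by (intro weak_conv_of_moments limit_moments_growth real_distribution_eigenvalue_distribution) auto
  then obtain \<gamma> where \<gamma>: "real_distribution \<gamma>" "\<And>k. has_bochner_integral \<gamma> (\<lambda>x. x ^ k) (limit_moments k)"
    "weak_conv_m (\<lambda>N. eigenvalue_distribution (scaled_matrix (Suc N) \<omega>)) \<gamma>" by blast
  have "weak_conv_m (\<lambda>N. eigenvalue_distribution (scaled_matrix N \<omega>)) \<gamma>"
    using \<gamma>(3) unfolding weak_conv_m_def weak_conv_def by (blast intro: LIMSEQ_imp_Suc)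
  then show ?case using is_limit_distribution_if_moments[OF \<gamma>(1,2)] by blast
qed

theorem band_toeplitz_limit:
  "\<exists>\<gamma>. is_limit_distribution b \<gamma> \<and> (\<forall>\<gamma>'. is_limit_distribution b \<gamma>' \<longrightarrow> \<gamma>' = \<gamma>) \<and>
    (AE \<omega> in M. weak_conv_m (\<lambda>N. eigenvalue_distribution (scaled_matrix N \<omega>)) \<gamma>)"
proof -
  have "\<exists>\<omega> \<gamma>. is_limit_distribution b \<gamma> \<and> weak_conv_m (\<lambda>N. eigenvalue_distribution (scaled_matrix N \<omega>)) \<gamma>"
  proof (rule ccontr)
    assume "\<not> ?thesis"
    then have "AE \<omega> in M. False"
      by (intro eventually_mono[OF AE_converges_to_limit_distribution]) blast
    then show False by simp
  qed
  then obtain \<gamma> where \<gamma>: "is_limit_distribution b \<gamma>" by blast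
  have "AE \<omega> in M. weak_conv_m (\<lambda>N. eigenvalue_distribution (scaled_matrix N \<omega>)) \<gamma>"
    using AE_converges_to_limit_distribution
    by eventually_elim (metis limit_distribution_unique \<gamma>)
  then show ?thesis using \<gamma> limit_distribution_unique by blast
qed

end

theorem theorem2p2:
  fixes b :: real and bN :: "nat \<Rightarrow> nat"
    and M :: "'w measure" and a :: "int \<Rightarrow> 'w \<Rightarrow> complex"
  assumes "0 < b" and "b \<le> 1"
    and "\<And>N. N \<ge> 1 \<Longrightarrow> bN N < N"
    and "(\<lambda>N. real (bN N) / real N) \<longlonglongrightarrow> b"
    and "hermitian_toeplitz_entries M a \<or> symmetric_toeplitz_entries M a"
  shows "\<exists>\<gamma>. is_limit_distribution b \<gamma> \<and>
    (\<forall>\<gamma>'. is_limit_distribution b \<gamma>' \<longrightarrow> \<gamma>' = \<gamma>) \<and>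
    (AE \<omega> in M. weak_conv_m
       (\<lambda>N. eigenvalue_distribution
          (complex_of_real (1 / sqrt ((2 - b) * b * real N)) \<cdot>\<^sub>m
             band_toeplitz N (bN N) (\<lambda>j. a j \<omega>))) \<gamma>)"
proof -
  have "independent_toeplitz_entries M a"
    using assms(5) hermitian_imp_independent_entries symmetric_imp_independent_entries by blast
  then interpret band_toeplitz_sequence M a b bN
    using assms(1-4) by (simp add: band_toeplitz_sequence_def band_toeplitz_sequence_axioms_def)
  show ?thesis using band_toeplitz_limit unfolding scaled_matrix_def scale_def .
qed

end
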